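(* Let $d\ge2$, let $\mathcal C_d$ be the cell containing the origin $\mathbf o$ of the ideal Poisson–Voronoi tessellation $\mathcal V_d$ of $\mathbb H_d$, let $R_1$ be the radius of the corresponding ideal nucleus, and let $B_u(\mathbf o)$ be the ball centered at $\mathbf o$ with hyperbolic radius $u\ge 0$. Then: (i) conditionally on $R_1=s$, $\ \mathbb P[B_u(\mathbf o)\subset\mathcal C_d\mid R_1=s]=\exp(-s\,I_d(u))$; (ii) averaging over the value of $R_1$, $\ \mathbb P[B_u(\mathbf o)\subset\mathcal C_d]=\dfrac1{1+I_d(u)}$. Here $$I_d(u)=\frac{2(d-1)}{c_d}\int_{\mathbb R^{d-1}}\mathrm dx\int_{\mathbb R_+}\frac{\mathrm d\rho}{\rho^{2d-1}}\,\mathbf 1_{(\rho+\sinh u)^2\ge|x|^2+\cosh^2u}\,\mathbf 1_{\rho^2\le1+|x|^2}$$ satisfies $$1+I_d(u)=\frac{2^{d-1}\Gamma(d/2)}{\sqrt\pi\,\Gamma(\frac{d-1}2)}(\cosh u)^{1-d}\int_0^1\frac{t^{d-2}(1-t^2)^{\frac{d-3}2}}{(1-t\tanh u)^{2d-2}}\,\mathrm dt.$$ In particular, $\mathbb P[B_u(\mathbf o)\subset\mathcal C_d\mid R_1=s]\le e^{-s(d-1)u}$ and $\mathbb P[B_u(\mathbf o)\subset\mathcal C_d]\le e^{-(d-1)u}$; that is, the distance from $\mathbf o$ to the boundary of $\mathcal C_d$ is stochastically dominated by an $\mathrm{Exp}(s(d-1))$ random variable conditionally on $R_1=s$, and by an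 $\mathrm{Exp}(d-1)$ random variable unconditionally. Also $\mathbb P[B_u(\mathbf o)\subset\mathcal C_d]\ge e^{-2(d-1)u}$; that is, the distance from $\mathbf o$ to the boundary of $\mathcal C_d$ stochastically dominates an $\mathrm{Exp}(2(d-1))$ random variable.
   Context: $\mathrm{Exp}(a)$ is the exponential law with rate $a$. $c_d=2^{2-d}\pi^{d/2}/\Gamma(d/2)$. Ideal Poisson–Voronoi tessellation $\mathcal V_d$: use the ball model of $\mathbb H_d$ with origin $\mathbf o=0$ and ideal boundary $\mathbb S_{d-1}$. For $\theta\in\mathbb S_{d-1}$ let $\mathrm d_\theta(z)=\lim_{x\to\theta}\big(d_{\mathbb H_d}(x,z)-d_{\mathbb H_d}(x,\mathbf o)\big)$. Let $(\Theta_i)_{i\ge1}$ be i.i.d. uniform on $\mathbb S_{d-1}$, and independently let $R_1<R_2<\cdots$ be the points of a unit-intensity homogeneous Poisson point process on $\mathbb R_+$; define $D_i$ by $R_i=\frac{c_d}{d-1}e^{(d-1)D_i}$. The cells of $\mathcal V_d$ are $C_i=\{z\in\mathbb H_d: \mathrm d_{\Theta_i}(z)+D_i\le \mathrm d_{\Theta_j}(z)+D_j\ \forall j\ne i\}$; the pairs $(\Theta_i,R_i)$ are the ideal nuclei (angle, radius). The zero cell is $\mathcal C_d=C_1$, and $R_1\sim\mathrm{Exp}(1)$. *)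

theory Defs
  imports "HOL-Probability.Probability"
begin

text \<open>
  Hyperbolic space is the open unit ball \<^term>\<open>ball 0 1\<close> of a Euclidean space of dimension $d$,
  with curvature $-1$.  The induced topology is the Euclidean one.
\<close>

definition hyp_dist :: "'a::euclidean_space \<Rightarrow> 'a \<Rightarrow> real" where
  "hyp_dist x y = arcosh (1 + 2 * (norm (x - y))\<^sup>2 / ((1 - (norm x)\<^sup>2) * (1 - (norm y)\<^sup>2)))"

definition hyp_cball :: "'a::euclidean_space \<Rightarrow> real \<Rightarrow> 'a set" where
  "hyp_cball x u = {z \<in> ball 0 1. hyp_dist x z \<le> u}"

definition horofunction :: "'a::euclidean_space \<Rightarrow> 'a \<Rightarrow> real" where
  "horofunction \<theta> z = Lim (at \<theta> within ball 0 1) (\<lambda>x. hyp_dist x z - hyp_dist x 0)"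

text \<open>
  As $C$ lies in the open unit ball, its boundary in hyperbolic space is the part of the Euclidean
  frontier inside the ball.  The infimum is taken in \<^typ>\<open>ereal\<close>, so that the distance to an empty
  boundary is $\infty$.
\<close>

definition origin_boundary_dist :: "'a::euclidean_space set \<Rightarrow> ereal" where
  "origin_boundary_dist C = (INF z \<in> frontier C \<inter> ball 0 1. ereal (hyp_dist 0 z))"

text \<open>
  Normalised surface measure on the unit sphere, as the cone measure: a Borel set $A$ of directions
  receives the proportion of the volume of the unit ball lying in the cone over $A$.
\<close>

definition sphere_uniform :: "'a::euclidean_space measure" where
  "sphere_uniform = distr (uniform_measure lborel (ball 0 1)) borel (\<lambda>x. x /\<^sub>R norm x)"

text \<open>
  \<open>R 0 < R 1 < \<dots>\<close> are the points of a homogeneous Poisson point process of intensity 1 on the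
  positive half-line: the number of points in a Borel set of finite Lebesgue measure has the Poisson
  law with that measure as parameter, and the numbers of points in disjoint sets are independent.
  As \<^const>\<open>card\<close> is 0 on infinite sets, finiteness is required explicitly.
\<close>

definition unit_poisson_points :: "'w measure \<Rightarrow> (nat \<Rightarrow> 'w \<Rightarrow> real) \<Rightarrow> bool" where
  "unit_poisson_points M R \<longleftrightarrow>
     (\<forall>i. R i \<in> borel_measurable M) \<and>
     (\<forall>\<omega>\<in>space M. (\<forall>i. 0 < R i \<omega>) \<and> strict_mono (\<lambda>i. R i \<omega>)) \<and>
     (\<forall>A k. A \<in> sets borel \<and> A \<subseteq> {0..} \<and> emeasure lborel A < \<infinity> \<longrightarrow>
        measure M {\<omega> \<in> space M. finite {i. R i \<omega> \<in> A} \<and> card {i. R i \<omega> \<in> A} = k} =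
          measure lborel A ^ k / fact k * exp (- measure lborel A)) \<and>
     (\<forall>(A :: nat \<Rightarrow> real set) n.
        (\<forall>j<n. A j \<in> sets borel \<and> A j \<subseteq> {0..} \<and> emeasure lborel (A j) < \<infinity>) \<and>
        disjoint_family_on A {..<n} \<longrightarrow>
        prob_space.indep_vars M (\<lambda>_. count_space UNIV) (\<lambda>j \<omega>. card {i. R i \<omega> \<in> A j}) {..<n})"

text \<open>
  The angles \<open>\<Theta>\<close> and radii \<open>R\<close> of the ideal nuclei, indexed from 0: \<open>(\<Theta> 0, R 0)\<close> is the nucleus
  $(\Theta_1, R_1)$ of the zero cell.
\<close>

definition ideal_nuclei ::
    "'w measure \<Rightarrow> (nat \<Rightarrow> 'w \<Rightarrow> 'a::euclidean_space) \<Rightarrow> (nat \<Rightarrow> 'w \<Rightarrow> real) \<Rightarrow> bool" where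
  "ideal_nuclei M \<Theta> R \<longleftrightarrow>
     prob_space M \<and>
     (\<forall>i. \<Theta> i \<in> borel_measurable M \<and> (\<forall>\<omega>\<in>space M. \<Theta> i \<omega> \<in> sphere 0 1) \<and>
          distr M borel (\<Theta> i) = sphere_uniform) \<and>
     prob_space.indep_vars M (\<lambda>_. borel) \<Theta> UNIV \<and>
     unit_poisson_points M R \<and>
     prob_space.indep_set M
       (sets (vimage_algebra (space M) (\<lambda>\<omega> i. \<Theta> i \<omega>) (PiM UNIV (\<lambda>_::nat. borel))))
       (sets (vimage_algebra (space M) (\<lambda>\<omega> i. R i \<omega>) (PiM UNIV (\<lambda>_::nat. borel))))"

definition c_const :: "nat \<Rightarrow> real" where
  "c_const d = 2 powr (2 - real d) * pi powr (real d / 2) / Gamma (real d / 2)"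

text \<open>The delay $D$ of a nucleus of radius $r$; it is determined by the equation in
  \<open>radius_eq_delay\<close> below.\<close>

definition delay :: "nat \<Rightarrow> real \<Rightarrow> real" where
  "delay d r = ln ((real d - 1) * r / c_const d) / (real d - 1)"

lemma radius_eq_delay:
  assumes "2 \<le> d" "0 < r"
  shows "r = c_const d / (real d - 1) * exp ((real d - 1) * delay d r)"
proof -
  have "0 < c_const d"
    using assms by (auto simp: c_const_def intro!: divide_pos_pos mult_pos_pos Gamma_real_pos)
  then show ?thesis
    using assms by (simp add: delay_def)
qed

definition ipvt_cell ::
    "(nat \<Rightarrow> 'a::euclidean_space) \<Rightarrow> (nat \<Rightarrow> real) \<Rightarrow> nat \<Rightarrow> 'a set" where
  "ipvt_cell \<theta> r i = {z \<in> ball 0 1. \<forall>j. j \<noteq> i \<longrightarrow>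
     horofunction (\<theta> i) z + delay DIM('a) (r i) \<le> horofunction (\<theta> j) z + delay DIM('a) (r j)}"

definition zero_cell ::
    "(nat \<Rightarrow> 'w \<Rightarrow> 'a::euclidean_space) \<Rightarrow> (nat \<Rightarrow> 'w \<Rightarrow> real) \<Rightarrow> 'w \<Rightarrow> 'a set" where
  "zero_cell \<Theta> R \<omega> = ipvt_cell (\<lambda>i. \<Theta> i \<omega>) (\<lambda>i. R i \<omega>) 0"

definition ball_in_zero_cell ::
    "'w measure \<Rightarrow> (nat \<Rightarrow> 'w \<Rightarrow> 'a::euclidean_space) \<Rightarrow> (nat \<Rightarrow> 'w \<Rightarrow> real) \<Rightarrow> real \<Rightarrow> 'w set" where
  "ball_in_zero_cell M \<Theta> R u = {\<omega> \<in> space M. hyp_cball 0 u \<subseteq> zero_cell \<Theta> R \<omega>}"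

text \<open>The conditional probability of \<open>E\<close> given the random variable \<open>X\<close>, as a random variable: its
  value at \<open>\<omega>\<close> is $P[E \mid X = s]$ for \<open>s = X \<omega>\<close>, up to null sets.\<close>

definition cond_prob_given :: "'w measure \<Rightarrow> ('w \<Rightarrow> real) \<Rightarrow> 'w set \<Rightarrow> 'w \<Rightarrow> real" where
  "cond_prob_given M X E = real_cond_exp M (vimage_algebra (space M) X borel) (indicator E)"

text \<open>\<open>K s\<close> is the law of \<open>Y\<close> conditionally on \<open>X = s\<close>.\<close>

definition regular_cond_law ::
    "'w measure \<Rightarrow> ('w \<Rightarrow> real) \<Rightarrow> ('w \<Rightarrow> ereal) \<Rightarrow> (real \<Rightarrow> ereal measure) \<Rightarrow> bool" where
  "regular_cond_law M X Y K \<longleftrightarrow>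
     X \<in> borel_measurable M \<and> Y \<in> borel_measurable M \<and> K \<in> borel \<rightarrow>\<^sub>M prob_algebra borel \<and>
     (\<forall>A\<in>sets borel. \<forall>B\<in>sets borel.
        measure M {\<omega> \<in> space M. X \<omega> \<in> A \<and> Y \<omega> \<in> B} =
          (LINT s:A|distr M borel X. measure (K s) B))"

definition Exp_law :: "real \<Rightarrow> ereal measure" where
  "Exp_law a = distr (density lborel (exponential_density a)) borel ereal"

text \<open>\<open>\<mu>\<close> is stochastically dominated by \<open>\<nu>\<close>.\<close>

definition stoch_le :: "ereal measure \<Rightarrow> ereal measure \<Rightarrow> bool" where
  "stoch_le \<mu> \<nu> \<longleftrightarrow> (\<forall>x. measure \<mu> {x<..} \<le> measure \<nu> {x<..})"

text \<open>Lebesgue measure on $R^{d-1}$ is rendered as the product measure over the index set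
  \<open>{..<d - 1}\<close>, so that $d$ may be an arbitrary number.\<close>

definition I_fun :: "nat \<Rightarrow> real \<Rightarrow> real" where
  "I_fun d u = 2 * (real d - 1) / c_const d *
     (\<integral>x. (LINT \<rho>:{0<..}|lborel. 1 / \<rho> ^ (2 * d - 1) *
              of_bool ((\<rho> + sinh u)\<^sup>2 \<ge> (\<Sum>i<d - 1. (x i)\<^sup>2) + (cosh u)\<^sup>2) *
              of_bool (\<rho>\<^sup>2 \<le> 1 + (\<Sum>i<d - 1. (x i)\<^sup>2)))
         \<partial>(\<Pi>\<^sub>M i\<in>{..<d - 1}. lborel))"

end

theory Submission
  imports Defs
begin

text \<open>
  The horofunction of the ball model is $\mathrm d_\theta(z) = \ln (|z - \theta|^2 / (1 - |z|^2))$.  A point \<open>z\<close> therefore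
  prefers the nucleus $(\Theta_1, R_1)$ of the zero cell, which has index 0 below, to $(\Theta_j, R_j)$ if and only if
  $(|z - \Theta_1| / |z - \Theta_j|)^{2(d-1)} \le R_j / R_1$.  The supremum of the left side over the ball $B_u(\mathbf o)$ is
  $W_j = (\sqrt{1 + \tau^2} + \tau)^{2(d-1)}$ with $\tau = \sinh u \, |\Theta_j - \Theta_1| / 2$ (\<open>apollonius_ball_iff\<close>).  So the ball lies
  in the zero cell if and only if $R_j \ge R_1 W_j$ for all $j \ne 1$ (\<open>hyp_cball_subset_cell_iff\<close>).

  Conditionally on $R_1 = s$, the other nuclei form a Poisson process of unit intensity on
  $(s, \infty)$ with independent uniform angles.  The mean number of them with $R_j < s W_j$ is
  $s (E W - 1)$, where $W$ has the common law of the $W_j$; by rotation invariance the angle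
  $\Theta_1$ does not matter.  Hence the conditional probability is $e^{-s (E W - 1)}$, and integrating against the
  exponential law of $R_1$ gives $1 / E W$.  The process is given by its counts, so instead of
  conditioning, the probability that the ball lies in the cell and $a < R_1 \le b$ is squeezed between
  two expressions that are asymptotic to $(b - a) e^{-a E W}$ as $b \to a$ (\<open>prob_increment_bounds\<close>).  This identifies
  the density of $R_1$ on the event (\<open>emeasure_ball_event_first\<close>).

  It remains to see that $E W = 1 + I_d(u)$.  Under stereographic projection the uniform law on the
  sphere has density $(1 + |x|^2)^{1-d} / c_d$ (\<open>nn_integral_sphere_uniform_stereographic\<close>), and the inner
  integral in the definition of $I_d(u)$ is this density multiplied by $c_d (W - 1) / (2(d-1))$
  (\<open>nn_integral_busemann_factor\<close>).  A substitution then gives the second formula (\<open>I_fun_beta_integral\<close>).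
  For the bounds, $W \le e^{2(d-1)u}$ always, and for two antipodal angles the product of the two values
  of $W$ is at least $e^{2(d-1)u}$, so that their average is at least $e^{(d-1)u}$ (\<open>I_fun_bounds\<close>).

  Finally, the zero cell is relatively closed, so the distance from the origin to its boundary is at
  least \<open>u\<close> if and only if it contains $B_u(\mathbf o)$ (\<open>origin_boundary_dist_ge_iff\<close>).  The conditional law
  of that distance given $R_1 = s$ is realised as the law of $I_d^{-1}(V/s)$ for a standard exponential
  $V$ (\<open>dist_kernel\<close>), and the domination statements are the bounds on $I_d$ in terms of tails.
\<close>

section \<open>Horofunctions and hyperbolic balls\<close>

text \<open>
  Both distances tend to infinity, but each is the logarithm of a function of \<open>x\<close> divided by
  $1 - |x|^2$.  The divergent denominators cancel in the difference, and the numerators (\<open>h\<close> below)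
  extend continuously to the boundary.
\<close>

lemma horofunction_tendsto:
  fixes \<theta> z :: "'a::euclidean_space"
  assumes \<theta>: "norm \<theta> = 1" and z: "norm z < 1"
  shows "((\<lambda>x. hyp_dist x z - hyp_dist x 0) \<longlongrightarrow> ln ((norm (z - \<theta>))\<^sup>2 / (1 - (norm z)\<^sup>2)))
           (at \<theta> within ball 0 1)"
proof -
  \<comment> \<open>\<open>p x y / (1 - (norm x)\<^sup>2)\<close> is half the excess over 1 of the argument of arcosh.\<close>
  define p where "p x y = (norm (x - y))\<^sup>2 / (1 - (norm y)\<^sup>2)" for x y :: 'a
  define h where "h x y = (1 - (norm x)\<^sup>2) + 2 * p x y
      + 2 * sqrt ((p x y)\<^sup>2 + (1 - (norm x)\<^sup>2) * p x y)" for x y :: 'a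
  have sq1: "(norm y)\<^sup>2 < 1" if "norm y < 1" for y :: 'a
    using that by (simp add: abs_square_less_1)
  have p_nonneg: "0 \<le> p x y" if "norm y < 1" for x y
    using sq1[OF that] by (simp add: p_def)
  have h_pos: "0 < h x y" if "norm x < 1" "norm y < 1" for x y
    unfolding h_def using sq1[OF that(1)] p_nonneg[OF that(2), of x]
    by (intro add_pos_nonneg) auto
  have hyp: "hyp_dist x y = ln (h x y) - ln (1 - (norm x)\<^sup>2)"
    if x: "norm x < 1" and y: "norm y < 1" for x y
  proof -
    define \<delta> where "\<delta> = 1 - (norm x)\<^sup>2"
    have \<delta>: "0 < \<delta>" using sq1[OF x] by (simp add: \<delta>_def)
    have arg: "1 + 2 * (norm (x - y))\<^sup>2 / ((1 - (norm x)\<^sup>2) * (1 - (norm y)\<^sup>2)) = 1 + 2 * p x y / \<delta>"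
      using \<delta> by (simp add: p_def \<delta>_def mult.commute)
    have "sqrt ((1 + 2 * p x y / \<delta>)\<^sup>2 - 1) = sqrt (((p x y)\<^sup>2 + \<delta> * p x y) * (2 / \<delta>)\<^sup>2)"
      using \<delta> by (intro arg_cong[where f = sqrt]) (simp add: field_simps power2_eq_square)
    also have "\<dots> = 2 * sqrt ((p x y)\<^sup>2 + \<delta> * p x y) / \<delta>"
      using \<delta> by (simp add: real_sqrt_mult real_sqrt_divide)
    finally have "hyp_dist x y = ln (1 + 2 * p x y / \<delta> + 2 * sqrt ((p x y)\<^sup>2 + \<delta> * p x y) / \<delta>)"
      using \<delta> p_nonneg[OF y, of x]
      unfolding hyp_dist_def arg by (subst arcosh_real_def) auto
    also have "1 + 2 * p x y / \<delta> + 2 * sqrt ((p x y)\<^sup>2 + \<delta> * p x y) / \<delta> = h x y / \<delta>"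
      using \<delta> unfolding h_def \<delta>_def[symmetric] by (simp add: add_divide_distrib)
    also have "ln (h x y / \<delta>) = ln (h x y) - ln \<delta>"
      using \<delta> h_pos[OF x y] by (simp add: ln_div)
    finally show ?thesis by (simp add: \<delta>_def)
  qed
  have zz: "1 - (norm z)\<^sup>2 \<noteq> 0" using sq1[OF z] by simp
  have ne: "z \<noteq> \<theta>" using \<theta> z by auto
  have lim: "((\<lambda>x. h x y) \<longlongrightarrow> h \<theta> y) (at \<theta> within ball 0 1)" if "norm y < 1" for y
    unfolding h_def p_def using sq1[OF that] by (intro tendsto_intros) auto
  have h\<theta>: "h \<theta> y = 4 * p \<theta> y" if "norm y < 1" for y
    using \<theta> p_nonneg[OF that, of \<theta>] by (simp add: h_def)
  have pos: "0 < p \<theta> y" if "norm y < 1" for y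
    using sq1[OF that] \<theta> that by (auto simp: p_def intro!: divide_pos_pos)
  have "((\<lambda>x. ln (h x z) - ln (h x 0)) \<longlongrightarrow> ln (h \<theta> z) - ln (h \<theta> 0)) (at \<theta> within ball 0 1)"
    using h\<theta>[OF z] h\<theta>[of 0] pos[OF z] pos[of 0] by (intro tendsto_diff tendsto_ln lim z) auto
  also have "ln (h \<theta> z) - ln (h \<theta> 0) = ln (p \<theta> z)"
  proof -
    have "ln (h \<theta> z) = ln 4 + ln (p \<theta> z)"
      unfolding h\<theta>[OF z] using pos[OF z] by (subst ln_mult) auto
    moreover have "h \<theta> 0 = 4" using h\<theta>[of 0] \<theta> by (simp add: p_def)
    ultimately show ?thesis by simp
  qed
  finally have "((\<lambda>x. ln (h x z) - ln (h x 0)) \<longlongrightarrow> ln (p \<theta> z)) (at \<theta> within ball 0 1)" .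
  moreover have "\<forall>\<^sub>F x in at \<theta> within ball 0 1. ln (h x z) - ln (h x 0) = hyp_dist x z - hyp_dist x 0"
    using z by (auto simp: eventually_at_filter hyp)
  ultimately show ?thesis
    unfolding p_def norm_minus_commute[of z \<theta>] by (rule Lim_transform_eventually)
qed

lemma horofunction_eq:
  fixes \<theta> z :: "'a::euclidean_space"
  assumes "norm \<theta> = 1" "norm z < 1"
  shows "horofunction \<theta> z = ln ((norm (z - \<theta>))\<^sup>2 / (1 - (norm z)\<^sup>2))"
  unfolding horofunction_def
proof (rule tendsto_Lim[OF _ horofunction_tendsto[OF assms]])
  have "\<theta> \<in> cball 0 1" using assms by simp
  then have "\<theta> islimpt ball 0 1"
    by (subst islimpt_ball) auto
  then show "at \<theta> within ball 0 1 \<noteq> bot"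
    by (simp add: trivial_limit_within)
qed

lemma hyp_dist_origin:
  fixes z :: "'a::euclidean_space"
  assumes "norm z < 1"
  shows "hyp_dist 0 z = arcosh ((1 + (norm z)\<^sup>2) / (1 - (norm z)\<^sup>2))"
proof -
  have "(norm z)\<^sup>2 < 1" using assms by (simp add: abs_square_less_1)
  then show ?thesis by (simp add: hyp_dist_def field_simps)
qed

text \<open>
  The Euclidean radius is $\tanh(u/2)$, written without half arguments because only \<open>sinh u\<close> and
  \<open>cosh u\<close> occur in the later algebra.
\<close>

lemma hyp_dist_origin_le_iff:
  fixes z :: "'a::euclidean_space"
  assumes z: "norm z < 1" and u: "0 \<le> u"
  shows "hyp_dist 0 z \<le> u \<longleftrightarrow> norm z \<le> sinh u / (1 + cosh u)"
proof -
  define t where "t = norm z"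
  have t: "0 \<le> t" "t\<^sup>2 < 1" using z by (auto simp: t_def abs_square_less_1)
  have c: "cosh u \<ge> 1" by (rule cosh_real_ge_1)
  have ge1: "(1 + t\<^sup>2) / (1 - t\<^sup>2) \<ge> 1" using t by (simp add: field_simps)
  have "hyp_dist 0 z \<le> u \<longleftrightarrow> (1 + t\<^sup>2) / (1 - t\<^sup>2) \<le> cosh u"
  proof -
    have nn: "0 \<le> arcosh ((1 + t\<^sup>2) / (1 - t\<^sup>2))"
      by (rule arcosh_nonneg_real[OF ge1])
    have ch: "cosh (arcosh ((1 + t\<^sup>2) / (1 - t\<^sup>2))) = (1 + t\<^sup>2) / (1 - t\<^sup>2)"
      by (rule cosh_arcosh_real[OF ge1])
    show ?thesis
      unfolding hyp_dist_origin[OF z] t_def[symmetric]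
      using cosh_real_nonneg_le_iff[OF nn u] ch by simp
  qed
  also have "\<dots> \<longleftrightarrow> t\<^sup>2 * (1 + cosh u) \<le> cosh u - 1"
    using t by (simp add: field_simps)
  also have "\<dots> \<longleftrightarrow> t\<^sup>2 * (1 + cosh u)\<^sup>2 \<le> (cosh u - 1) * (1 + cosh u)"
  proof -
    have "(t\<^sup>2 * (1 + cosh u)) * (1 + cosh u) \<le> (cosh u - 1) * (1 + cosh u)
        \<longleftrightarrow> t\<^sup>2 * (1 + cosh u) \<le> cosh u - 1"
      using c by (intro mult_le_cancel_right_pos) simp
    then show ?thesis by (simp only: power2_eq_square mult.assoc)
  qed
  also have "(cosh u - 1) * (1 + cosh u) = (sinh u)\<^sup>2"
    using cosh_square_eq[of u] by (simp add: algebra_simps power2_eq_square)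
  also have "t\<^sup>2 * (1 + cosh u)\<^sup>2 \<le> (sinh u)\<^sup>2 \<longleftrightarrow> t * (1 + cosh u) \<le> sinh u"
    unfolding power_mult_distrib[symmetric] using t c u by (intro power_mono_iff) auto
  also have "\<dots> \<longleftrightarrow> t \<le> sinh u / (1 + cosh u)"
    using c by (simp add: field_simps)
  finally show ?thesis by (simp add: t_def)
qed

lemma euclidean_radius_less_1: "0 \<le> u \<Longrightarrow> sinh u / (1 + cosh u) < (1::real)"
proof -
  assume "0 \<le> u"
  have "sinh u < cosh u" by (simp add: sinh_less_cosh_real)
  then show ?thesis using cosh_real_ge_1[of u] by (simp add: field_simps)
qed

lemma hyp_cball_origin:
  assumes "0 \<le> u"
  shows "hyp_cball (0::'a::euclidean_space) u = cball 0 (sinh u / (1 + cosh u))"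
proof -
  have "norm z < 1 \<and> hyp_dist 0 z \<le> u \<longleftrightarrow> norm z \<le> sinh u / (1 + cosh u)" for z :: 'a
    using hyp_dist_origin_le_iff[OF _ assms, of z] euclidean_radius_less_1[OF assms] by linarith
  then show ?thesis unfolding hyp_cball_def mem_ball_0 set_eq_iff mem_Collect_eq mem_cball_0 by blast
qed

section \<open>Balls contained in a cell\<close>

text \<open>
  If \<open>\<theta>\<close> and \<open>\<phi>\<close> are unit vectors at Euclidean distance $2x$, this is the largest value of
  $\exp(\mathrm d_\theta - \mathrm d_\phi)$ on the hyperbolic ball of radius \<open>u\<close> around the origin.  It equals
  $e^{2w}$ for the number $w$ with $\sinh w = x \sinh u$.
\<close>

definition busemann_factor :: "real \<Rightarrow> real \<Rightarrow> real" where
  "busemann_factor u x = (sqrt (1 + (sinh u * x)\<^sup>2) + sinh u * x)\<^sup>2"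

lemma busemann_factor_pos: "0 < busemann_factor u x"
proof -
  have "0 < sqrt (1 + (sinh u * x)\<^sup>2) + sinh u * x"
  proof -
    have "- (sinh u * x) \<le> \<bar>sinh u * x\<bar>" by simp
    also have "\<dots> = sqrt ((sinh u * x)\<^sup>2)" by simp
    also have "\<dots> < sqrt (1 + (sinh u * x)\<^sup>2)" by (intro real_sqrt_less_mono) simp
    finally show ?thesis by simp
  qed
  then show ?thesis by (simp add: busemann_factor_def)
qed

text \<open>
  With $l = \sqrt\Lambda$ the left side says $l - 1/l \ge 2 x \sinh u$; squaring gives the right side, where
  $1 \le \Lambda$ keeps the sign.  In this polynomial form \<open>\<Lambda>\<close> appears in the geometric argument below.
\<close>

lemma busemann_factor_le_iff:
  assumes "0 \<le> u" "0 \<le> x" "0 < \<Lambda>"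
  shows "busemann_factor u x \<le> \<Lambda> \<longleftrightarrow> 1 \<le> \<Lambda> \<and> 4 * (sinh u * x)\<^sup>2 * \<Lambda> \<le> (\<Lambda> - 1)\<^sup>2"
proof -
  define \<tau> where "\<tau> = sinh u * x"
  define l where "l = sqrt \<Lambda>"
  have \<tau>: "0 \<le> \<tau>" using assms by (simp add: \<tau>_def)
  have l: "0 < l" "\<Lambda> = l\<^sup>2" using assms by (auto simp: l_def)
  have "busemann_factor u x \<le> \<Lambda> \<longleftrightarrow> sqrt (1 + \<tau>\<^sup>2) + \<tau> \<le> l"
    using \<tau> l by (simp add: busemann_factor_def \<tau>_def[symmetric] power_mono_iff)
  also have "\<dots> \<longleftrightarrow> sqrt (1 + \<tau>\<^sup>2) \<le> l - \<tau>" by auto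
  also have "\<dots> \<longleftrightarrow> 0 \<le> l - \<tau> \<and> 1 + \<tau>\<^sup>2 \<le> (l - \<tau>)\<^sup>2"
    by (auto intro: real_le_lsqrt dest: sqrt_le_D order_trans[OF real_sqrt_ge_zero, rotated])
  also have "\<dots> \<longleftrightarrow> \<tau> \<le> l \<and> 2 * \<tau> * l \<le> l\<^sup>2 - 1"
    by (auto simp: power2_eq_square algebra_simps)
  also have "\<dots> \<longleftrightarrow> 1 \<le> \<Lambda> \<and> 2 * \<tau> * l \<le> \<Lambda> - 1"
  proof -
    have "\<tau> \<le> l" if "2 * \<tau> * l \<le> l\<^sup>2 - 1"
    proof -
      have "0 \<le> \<tau> * l" using \<tau> l by simp
      then have "\<tau> * l \<le> l * l" using that by (simp add: power2_eq_square)
      then show ?thesis using l by simp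
    qed
    moreover have "1 \<le> \<Lambda>" if "2 * \<tau> * l \<le> \<Lambda> - 1"
      using that mult_nonneg_nonneg[OF \<tau> less_imp_le[OF l(1)]] by linarith
    ultimately show ?thesis using l by auto
  qed
  also have "\<dots> \<longleftrightarrow> 1 \<le> \<Lambda> \<and> (2 * \<tau> * l)\<^sup>2 \<le> (\<Lambda> - 1)\<^sup>2"
    using \<tau> l by (auto simp: power_mono_iff)
  also have "(2 * \<tau> * l)\<^sup>2 = 4 * \<tau>\<^sup>2 * \<Lambda>" using l by (simp add: power_mult_distrib)
  finally show ?thesis by (simp add: \<tau>_def)
qed

text \<open>
  For $|z| = t$ the inequality compares a constant with a linear form in \<open>z\<close>, so it is worst in the
  direction of $v = \Lambda\phi - \theta$.  What is left, $2 t |v| \le (\Lambda - 1)(1 + t^2)$, is most restrictive for the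
  largest \<open>t\<close>, because $t / (1 + t^2)$ increases on $[0,1]$; there $2t/(1+t^2) = \tanh u$.  Squaring and
  expanding $|v|^2$ leads to the condition of \<open>busemann_factor_le_iff\<close>.
\<close>

lemma apollonius_ball_iff:
  fixes \<theta> \<phi> :: "'a::euclidean_space"
  assumes \<theta>: "norm \<theta> = 1" and \<phi>: "norm \<phi> = 1" and u: "0 \<le> u" and \<Lambda>: "0 < \<Lambda>"
  shows "(\<forall>z\<in>cball 0 (sinh u / (1 + cosh u)). (norm (z - \<theta>))\<^sup>2 \<le> \<Lambda> * (norm (z - \<phi>))\<^sup>2)
          \<longleftrightarrow> busemann_factor u (norm (\<phi> - \<theta>) / 2) \<le> \<Lambda>"
proof -
  define \<rho> where "\<rho> = sinh u / (1 + cosh u)"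
  define v where "v = \<Lambda> *\<^sub>R \<phi> - \<theta>"
  have c1: "1 \<le> cosh u" by (rule cosh_real_ge_1)
  have s0: "0 \<le> sinh u" using u by simp
  have \<rho>: "0 \<le> \<rho>" "\<rho> < 1" using euclidean_radius_less_1[OF u] c1 s0 by (auto simp: \<rho>_def)
  have ss: "(sinh u)\<^sup>2 = (cosh u - 1) * (cosh u + 1)"
    using cosh_square_eq[of u] by (simp add: algebra_simps power2_eq_square)
  \<comment> \<open>The double argument formula for tanh, with denominators cleared.\<close>
  have \<rho>c: "2 * \<rho> * cosh u = (1 + \<rho>\<^sup>2) * sinh u"
  proof -
    have "\<rho>\<^sup>2 = (cosh u - 1) / (1 + cosh u)"
      using c1 unfolding \<rho>_def power_divide ss
      by (simp add: power2_eq_square add.commute)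
    then have "1 + \<rho>\<^sup>2 = 2 * cosh u / (1 + cosh u)" using c1 by (simp add: field_simps)
    then show ?thesis by (simp add: \<rho>_def)
  qed
  have diff: "(norm (z - \<theta>))\<^sup>2 - \<Lambda> * (norm (z - \<phi>))\<^sup>2 = (1 - \<Lambda>) * (1 + (norm z)\<^sup>2) + 2 * (z \<bullet> v)" for z
  proof -
    have "\<theta> \<bullet> \<theta> = 1" "\<phi> \<bullet> \<phi> = 1" using \<theta> \<phi> by (simp_all add: dot_square_norm)
    then show ?thesis
      unfolding power2_norm_eq_inner v_def by (simp add: algebra_simps inner_commute)
  qed
  \<comment> \<open>Only the distance between the two unit vectors enters.\<close>
  have nv: "(norm v)\<^sup>2 = (\<Lambda> - 1)\<^sup>2 + \<Lambda> * (norm (\<phi> - \<theta>))\<^sup>2"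
  proof -
    have "\<theta> \<bullet> \<theta> = 1" "\<phi> \<bullet> \<phi> = 1" using \<theta> \<phi> by (simp_all add: dot_square_norm)
    then show ?thesis
      unfolding power2_norm_eq_inner v_def
      by (simp add: algebra_simps inner_commute power2_eq_square)
  qed
  have "(\<forall>z\<in>cball 0 \<rho>. (norm (z - \<theta>))\<^sup>2 \<le> \<Lambda> * (norm (z - \<phi>))\<^sup>2)
      \<longleftrightarrow> 1 \<le> \<Lambda> \<and> 2 * \<rho> * norm v \<le> (\<Lambda> - 1) * (1 + \<rho>\<^sup>2)" (is "?L \<longleftrightarrow> ?R")
  proof
    assume L: ?L
    have "1 \<le> \<Lambda>" using bspec[OF L, of 0] \<rho> \<theta> \<phi> by simp
    moreover have "2 * \<rho> * norm v \<le> (\<Lambda> - 1) * (1 + \<rho>\<^sup>2)"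
    proof (cases "v = 0")
      case True then show ?thesis using \<open>1 \<le> \<Lambda>\<close> \<rho> by simp
    next
      case False
      define z where "z = (\<rho> / norm v) *\<^sub>R v"
      have "norm z = \<rho>" "z \<bullet> v = \<rho> * norm v"
        using False \<rho> by (simp_all add: z_def dot_square_norm power2_eq_square)
      then show ?thesis using bspec[OF L, of z] diff[of z] by (simp add: algebra_simps)
    qed
    ultimately show ?R ..
  next
    assume R: ?R
    show ?L
    proof
      fix z :: 'a assume "z \<in> cball 0 \<rho>"
      then have z: "norm z \<le> \<rho>" by simp
      have "(norm z) * (1 + \<rho>\<^sup>2) \<le> \<rho> * (1 + (norm z)\<^sup>2)"
      proof -
        have "0 \<le> (\<rho> - norm z) * (1 - \<rho> * norm z)"
          using z \<rho> by (intro mult_nonneg_nonneg) (auto intro!: mult_le_one)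
        then show ?thesis by (simp add: algebra_simps power2_eq_square)
      qed
      then have "(2 * norm v) * (norm z * (1 + \<rho>\<^sup>2)) \<le> (2 * norm v) * (\<rho> * (1 + (norm z)\<^sup>2))"
        by (intro mult_left_mono) auto
      also have "\<dots> = (2 * \<rho> * norm v) * (1 + (norm z)\<^sup>2)" by simp
      also have "\<dots> \<le> ((\<Lambda> - 1) * (1 + \<rho>\<^sup>2)) * (1 + (norm z)\<^sup>2)"
        using R by (intro mult_right_mono) auto
      finally have "(1 + \<rho>\<^sup>2) * (2 * norm z * norm v) \<le> (1 + \<rho>\<^sup>2) * ((\<Lambda> - 1) * (1 + (norm z)\<^sup>2))"
        by (simp only: mult_ac)
      then have "2 * norm z * norm v \<le> (\<Lambda> - 1) * (1 + (norm z)\<^sup>2)"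
        by (subst (asm) mult_le_cancel_left_pos) (auto intro: add_pos_nonneg)
      moreover have "2 * (z \<bullet> v) \<le> 2 * norm z * norm v"
        using norm_cauchy_schwarz[of z v] by simp
      ultimately show "(norm (z - \<theta>))\<^sup>2 \<le> \<Lambda> * (norm (z - \<phi>))\<^sup>2"
        using diff[of z] by (simp add: algebra_simps)
    qed
  qed
  also have "\<dots> \<longleftrightarrow> 1 \<le> \<Lambda> \<and> sinh u * norm v \<le> (\<Lambda> - 1) * cosh u"
  proof -
    have "2 * \<rho> * norm v \<le> (\<Lambda> - 1) * (1 + \<rho>\<^sup>2) \<longleftrightarrow>
          (2 * \<rho> * norm v) * cosh u \<le> ((\<Lambda> - 1) * (1 + \<rho>\<^sup>2)) * cosh u"
      using c1 by (intro mult_le_cancel_right_pos[symmetric]) simp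
    also have "(2 * \<rho> * norm v) * cosh u = (1 + \<rho>\<^sup>2) * (sinh u * norm v)"
      using arg_cong[OF \<rho>c, of "\<lambda>t. t * norm v"] by (simp add: mult_ac)
    also have "((\<Lambda> - 1) * (1 + \<rho>\<^sup>2)) * cosh u = (1 + \<rho>\<^sup>2) * ((\<Lambda> - 1) * cosh u)"
      by (simp only: mult_ac)
    also have "(1 + \<rho>\<^sup>2) * (sinh u * norm v) \<le> (1 + \<rho>\<^sup>2) * ((\<Lambda> - 1) * cosh u) \<longleftrightarrow>
        sinh u * norm v \<le> (\<Lambda> - 1) * cosh u"
      by (subst mult_le_cancel_left_pos) (auto intro: add_pos_nonneg)
    finally show ?thesis by simp
  qed
  also have "\<dots> \<longleftrightarrow> 1 \<le> \<Lambda> \<and> (sinh u * norm v)\<^sup>2 \<le> ((\<Lambda> - 1) * cosh u)\<^sup>2"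
    using s0 c1 by (intro conj_cong refl power_mono_iff[symmetric]) auto
  also have "\<dots> \<longleftrightarrow> 1 \<le> \<Lambda> \<and> 4 * (sinh u * (norm (\<phi> - \<theta>) / 2))\<^sup>2 * \<Lambda> \<le> (\<Lambda> - 1)\<^sup>2"
  proof -
    have "S * (L + \<Lambda> * N) \<le> L * (S + 1) \<longleftrightarrow> 4 * (S * (N / 4)) * \<Lambda> \<le> L" for S L N :: real
      by (simp add: algebra_simps)
    from this[of "(sinh u)\<^sup>2" "(\<Lambda> - 1)\<^sup>2" "(norm (\<phi> - \<theta>))\<^sup>2"] show ?thesis
      unfolding power_mult_distrib nv cosh_square_eq power_divide by simp
  qed
  also have "\<dots> \<longleftrightarrow> busemann_factor u (norm (\<phi> - \<theta>) / 2) \<le> \<Lambda>"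
    using busemann_factor_le_iff[OF u _ \<Lambda>, of "norm (\<phi> - \<theta>) / 2"] by simp
  finally show ?thesis by (simp add: \<rho>_def)
qed

text \<open>
  The constant $c_d$ in the delays and the factor $1 - |z|^2$ in the horofunctions are common to both
  nuclei and cancel.
\<close>

lemma cell_inequality_iff:
  fixes \<theta> \<phi> z :: "'a::euclidean_space"
  assumes d: "2 \<le> DIM('a)" and \<theta>: "norm \<theta> = 1" and \<phi>: "norm \<phi> = 1" and r: "0 < r" and s: "0 < s"
    and z: "norm z < 1"
  shows "horofunction \<theta> z + delay DIM('a) r \<le> horofunction \<phi> z + delay DIM('a) s
     \<longleftrightarrow> (norm (z - \<theta>))\<^sup>2 \<le> (s / r) powr (1 / (real DIM('a) - 1)) * (norm (z - \<phi>))\<^sup>2"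
proof -
  define n where "n = real DIM('a) - 1"
  define c where "c = c_const DIM('a)"
  define q where "q = 1 - (norm z)\<^sup>2"
  define a where "a = (norm (z - \<theta>))\<^sup>2"
  define b where "b = (norm (z - \<phi>))\<^sup>2"
  define \<Lambda> where "\<Lambda> = (s / r) powr (1 / n)"
  have n: "0 < n" using d by (simp add: n_def)
  have c: "0 < c"
    using d by (auto simp: c_def c_const_def intro!: divide_pos_pos mult_pos_pos Gamma_real_pos)
  have q: "0 < q" using z by (simp add: q_def abs_square_less_1)
  have ab: "0 < a" "0 < b" using \<theta> \<phi> z by (auto simp: a_def b_def)
  have \<Lambda>: "0 < \<Lambda>" using r s by (simp add: \<Lambda>_def)
  have "horofunction \<theta> z + delay DIM('a) r \<le> horofunction \<phi> z + delay DIM('a) s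
      \<longleftrightarrow> ln (a / q) + ln (n * r / c) / n \<le> ln (b / q) + ln (n * s / c) / n"
    using horofunction_eq[OF \<theta> z] horofunction_eq[OF \<phi> z]
    by (simp add: delay_def n_def c_def a_def b_def q_def)
  also have "\<dots> \<longleftrightarrow> ln a + ln r / n \<le> ln b + ln s / n"
    using n c r s q ab by (simp add: ln_div ln_mult diff_divide_distrib add_divide_distrib)
  also have "\<dots> \<longleftrightarrow> ln a \<le> ln (\<Lambda> * b)"
    using r s ab \<Lambda> n by (simp add: ln_mult \<Lambda>_def ln_powr ln_div diff_divide_distrib algebra_simps)
  also have "\<dots> \<longleftrightarrow> a \<le> \<Lambda> * b"
    using ab \<Lambda> by simp
  finally show ?thesis by (simp add: a_def b_def \<Lambda>_def n_def)
qed

text \<open>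
  The factor compares squared distances, and the radius of a nucleus grows like the $(d-1)$-st power of
  the exponential of its delay; hence the exponent \<open>DIM('a) - 1\<close>.
\<close>

lemma hyp_cball_subset_cell_iff:
  fixes \<theta> :: "nat \<Rightarrow> 'a::euclidean_space" and r :: "nat \<Rightarrow> real"
  assumes d: "2 \<le> DIM('a)" and \<theta>: "\<And>j. norm (\<theta> j) = 1" and r: "\<And>j. 0 < r j" and u: "0 \<le> u"
  shows "hyp_cball 0 u \<subseteq> ipvt_cell \<theta> r i \<longleftrightarrow>
    (\<forall>j. j \<noteq> i \<longrightarrow> r i * busemann_factor u (norm (\<theta> j - \<theta> i) / 2) ^ (DIM('a) - 1) \<le> r j)"
proof -
  define \<rho> where "\<rho> = sinh u / (1 + cosh u)"
  define n where "n = DIM('a) - 1"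
  define \<Lambda> where "\<Lambda> j = (r j / r i) powr (1 / (real DIM('a) - 1))" for j
  have n: "0 < n" "real DIM('a) - 1 = real n" using d by (auto simp: n_def)
  have \<Lambda>: "0 < \<Lambda> j" for j using r[of i] r[of j] by (simp add: \<Lambda>_def)
  have \<Lambda>n: "\<Lambda> j ^ n = r j / r i" for j
    using n \<Lambda>[of j] r[of i] r[of j] by (simp add: \<Lambda>_def powr_realpow[symmetric] powr_powr)
  have in_ball: "norm z < 1" if "z \<in> cball 0 \<rho>" for z :: 'a
    using that euclidean_radius_less_1[OF u] by (simp add: \<rho>_def)
  have "hyp_cball 0 u \<subseteq> ipvt_cell \<theta> r i \<longleftrightarrow>
      (\<forall>j. j \<noteq> i \<longrightarrow> (\<forall>z\<in>cball 0 \<rho>. (norm (z - \<theta> i))\<^sup>2 \<le> \<Lambda> j * (norm (z - \<theta> j))\<^sup>2))"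
    unfolding hyp_cball_origin[OF u] \<rho>_def[symmetric] ipvt_cell_def \<Lambda>_def
    using in_ball cell_inequality_iff[OF d \<theta>[of i] \<theta> r[of i] r] by (auto simp: subset_iff)
  also have "\<dots> \<longleftrightarrow> (\<forall>j. j \<noteq> i \<longrightarrow> busemann_factor u (norm (\<theta> j - \<theta> i) / 2) \<le> \<Lambda> j)"
    unfolding \<rho>_def using apollonius_ball_iff[OF \<theta>[of i] \<theta> u \<Lambda>] by simp
  also have "\<dots> \<longleftrightarrow> (\<forall>j. j \<noteq> i \<longrightarrow> busemann_factor u (norm (\<theta> j - \<theta> i) / 2) ^ n \<le> \<Lambda> j ^ n)"
    using n \<Lambda> by (simp add: power_mono_iff less_imp_le[OF busemann_factor_pos] less_imp_le)
  also have "\<dots> \<longleftrightarrow> (\<forall>j. j \<noteq> i \<longrightarrow> r i * busemann_factor u (norm (\<theta> j - \<theta> i) / 2) ^ n \<le> r j)"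
    unfolding \<Lambda>n using r[of i] by (simp add: field_simps)
  finally show ?thesis by (simp add: n_def)
qed

lemma cell_relatively_closed:
  fixes \<theta> :: "nat \<Rightarrow> 'a::euclidean_space" and r :: "nat \<Rightarrow> real"
  assumes d: "2 \<le> DIM('a)" and \<theta>: "\<And>j. norm (\<theta> j) = 1" and r: "\<And>j. 0 < r j"
  shows "\<exists>K. closed K \<and> ipvt_cell \<theta> r i = ball 0 1 \<inter> K"
proof (intro exI conjI)
  let ?\<Lambda> = "\<lambda>j. (r j / r i) powr (1 / (real DIM('a) - 1))"
  let ?K = "\<Inter>j\<in>-{i}. {z. (norm (z - \<theta> i))\<^sup>2 \<le> ?\<Lambda> j * (norm (z - \<theta> j))\<^sup>2}"
  show "closed ?K"
    by (intro closed_INT ballI closed_Collect_le continuous_intros)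
  show "ipvt_cell \<theta> r i = ball 0 1 \<inter> ?K"
    unfolding ipvt_cell_def using cell_inequality_iff[OF d \<theta>[of i] \<theta> r[of i] r] by auto
qed

lemma euclidean_radius_strict_mono:
  assumes "0 \<le> v" "v < u"
  shows "sinh v / (1 + cosh v) < sinh u / (1 + cosh (u::real))"
proof -
  have "0 < sinh (u - v)" using assms by simp
  then have "sinh v * cosh u < sinh u * cosh v" by (simp add: sinh_diff mult.commute)
  moreover have "sinh v < sinh u" using assms by simp
  ultimately have "sinh v * (1 + cosh u) < sinh u * (1 + cosh v)"
    unfolding distrib_left by linarith
  moreover have "0 < 1 + cosh u" "0 < 1 + cosh v"
    using cosh_real_ge_1[of u] cosh_real_ge_1[of v] by auto
  ultimately show ?thesis by (simp add: divide_less_eq less_divide_eq mult.commute)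
qed

lemma hyp_dist_origin_nonneg:
  fixes z :: "'a::euclidean_space"
  assumes "norm z < 1"
  shows "0 \<le> hyp_dist 0 z"
proof -
  have "(norm z)\<^sup>2 < 1" using assms by (simp add: abs_square_less_1)
  then show ?thesis
    unfolding hyp_dist_origin[OF assms] by (intro arcosh_nonneg_real) (simp add: field_simps)
qed

lemma hyp_dist_origin_strict_mono:
  fixes w z :: "'a::euclidean_space"
  assumes "norm w < norm z" "norm z < 1"
  shows "hyp_dist 0 w < hyp_dist 0 z"
proof -
  have w: "norm w < 1" using assms by simp
  have "(norm w)\<^sup>2 < (norm z)\<^sup>2" "(norm z)\<^sup>2 < 1"
    using assms by (auto simp: abs_square_less_1 intro: power_strict_mono)
  then have "(1 + (norm w)\<^sup>2) / (1 - (norm w)\<^sup>2) < (1 + (norm z)\<^sup>2) / (1 - (norm z)\<^sup>2)"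
    using assms by (intro frac_less) auto
  moreover have "1 \<le> (1 + (norm w)\<^sup>2) / (1 - (norm w)\<^sup>2)"
    using \<open>(norm w)\<^sup>2 < (norm z)\<^sup>2\<close> \<open>(norm z)\<^sup>2 < 1\<close> by (simp add: field_simps)
  ultimately show ?thesis
    unfolding hyp_dist_origin[OF w] hyp_dist_origin[OF assms(2)]
    by (intro arcosh_real_strict_mono) auto
qed

lemma origin_boundary_dist_nonneg: "0 \<le> origin_boundary_dist C"
  unfolding origin_boundary_dist_def
  by (intro INF_greatest) (auto intro: hyp_dist_origin_nonneg)

text \<open>
  The segment from the origin to a point outside \<open>C\<close> crosses the frontier of \<open>C\<close>, and it does so
  strictly before its end, since \<open>C\<close> is relatively closed.  So a ball that is not contained in \<open>C\<close> has a
  frontier point in its interior, and the equivalence holds with the closed ball and a weak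
  inequality, for every \<open>u\<close> and without exceptional null sets later on.
\<close>

lemma origin_boundary_dist_ge_iff:
  fixes K :: "'a::euclidean_space set"
  assumes K: "closed K" and C: "C = ball 0 1 \<inter> K" and 0: "0 \<in> C" and u: "0 \<le> u"
  shows "ereal u \<le> origin_boundary_dist C \<longleftrightarrow> hyp_cball 0 u \<subseteq> C"
proof
  assume *: "hyp_cball 0 u \<subseteq> C"
  show "ereal u \<le> origin_boundary_dist C"
    unfolding origin_boundary_dist_def
  proof (rule INF_greatest)
    fix z assume z: "z \<in> frontier C \<inter> ball 0 1"
    then have nz: "norm z < 1" by simp
    have "ball 0 (sinh u / (1 + cosh u)) \<subseteq> interior C"
      using * unfolding hyp_cball_origin[OF u] by (intro interior_maximal) auto
    then have "sinh u / (1 + cosh u) \<le> norm z"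
      using z by (force simp: frontier_def)
    moreover have "norm z \<le> sinh (hyp_dist 0 z) / (1 + cosh (hyp_dist 0 z))"
      using hyp_dist_origin_le_iff[OF nz hyp_dist_origin_nonneg[OF nz]] by simp
    ultimately show "ereal u \<le> ereal (hyp_dist 0 z)"
      using euclidean_radius_strict_mono[OF hyp_dist_origin_nonneg[OF nz], of u] by force
  qed
next
  assume *: "ereal u \<le> origin_boundary_dist C"
  show "hyp_cball 0 u \<subseteq> C"
  proof (rule ccontr)
    assume "\<not> hyp_cball 0 u \<subseteq> C"
    then obtain z where z: "norm z < 1" "hyp_dist 0 z \<le> u" "z \<notin> C"
      by (auto simp: hyp_cball_def)
    have "closed_segment 0 z \<inter> frontier C \<noteq> {}"
    proof (rule connected_Int_frontier)
      show "closed_segment 0 z \<inter> C \<noteq> {}" using 0 by auto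
      show "closed_segment 0 z - C \<noteq> {}" using z by auto
    qed simp
    then obtain w where w: "w \<in> closed_segment 0 z" "w \<in> frontier C" by auto
    obtain t where t: "0 \<le> t" "t \<le> 1" "w = t *\<^sub>R z"
      using w(1) by (auto simp: closed_segment_def)
    have "norm w \<le> norm z" using t by (simp add: mult_left_le_one_le)
    have "w \<in> K"
      using w(2) closure_mono[of C K] K by (auto simp: C frontier_def)
    then have "w \<in> C" using \<open>norm w \<le> norm z\<close> z by (simp add: C)
    then have "t \<noteq> 1" "z \<noteq> 0" using t z 0 by auto
    then have "norm w < norm z" using t by simp
    then have "hyp_dist 0 w < u"
      using hyp_dist_origin_strict_mono[of w z] z by simp
    moreover have "origin_boundary_dist C \<le> ereal (hyp_dist 0 w)"
      unfolding origin_boundary_dist_def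
      using w z \<open>norm w \<le> norm z\<close> by (intro INF_lower) auto
    ultimately show False
      using * by (metis ereal_less_eq(3) less_le_not_le order_trans)
  qed
qed

section \<open>Rotation invariance\<close>

lemma nn_integral_lborel_reflect_translate:
  fixes y :: "'a::euclidean_space" and g :: "'a \<Rightarrow> ennreal"
  assumes [measurable]: "g \<in> borel_measurable borel"
  shows "(\<integral>\<^sup>+x. g (y - x) \<partial>lborel) = (\<integral>\<^sup>+x. g x \<partial>lborel)"
proof -
  have "lborel = distr lborel borel (\<lambda>x. y - x)"
    using lborel_affine[of "-1" y] by (simp add: density_1 one_ennreal_def[symmetric])
  then have "(\<integral>\<^sup>+x. g x \<partial>lborel) = (\<integral>\<^sup>+x. g x \<partial>distr lborel borel (\<lambda>x. y - x))"
    by (rule arg_cong)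
  also have "\<dots> = (\<integral>\<^sup>+x. g (y - x) \<partial>lborel)"
    by (simp add: nn_integral_distr)
  finally show ?thesis ..
qed

lemma nn_integral_lborel_translate:
  fixes y :: "'a::euclidean_space" and g :: "'a \<Rightarrow> ennreal"
  assumes [measurable]: "g \<in> borel_measurable borel"
  shows "(\<integral>\<^sup>+x. g (x - y) \<partial>lborel) = (\<integral>\<^sup>+x. g x \<partial>lborel)"
proof -
  have "(\<integral>\<^sup>+x. g x \<partial>lborel) = (\<integral>\<^sup>+x. g x \<partial>distr lborel borel ((+) (-y)))"
    by (simp add: lborel_distr_plus)
  also have "\<dots> = (\<integral>\<^sup>+x. g (x - y) \<partial>lborel)"
    by (simp add: nn_integral_distr)
  finally show ?thesis ..
qed

lemma unit_ball_vol_DIM_neq_0: "unit_ball_vol (real DIM('a::euclidean_space)) \<noteq> 0"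
  using unit_ball_vol_pos[of "real DIM('a)"] by (metis less_irrefl of_nat_0_le_iff)

text \<open>
  A translation-invariant measure is determined up to a factor, and the unit ball fixes the factor.
  Concretely, let \<open>B\<close> be the unit ball, and integrate $1_A(f x)\,1_B(y)$ over all \<open>x\<close> and \<open>y\<close>.  The shift
  $y \mapsto y - f x$ followed by the substitution $f x \mapsto y - f x$ exchanges the roles of the two variables:
  what results is the integral of $1_A(y - f x)\,1_B(f x)$, which is the volume of \<open>A\<close> times that of \<open>B\<close>
  because \<open>f\<close> preserves \<open>B\<close>.
\<close>

lemma lborel_distr_orthogonal_transformation:
  fixes f :: "'a::euclidean_space \<Rightarrow> 'a"
  assumes f: "orthogonal_transformation f"
  shows "distr lborel borel f = lborel"
proof (rule measure_eqI)
  have lin: "linear f" by (rule orthogonal_transformation_linear[OF f])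
  have [measurable]: "f \<in> borel_measurable borel"
    using lin by (intro borel_measurable_continuous_onI linear_continuous_on linear_conv_bounded_linear[THEN iffD1])
  have surj: "surj f" by (rule orthogonal_transformation_surj[OF f])
  have nf: "norm (f x) = norm x" for x by (rule orthogonal_transformation_norm[OF f])
  have fdiff: "f (x - y) = f x - f y" for x y by (rule linear_diff[OF lin])
  fix A assume "A \<in> sets (distr lborel borel f)"
  then have A[measurable]: "A \<in> sets borel" by simp
  let ?B = "ball 0 1 :: 'a set"
  have [measurable]: "?B \<in> sets borel" by simp
  let ?\<mu> = "emeasure lborel :: 'a set \<Rightarrow> ennreal"
  have "?\<mu> (f -` A) * ?\<mu> ?B = (\<integral>\<^sup>+x. (\<integral>\<^sup>+y. indicator A (f x) * indicator ?B y \<partial>lborel) \<partial>lborel)"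
  proof -
    have "?\<mu> (f -` A) = (\<integral>\<^sup>+x. indicator (f -` A) x \<partial>lborel)"
      using measurable_sets[of f borel borel A] by simp
    also have "\<dots> = (\<integral>\<^sup>+x. indicator A (f x) \<partial>lborel)"
      by (intro nn_integral_cong) (simp add: indicator_def)
    finally have fA: "?\<mu> (f -` A) = (\<integral>\<^sup>+x. indicator A (f x) \<partial>lborel)" .
    have "(\<integral>\<^sup>+y. c * indicator ?B y \<partial>lborel) = c * ?\<mu> ?B" for c
      by (rule nn_integral_cmult_indicator) simp
    then show ?thesis unfolding fA by (simp only: nn_integral_multc[symmetric]) (rule nn_integral_multc[symmetric], measurable)
  qed
  also have "\<dots> = (\<integral>\<^sup>+x. (\<integral>\<^sup>+y. indicator A (f x) * indicator ?B (y - f x) \<partial>lborel) \<partial>lborel)"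
    by (rule nn_integral_cong, rule nn_integral_lborel_translate[symmetric]) measurable
  also have "\<dots> = (\<integral>\<^sup>+y. (\<integral>\<^sup>+x. indicator A (f x) * indicator ?B (y - f x) \<partial>lborel) \<partial>lborel)"
    by (rule lborel_pair.Fubini'[symmetric]) measurable
  also have "\<dots> = (\<integral>\<^sup>+y. (\<integral>\<^sup>+x. indicator A (y - f x) * indicator ?B (f x) \<partial>lborel) \<partial>lborel)"
  proof (rule nn_integral_cong)
    fix y :: 'a
    obtain y' where y: "y = f y'" using surj by (metis surjD)
    show "(\<integral>\<^sup>+x. indicator A (f x) * indicator ?B (y - f x) \<partial>lborel)
        = (\<integral>\<^sup>+x. (indicator A (y - f x) * indicator ?B (f x)::ennreal) \<partial>lborel)"
      by (subst nn_integral_lborel_reflect_translate[of _ y', symmetric]) (simp_all add: fdiff y)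
  qed
  also have "\<dots> = (\<integral>\<^sup>+x. (\<integral>\<^sup>+y. indicator A (y - f x) * indicator ?B (f x) \<partial>lborel) \<partial>lborel)"
    by (rule lborel_pair.Fubini') measurable
  also have "\<dots> = (\<integral>\<^sup>+x. ?\<mu> A * indicator ?B x \<partial>lborel)"
  proof (rule nn_integral_cong)
    fix x :: 'a
    have "(\<integral>\<^sup>+y. indicator A (y - f x) * indicator ?B (f x) \<partial>lborel)
        = (\<integral>\<^sup>+y. indicator A (y - f x) \<partial>lborel) * (indicator ?B (f x) :: ennreal)"
      by (rule nn_integral_multc) measurable
    also have "\<dots> = ?\<mu> A * indicator ?B x"
      by (subst nn_integral_lborel_translate) (auto simp: indicator_def nf)
    finally show "(\<integral>\<^sup>+y. indicator A (y - f x) * indicator ?B (f x) \<partial>lborel) = ?\<mu> A * indicator ?B x" .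
  qed
  also have "\<dots> = ?\<mu> A * ?\<mu> ?B" by (simp add: nn_integral_cmult)
  finally have "?\<mu> (f -` A) * ?\<mu> ?B = ?\<mu> A * ?\<mu> ?B" .
  moreover have "?\<mu> ?B \<noteq> 0" "?\<mu> ?B \<noteq> \<top>"
    using unit_ball_vol_DIM_neq_0[where 'a='a] by (auto simp: emeasure_ball)
  ultimately show "emeasure (distr lborel borel f) A = emeasure lborel A"
    by (simp add: emeasure_distr ennreal_mult_cancel_left mult.commute[of _ "?\<mu> ?B"])
qed simp

lemma prob_space_sphere_uniform: "prob_space (sphere_uniform :: 'a::euclidean_space measure)"
proof -
  have "prob_space (uniform_measure lborel (ball 0 1 :: 'a set))"
    using unit_ball_vol_DIM_neq_0[where 'a='a]
    by (intro prob_space_uniform_measure) (auto simp: emeasure_ball)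
  then show ?thesis
    unfolding sphere_uniform_def by (rule prob_space.prob_space_distr) simp
qed

lemma sets_sphere_uniform[measurable_cong, simp]: "sets sphere_uniform = sets borel"
  by (simp add: sphere_uniform_def)

lemma nn_integral_sphere_uniform:
  fixes G :: "'a::euclidean_space \<Rightarrow> ennreal"
  assumes [measurable]: "G \<in> borel_measurable borel"
  shows "(\<integral>\<^sup>+\<theta>. G \<theta> \<partial>sphere_uniform)
     = (\<integral>\<^sup>+x. G (x /\<^sub>R norm x) * indicator (ball 0 1) x \<partial>lborel) / ennreal (unit_ball_vol DIM('a))"
  by (simp add: sphere_uniform_def nn_integral_distr nn_integral_uniform_measure emeasure_ball)

lemma nn_integral_sphere_uniform_orthogonal_transformation:
  fixes G :: "'a::euclidean_space \<Rightarrow> ennreal" and f :: "'a \<Rightarrow> 'a"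
  assumes [measurable]: "G \<in> borel_measurable borel" and f: "orthogonal_transformation f"
  shows "(\<integral>\<^sup>+\<theta>. G (f \<theta>) \<partial>sphere_uniform) = (\<integral>\<^sup>+\<theta>. G \<theta> \<partial>sphere_uniform)"
proof -
  have lin: "linear f" by (rule orthogonal_transformation_linear[OF f])
  have [measurable]: "f \<in> borel_measurable borel"
    using lin by (intro borel_measurable_continuous_onI linear_continuous_on linear_conv_bounded_linear[THEN iffD1])
  have nf: "norm (f x) = norm x" for x by (rule orthogonal_transformation_norm[OF f])
  have "(\<integral>\<^sup>+x. G (x /\<^sub>R norm x) * indicator (ball 0 1) x \<partial>lborel)
      = (\<integral>\<^sup>+x. G (x /\<^sub>R norm x) * indicator (ball 0 1) x \<partial>distr lborel borel f)"
    by (simp add: lborel_distr_orthogonal_transformation[OF f])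
  also have "\<dots> = (\<integral>\<^sup>+x. G (f (x /\<^sub>R norm x)) * indicator (ball 0 1) x \<partial>lborel)"
    by (simp add: nn_integral_distr linear_scale[OF lin] nf indicator_def)
  finally show ?thesis
    by (simp add: nn_integral_sphere_uniform)
qed

text \<open>
  The witness is the reflection in the hyperplane that bisects the segment from \<open>a\<close> to \<open>b\<close>.
\<close>

lemma orthogonal_transformation_mapping:
  fixes a b :: "'a::euclidean_space"
  assumes "norm a = norm b"
  obtains f where "orthogonal_transformation f" "f a = b"
proof (cases "a = b")
  case True
  then show ?thesis using that[of "\<lambda>x. x"] by (simp add: orthogonal_transformation_def linear_ident)
next
  case False
  define v where "v = a - b"
  define f where "f x = x - (2 * (x \<bullet> v) / (v \<bullet> v)) *\<^sub>R v" for x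
  have vv: "v \<bullet> v \<noteq> 0" using False by (simp add: v_def)
  have "linear f"
    by (intro linearI) (simp_all add: f_def inner_add_left add_divide_distrib distrib_left scaleR_left_distrib algebra_simps)
  moreover have "f x \<bullet> f y = x \<bullet> y" for x y
    using vv by (simp add: f_def inner_diff_left inner_diff_right inner_commute)
  moreover have "f a = b"
  proof -
    have "a \<bullet> a = b \<bullet> b" using assms by (simp add: norm_eq_sqrt_inner)
    then have "2 * (a \<bullet> v) = v \<bullet> v" by (simp add: v_def inner_diff_left inner_diff_right inner_commute)
    then show ?thesis using vv by (simp add: f_def v_def)
  qed
  ultimately show ?thesis using that by (auto simp: orthogonal_transformation_def)
qed

text \<open>
  This is the only consequence of rotation invariance that is needed: the law of the distance from a
  uniform point of the sphere to a fixed point of the sphere does not depend on that point.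
\<close>

lemma nn_integral_sphere_uniform_chord:
  fixes a b :: "'a::euclidean_space" and H :: "real \<Rightarrow> ennreal"
  assumes [measurable]: "H \<in> borel_measurable borel" and ab: "norm a = norm b"
  shows "(\<integral>\<^sup>+\<theta>. H (norm (\<theta> - a)) \<partial>sphere_uniform) = (\<integral>\<^sup>+\<theta>. H (norm (\<theta> - b)) \<partial>sphere_uniform)"
proof -
  obtain f where f: "orthogonal_transformation f" "f a = b"
    using orthogonal_transformation_mapping[OF ab] .
  have "norm (f \<theta> - b) = norm (\<theta> - a)" for \<theta>
    using orthogonal_transformation_norm[OF f(1), of "\<theta> - a"]
      linear_diff[OF orthogonal_transformation_linear[OF f(1)]] f(2) by simp
  then show ?thesis
    using nn_integral_sphere_uniform_orthogonal_transformation[OF _ f(1), of "\<lambda>\<theta>. H (norm (\<theta> - b))"]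
    by simp
qed

section \<open>Stereographic projection\<close>

lemma nn_integral_incseq_SUP:
  assumes [measurable]: "f \<in> borel_measurable M" "\<And>k. A k \<in> sets M" and "incseq A"
  shows "(\<integral>\<^sup>+x. f x * indicator (\<Union>k. A k) x \<partial>M) = (SUP k. \<integral>\<^sup>+x. f x * indicator (A k) x \<partial>M)"
proof -
  have "(\<integral>\<^sup>+x. f x * indicator (\<Union>k. A k) x \<partial>M) = emeasure (density M f) (\<Union>k. A k)"
    by (simp add: emeasure_density)
  also have "\<dots> = (SUP k. emeasure (density M f) (A k))"
    using assms by (intro SUP_emeasure_incseq[symmetric]) auto
  finally show ?thesis by (simp add: emeasure_density)
qed

text \<open>
  Exhaustion by compact intervals and monotone convergence give the substitution rule on open and
  unbounded intervals, for integrands that are merely measurable and with no integrability condition.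
\<close>

lemma nn_integral_substitution_UN:
  fixes f :: "real \<Rightarrow> ennreal" and g g' :: "real \<Rightarrow> real"
  assumes [measurable]: "f \<in> borel_measurable borel" "g \<in> borel_measurable borel" "g' \<in> borel_measurable borel"
    and deriv: "\<And>k x. x \<in> {a k..b k} \<Longrightarrow> (g has_real_derivative g' x) (at x)"
    and cont: "\<And>k. continuous_on {a k..b k} g'"
    and nonneg: "\<And>k x. x \<in> {a k..b k} \<Longrightarrow> 0 \<le> g' x"
    and less: "\<And>k. a k < b k"
    and inc: "incseq (\<lambda>k. {a k..b k})" "incseq (\<lambda>k. {g (a k)..g (b k)})"
    and S: "S = (\<Union>k. {a k..b k})" and T: "T = (\<Union>k. {g (a k)..g (b k)})"
  shows "(\<integral>\<^sup>+x. f x * indicator T x \<partial>lborel) = (\<integral>\<^sup>+x. f (g x) * ennreal (g' x) * indicator S x \<partial>lborel)"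
proof -
  have "(\<integral>\<^sup>+x. f x * indicator T x \<partial>lborel) = (SUP k. \<integral>\<^sup>+x. f x * indicator {g (a k)..g (b k)} x \<partial>lborel)"
    unfolding T using inc by (intro nn_integral_incseq_SUP) auto
  also have "\<dots> = (SUP k. \<integral>\<^sup>+x. f (g x) * ennreal (g' x) * indicator {a k..b k} x \<partial>lborel)"
    by (intro SUP_cong refl nn_integral_substitution_aux deriv cont nonneg less) auto
  also have "\<dots> = (\<integral>\<^sup>+x. f (g x) * ennreal (g' x) * indicator S x \<partial>lborel)"
    unfolding S using inc by (intro nn_integral_incseq_SUP[symmetric]) auto
  finally show ?thesis .
qed

text \<open>
  Polar coordinates: both measures give the half-line up to \<open>a\<close> the volume of a ball of radius \<open>a\<close>.
  The product over an index set, in place of a Euclidean type, allows dimension $d - 1$ to be used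
  next to dimension $d$.
\<close>

lemma distr_euclidean_norm_PiM:
  assumes A: "finite A" "A \<noteq> {}"
  shows "distr (Pi\<^sub>M A (\<lambda>_. lborel)) borel (\<lambda>x. sqrt (\<Sum>i\<in>A. (x i)\<^sup>2)) =
    density lborel (\<lambda>r. ennreal (real (card A) * unit_ball_vol (real (card A)) * r ^ (card A - 1)) * indicator {0<..} r)"
    (is "?L = ?R")
proof -
  define n where "n = card A"
  define V where "V = unit_ball_vol (real n)"
  have n: "0 < n" using A by (auto simp: n_def card_gt_0_iff)
  have V: "0 \<le> V" by (simp add: V_def)
  have [measurable]: "(\<lambda>x. sqrt (\<Sum>i\<in>A. (x i)\<^sup>2)) \<in> borel_measurable (Pi\<^sub>M A (\<lambda>_. lborel))"
    using A by measurable
  have L: "emeasure ?L {..a} = ennreal (V * a ^ n)" if "0 < a" for a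
  proof -
    have "emeasure ?L {..a} = emeasure (Pi\<^sub>M A (\<lambda>_. lborel))
             ({f. sqrt (\<Sum>i\<in>A. (f i)\<^sup>2) \<le> a} \<inter> space (Pi\<^sub>M A (\<lambda>_. lborel)))"
      by (subst emeasure_distr) (auto intro!: arg_cong[where f = "emeasure _"])
    then show ?thesis using emeasure_cball_aux[OF A(1) that] by (simp add: V_def n_def)
  qed
  have L0: "emeasure ?L {..a} = 0" if "a \<le> 0" for a
  proof -
    have "emeasure ?L {..a} \<le> ennreal e" if e: "0 < e" for e
    proof -
      define x where "x = min 1 (e / (V + 1))"
      have x: "0 < x" "x \<le> 1" using e V by (auto simp: x_def)
      have "emeasure ?L {..a} \<le> emeasure ?L {..x}"
        using \<open>a \<le> 0\<close> x by (intro emeasure_mono) auto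
      also have "\<dots> = ennreal (V * x ^ n)" by (rule L[OF x(1)])
      also have "V * x ^ n \<le> (V + 1) * x"
        using x n V by (intro mult_mono) (auto simp: power_le_one_iff intro!: power_decreasing[of 1 n x, simplified])
      also have "\<dots> \<le> (V + 1) * (e / (V + 1))" using V by (intro mult_left_mono) (auto simp: x_def)
      also have "\<dots> = e" using V by simp
      finally show ?thesis using e V x by (simp add: ennreal_leI)
    qed
    then show ?thesis
      by (metis ennreal_le_epsilon[of 0] add.left_neutral le_zero_eq)
  qed
  have R: "emeasure ?R {..a} = (if 0 < a then ennreal (V * a ^ n) else 0)" for a
  proof (cases "0 < a")
    case False
    have "emeasure ?R {..a} = (\<integral>\<^sup>+r. ennreal (real (card A) * unit_ball_vol (real (card A)) * r ^ (card A - 1))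
        * indicator {0<..} r * indicator {..a} r \<partial>lborel)"
      by (rule emeasure_density) auto
    also have "\<dots> = (\<integral>\<^sup>+(r::real). 0 \<partial>lborel)"
      using False by (intro nn_integral_cong) (auto simp: indicator_def)
    finally show ?thesis using False by simp
  next
    case True
    have "emeasure ?R {..a} = (\<integral>\<^sup>+r. ennreal (real n * V * r ^ (n - 1)) * indicator {0..a} r \<partial>lborel)"
      using AE_lborel_singleton[of "0::real"]
      by (subst emeasure_density) (auto intro!: nn_integral_cong_AE simp: indicator_def n_def V_def elim!: eventually_mono)
    also have "\<dots> = ennreal (V * a ^ n - V * 0 ^ n)"
      using True V n
      by (intro nn_integral_FTC_Icc) (auto intro!: derivative_eq_intros simp: mult.commute)
    finally show ?thesis using True n by (simp add: zero_power)
  qed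
  show ?thesis
  proof (rule measure_eqI_generator_eq[where \<Omega> = UNIV and E = "range (\<lambda>a. {..a})" and A = "\<lambda>i. {..real i}"])
    show "Int_stable (range (\<lambda>a::real. {..a}))"
    proof -
      have "{..a} \<inter> {..b} = {..min a b}" for a b :: real by auto
      then show ?thesis by (auto simp: Int_stable_def)
    qed
    show "sets ?L = sigma_sets UNIV (range (\<lambda>a. {..a}))" "sets ?R = sigma_sets UNIV (range (\<lambda>a. {..a}))"
      by (simp_all add: borel_eq_atMost)
    fix X assume "X \<in> range (\<lambda>a::real. {..a})"
    then show "emeasure ?L X = emeasure ?R X" using L L0 R by force
  next
    show "(\<Union>i. {..real i}) = UNIV" by (auto intro: real_arch_simple)
    fix i show "emeasure ?L {..real i} \<noteq> \<infinity>" using L L0 by (cases "i = 0") auto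
  qed auto
qed

lemma nn_integral_PiM_radial:
  assumes A: "finite A" "A \<noteq> {}" and [measurable]: "h \<in> borel_measurable borel"
  shows "(\<integral>\<^sup>+x. h (sqrt (\<Sum>i\<in>A. (x i)\<^sup>2)) \<partial>Pi\<^sub>M A (\<lambda>_. lborel)) =
    (\<integral>\<^sup>+r. h r * ennreal (real (card A) * unit_ball_vol (real (card A)) * r ^ (card A - 1)) * indicator {0<..} r \<partial>lborel)"
proof -
  have [measurable]: "(\<lambda>x. sqrt (\<Sum>i\<in>A. (x i)\<^sup>2)) \<in> borel_measurable (Pi\<^sub>M A (\<lambda>_. lborel))"
    using A by measurable
  have "(\<integral>\<^sup>+x. h (sqrt (\<Sum>i\<in>A. (x i)\<^sup>2)) \<partial>Pi\<^sub>M A (\<lambda>_. lborel)) =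
      (\<integral>\<^sup>+r. h r \<partial>distr (Pi\<^sub>M A (\<lambda>_. lborel)) borel (\<lambda>x. sqrt (\<Sum>i\<in>A. (x i)\<^sup>2)))"
    by (subst nn_integral_distr) auto
  also have "\<dots> = (\<integral>\<^sup>+r. h r * ennreal (real (card A) * unit_ball_vol (real (card A)) * r ^ (card A - 1)) * indicator {0<..} r \<partial>lborel)"
    unfolding distr_euclidean_norm_PiM[OF A] by (subst nn_integral_density) (auto intro!: nn_integral_cong simp: mult_ac)
  finally show ?thesis .
qed

text \<open>
  Cylindrical coordinates around the axis \<open>b\<close>.
\<close>

lemma nn_integral_lborel_axis:
  fixes b :: "'a::euclidean_space" and \<Psi> :: "real \<Rightarrow> real \<Rightarrow> ennreal"
  assumes b: "b \<in> Basis" and d: "2 \<le> DIM('a)"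
    and [measurable]: "case_prod \<Psi> \<in> borel_measurable (borel \<Otimes>\<^sub>M borel)"
  defines "n \<equiv> DIM('a) - 1"
  shows "(\<integral>\<^sup>+x. \<Psi> (x \<bullet> b) (norm x) \<partial>(lborel :: 'a measure)) =
    (\<integral>\<^sup>+t. (\<integral>\<^sup>+r. \<Psi> t (sqrt (t\<^sup>2 + r\<^sup>2)) * ennreal (real n * unit_ball_vol (real n) * r ^ (n - 1)) * indicator {0<..} r \<partial>lborel) \<partial>lborel)"
proof -
  interpret product_sigma_finite "\<lambda>_::'a. lborel :: real measure" by standard
  define A where "A = Basis - {b}"
  have A: "finite A" "b \<notin> A" "insert b A = Basis" "card A = n"
    using b by (auto simp: A_def n_def card_Diff_singleton)
  have "A \<noteq> {}" using A(4) d by (auto simp: n_def)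
  have "(\<integral>\<^sup>+x. \<Psi> (x \<bullet> b) (norm x) \<partial>(lborel :: 'a measure)) =
      (\<integral>\<^sup>+f. \<Psi> ((\<Sum>c\<in>Basis. f c *\<^sub>R c) \<bullet> b) (norm (\<Sum>c\<in>Basis. f c *\<^sub>R c :: 'a)) \<partial>(\<Pi>\<^sub>M c\<in>Basis. lborel))"
    by (subst lborel_eq, subst nn_integral_distr) auto
  also have "\<dots> = (\<integral>\<^sup>+f. \<Psi> (f b) (sqrt (\<Sum>c\<in>Basis. (f c)\<^sup>2)) \<partial>(\<Pi>\<^sub>M c\<in>(Basis::'a set). lborel))"
  proof -
    have "norm (\<Sum>c\<in>Basis. f c *\<^sub>R c :: 'a) = sqrt (\<Sum>c\<in>Basis. (f c)\<^sup>2)" for f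
      unfolding norm_eq_sqrt_inner
      by (subst euclidean_inner) (simp add: inner_sum_left_Basis power2_eq_square)
    then show ?thesis using b by (simp add: inner_sum_left_Basis)
  qed
  also have "\<dots> = (\<integral>\<^sup>+f. \<Psi> (f b) (sqrt ((f b)\<^sup>2 + (\<Sum>c\<in>A. (f c)\<^sup>2))) \<partial>(\<Pi>\<^sub>M c\<in>insert b A. lborel))"
    unfolding A(3)[symmetric] using A(1,2) by simp
  also have "\<dots> = (\<integral>\<^sup>+t. (\<integral>\<^sup>+f. \<Psi> t (sqrt (t\<^sup>2 + (\<Sum>c\<in>A. (f c)\<^sup>2))) \<partial>(\<Pi>\<^sub>M c\<in>A. lborel)) \<partial>lborel)"
  proof (subst product_nn_integral_insert_rev)
    show "(\<lambda>f. \<Psi> (f b) (sqrt ((f b)\<^sup>2 + (\<Sum>c\<in>A. (f c)\<^sup>2)))) \<in> borel_measurable (\<Pi>\<^sub>M c\<in>insert b A. lborel)"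
      using A(1) by measurable
    have "(\<Sum>c\<in>A. (if c = b then t else f c)\<^sup>2) = (\<Sum>c\<in>A. (f c)\<^sup>2)" for f :: "'a \<Rightarrow> real" and t
      using A(2) by (intro sum.cong) auto
    then show "(\<integral>\<^sup>+t. (\<integral>\<^sup>+f. \<Psi> ((f(b := t)) b) (sqrt (((f(b := t)) b)\<^sup>2 + (\<Sum>c\<in>A. ((f(b := t)) c)\<^sup>2))) \<partial>(\<Pi>\<^sub>M c\<in>A. lborel)) \<partial>lborel)
       = (\<integral>\<^sup>+t. (\<integral>\<^sup>+f. \<Psi> t (sqrt (t\<^sup>2 + (\<Sum>c\<in>A. (f c)\<^sup>2))) \<partial>(\<Pi>\<^sub>M c\<in>A. lborel)) \<partial>lborel)"
      by simp
  qed (use A in auto)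
  also have "\<dots> = (\<integral>\<^sup>+t. (\<integral>\<^sup>+f. \<Psi> t (sqrt (t\<^sup>2 + (sqrt (\<Sum>c\<in>A. (f c)\<^sup>2))\<^sup>2)) \<partial>(\<Pi>\<^sub>M c\<in>A. lborel)) \<partial>lborel)"
    by (simp add: sum_nonneg)
  also have "\<dots> = (\<integral>\<^sup>+t. (\<integral>\<^sup>+r. \<Psi> t (sqrt (t\<^sup>2 + r\<^sup>2)) * ennreal (real n * unit_ball_vol (real n) * r ^ (n - 1)) * indicator {0<..} r \<partial>lborel) \<partial>lborel)"
    by (subst nn_integral_PiM_radial[where h = "\<lambda>r. \<Psi> _ (sqrt (_\<^sup>2 + r\<^sup>2))"]) (use A \<open>A \<noteq> {}\<close> in auto)
  finally show ?thesis .
qed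

text \<open>
  The new variable is $q = t + \sqrt{t^2 + r^2}$.  A point \<open>x\<close> with axial coordinate \<open>t\<close> at distance \<open>r\<close> from the
  axis has $|x| = \sqrt{t^2 + r^2}$, and stereographic projection of $x/|x|$ from the pole opposite to the
  axis has norm $r/q$; this is what makes \<open>q\<close> the natural variable.
\<close>

lemma nn_integral_hyperbola_substitution:
  fixes F :: "real \<Rightarrow> ennreal"
  assumes [measurable]: "F \<in> borel_measurable borel" and r: "0 < r"
  shows "(\<integral>\<^sup>+t. F t \<partial>lborel) =
    (\<integral>\<^sup>+q. F ((q - r\<^sup>2 / q) / 2) * ennreal ((1 + r\<^sup>2 / q\<^sup>2) / 2) * indicator {0<..} q \<partial>lborel)"
proof -
  define g where "g q = (q - r\<^sup>2 / q) / 2" for q :: real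
  \<comment> \<open>The intervals from \<open>a k\<close> to \<open>b k\<close> exhaust the positive half-line.\<close>
  define a where "a k = 1 / (real k + 1)" for k
  define b where "b k = real k + 2" for k
  have a: "0 < a k" "a k < b k" for k
  proof -
    have "1 / (real k + 1) \<le> 1" by simp
    also have "1 < real k + 2" by simp
    finally show "0 < a k" "a k < b k" by (auto simp: a_def b_def)
  qed
  have a_dec: "a l \<le> a k" and b_inc: "b k \<le> b l" if "k \<le> l" for k l
    using that by (auto simp: a_def b_def frac_le)
  have g_mono: "g p \<le> g q" if "0 < p" "p \<le> q" for p q
  proof -
    have "r\<^sup>2 / q \<le> r\<^sup>2 / p" using that by (intro divide_left_mono) auto
    then show ?thesis unfolding g_def using that by (intro divide_right_mono diff_mono) auto
  qed
  have Icc: "\<exists>k. q \<in> {a k..b k}" if "0 < q" for q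
  proof -
    obtain k1 where k1: "1 / q < real k1" using reals_Archimedean2 by blast
    obtain k2 where k2: "q < real k2" using reals_Archimedean2 by blast
    have "a (max k1 k2) \<le> q"
    proof -
      have "1 / q \<le> real (max k1 k2) + 1" using k1 by linarith
      then show ?thesis using that by (simp add: a_def field_simps)
    qed
    moreover have "q \<le> b (max k1 k2)" using k2 by (simp add: b_def)
    ultimately show ?thesis by auto
  qed
  have "(\<integral>\<^sup>+t. F t * indicator UNIV t \<partial>lborel) =
      (\<integral>\<^sup>+q. F (g q) * ennreal ((1 + r\<^sup>2 / q\<^sup>2) / 2) * indicator {0<..} q \<partial>lborel)"
  proof (rule nn_integral_substitution_UN[where a = a and b = b])
    show "g \<in> borel_measurable borel" unfolding g_def by measurable
    fix k x assume "x \<in> {a k..b k}"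
    then have x: "0 < x" using a(1)[of k] by auto
    show "(g has_real_derivative (1 + r\<^sup>2 / x\<^sup>2) / 2) (at x)"
      unfolding g_def using x by (auto intro!: derivative_eq_intros simp: power2_eq_square field_simps)
    show "0 \<le> (1 + r\<^sup>2 / x\<^sup>2) / 2" by simp
  next
    fix k show "continuous_on {a k..b k} (\<lambda>q. (1 + r\<^sup>2 / q\<^sup>2) / 2)"
      using a(1)[of k] by (intro continuous_intros) auto
    show "a k < b k" by (rule a)
  next
    show "incseq (\<lambda>k. {a k..b k})" using a_dec b_inc by (force simp: incseq_def)
    show "incseq (\<lambda>k. {g (a k)..g (b k)})"
      using g_mono[OF a(1) a_dec] g_mono[OF less_trans[OF a] b_inc]
      by (auto simp: incseq_def intro: order_trans)
    show "{0<..} = (\<Union>k. {a k..b k})" using Icc by (auto intro: less_le_trans[OF a(1)])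
    show "UNIV = (\<Union>k. {g (a k)..g (b k)})"
    proof (intro UNIV_eq_I UN_I)
      fix t :: real
      define q where "q = t + sqrt (t\<^sup>2 + r\<^sup>2)"
      have "\<bar>t\<bar> < sqrt (t\<^sup>2 + r\<^sup>2)" using r by (intro real_less_rsqrt) auto
      then have q: "0 < q" by (auto simp: q_def)
      have "r\<^sup>2 = q * (q - 2 * t)" 
        using r by (simp add: q_def algebra_simps power2_eq_square[symmetric])
      then have "g q = t" using q by (simp add: g_def)
      moreover obtain k where "q \<in> {a k..b k}" using Icc[OF q] by blast
      ultimately show "t \<in> {g (a (SOME k. q \<in> {a k..b k}))..g (b (SOME k. q \<in> {a k..b k}))}"
        using someI[of "\<lambda>k. q \<in> {a k..b k}" k] g_mono[OF a(1), of _ q] g_mono[OF q] by auto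
    qed simp
  qed auto
  then show ?thesis by (simp add: g_def)
qed

text \<open>
  Thus $c_d$ is the area of the unit sphere divided by $2^{d-1}$; by the next lemma, with $H = 1$, it is
  the integral of $(1 + |w|^2)^{1-d}$ over $R^{d-1}$.
\<close>

lemma c_const_unit_ball_vol:
  assumes "0 < n"
  shows "c_const (Suc n) = real (Suc n) * unit_ball_vol (real (Suc n)) / 2 ^ n"
proof -
  define x where "x = real (Suc n)"
  have x: "0 < x" by (simp add: x_def)
  have "2 powr (2 - x) = 2 powr (1 - real n)" by (simp add: x_def)
  also have "\<dots> = 2 / 2 ^ n" by (simp add: powr_diff powr_realpow)
  finally have 1: "2 powr (2 - x) = 2 / 2 ^ n" .
  have 2: "Gamma (x / 2 + 1) = x / 2 * Gamma (x / 2)"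
    using x by (intro Gamma_plus1) (auto elim!: nonpos_Ints_cases)
  have "0 < Gamma (x / 2)" using x by (intro Gamma_real_pos) simp
  then show ?thesis
    using x unfolding c_const_def unit_ball_vol_def x_def[symmetric] 1 2 by (simp add: mult.commute)
qed

text \<open>
  In cylindrical coordinates $(t, r)$ around \<open>b\<close> put $q = t + \sqrt{t^2 + r^2}$ and $\rho = r/q$.  The unit ball becomes
  $q (1 + \rho^2) < 2$, and half the distance from $x/|x|$ to $-b$ becomes $1/\sqrt{1 + \rho^2}$, a function of \<open>\<rho>\<close> alone.
  So \<open>q\<close> can be integrated out.  The density that remains is the radial part of the law
  $(1 + |w|^2)^{1-d}\,dw / c_d$ of the stereographic image of a uniform point of the sphere.
\<close>

lemma nn_integral_sphere_uniform_stereographic_axis: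
  fixes b :: "'a::euclidean_space" and H :: "real \<Rightarrow> ennreal"
  assumes b: "b \<in> Basis" and d: "2 \<le> DIM('a)" and [measurable]: "H \<in> borel_measurable borel"
  defines "n \<equiv> DIM('a) - 1"
  shows "(\<integral>\<^sup>+\<theta>. H (norm (\<theta> + b) / 2) \<partial>sphere_uniform) =
    ennreal (real n * unit_ball_vol (real n) / c_const DIM('a)) *
    (\<integral>\<^sup>+\<rho>. H (1 / sqrt (1 + \<rho>\<^sup>2)) * ennreal (\<rho> ^ (n - 1) / (1 + \<rho>\<^sup>2) ^ n) * indicator {0<..} \<rho> \<partial>lborel)"
proof -
  define V where "V = real n * unit_ball_vol (real n)"
  define W where "W = unit_ball_vol (real DIM('a))"
  define \<Psi> where "\<Psi> t N = H (sqrt ((1 + t / N) / 2)) * indicator {..<1} N" for t N :: real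
  have [measurable]: "case_prod \<Psi> \<in> borel_measurable (borel \<Otimes>\<^sub>M borel)" unfolding \<Psi>_def by measurable
  have n: "0 < n" "DIM('a) = Suc n" using d by (auto simp: n_def)
  have V: "0 \<le> V" by (simp add: V_def)
  have W: "0 < W" unfolding W_def by (rule unit_ball_vol_pos) simp
  have cW: "c_const DIM('a) = real (Suc n) * W / 2 ^ n"
    unfolding W_def n(2) by (rule c_const_unit_ball_vol[OF n(1)])
  have sq: "1 + \<rho>\<^sup>2 \<noteq> 0" "0 < 1 + \<rho>\<^sup>2" for \<rho> :: real
    using zero_le_power2[of \<rho>] by linarith+
  have chord: "norm (x /\<^sub>R norm x + b) / 2 = sqrt ((1 + (x \<bullet> b) / norm x) / 2)" if "x \<noteq> 0" for x
  proof -
    have "(norm (x /\<^sub>R norm x + b))\<^sup>2 = 2 + 2 * ((x \<bullet> b) / norm x)"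
    proof -
      define y where "y = x /\<^sub>R norm x"
      have y: "norm y = 1" "y \<bullet> b = (x \<bullet> b) / norm x"
        using that by (simp_all add: y_def divide_inverse mult.commute)
      show ?thesis
        unfolding y_def[symmetric] y(2)[symmetric] using dot_norm[of y b] y(1) b by simp
    qed
    then have "(norm (x /\<^sub>R norm x + b) / 2)\<^sup>2 = (1 + (x \<bullet> b) / norm x) / 2"
      by (simp add: power_divide)
    then show ?thesis by (metis divide_nonneg_nonneg norm_ge_zero real_sqrt_unique zero_le_numeral)
  qed
  have "(\<integral>\<^sup>+x. H (norm (x /\<^sub>R norm x + b) / 2) * indicator (ball 0 1) x \<partial>lborel)
      = (\<integral>\<^sup>+x. \<Psi> (x \<bullet> b) (norm x) \<partial>lborel)"
    using AE_lborel_singleton[of "0::'a"]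
    by (intro nn_integral_cong_AE, eventually_elim) (simp add: chord \<Psi>_def indicator_def)
  also have "\<dots> = (\<integral>\<^sup>+t. (\<integral>\<^sup>+r. \<Psi> t (sqrt (t\<^sup>2 + r\<^sup>2)) * ennreal (V * r ^ (n - 1)) * indicator {0<..} r \<partial>lborel) \<partial>lborel)"
    unfolding V_def n_def by (rule nn_integral_lborel_axis[OF b d]) measurable
  also have "\<dots> = (\<integral>\<^sup>+r. (\<integral>\<^sup>+t. \<Psi> t (sqrt (t\<^sup>2 + r\<^sup>2)) * ennreal (V * r ^ (n - 1)) * indicator {0<..} r \<partial>lborel) \<partial>lborel)"
    by (rule lborel_pair.Fubini') measurable
  also have "\<dots> = (\<integral>\<^sup>+r. (\<integral>\<^sup>+q. \<Psi> ((q - r\<^sup>2 / q) / 2) (sqrt (((q - r\<^sup>2 / q) / 2)\<^sup>2 + r\<^sup>2)) * ennreal (V * r ^ (n - 1)) * indicator {0<..} r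
        * ennreal ((1 + r\<^sup>2 / q\<^sup>2) / 2) * indicator {0<..} q \<partial>lborel) \<partial>lborel)"
  proof (rule nn_integral_cong)
    fix r :: real
    show "(\<integral>\<^sup>+t. \<Psi> t (sqrt (t\<^sup>2 + r\<^sup>2)) * ennreal (V * r ^ (n - 1)) * indicator {0<..} r \<partial>lborel) =
      (\<integral>\<^sup>+q. \<Psi> ((q - r\<^sup>2 / q) / 2) (sqrt (((q - r\<^sup>2 / q) / 2)\<^sup>2 + r\<^sup>2)) * ennreal (V * r ^ (n - 1)) * indicator {0<..} r
        * ennreal ((1 + r\<^sup>2 / q\<^sup>2) / 2) * indicator {0<..} q \<partial>lborel)"
    proof (cases "0 < r")
      case True
      show ?thesis by (rule nn_integral_hyperbola_substitution[OF _ True]) measurable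
    qed simp
  qed
  also have "\<dots> = (\<integral>\<^sup>+q. (\<integral>\<^sup>+r. \<Psi> ((q - r\<^sup>2 / q) / 2) (sqrt (((q - r\<^sup>2 / q) / 2)\<^sup>2 + r\<^sup>2)) * ennreal (V * r ^ (n - 1)) * indicator {0<..} r
        * ennreal ((1 + r\<^sup>2 / q\<^sup>2) / 2) * indicator {0<..} q \<partial>lborel) \<partial>lborel)"
    by (rule lborel_pair.Fubini') measurable
  also have "\<dots> = (\<integral>\<^sup>+q. (\<integral>\<^sup>+\<rho>. (H (1 / sqrt (1 + \<rho>\<^sup>2)) * ennreal (V * \<rho> ^ (n - 1) * ((1 + \<rho>\<^sup>2) / 2)) * indicator {0<..} \<rho>)
        * (ennreal (q ^ n) * indicator {0<..<2 / (1 + \<rho>\<^sup>2)} q) \<partial>lborel) \<partial>lborel)"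
  proof (rule nn_integral_cong)
    fix q :: real
    show "(\<integral>\<^sup>+r. \<Psi> ((q - r\<^sup>2 / q) / 2) (sqrt (((q - r\<^sup>2 / q) / 2)\<^sup>2 + r\<^sup>2)) * ennreal (V * r ^ (n - 1)) * indicator {0<..} r
        * ennreal ((1 + r\<^sup>2 / q\<^sup>2) / 2) * indicator {0<..} q \<partial>lborel) =
      (\<integral>\<^sup>+\<rho>. (H (1 / sqrt (1 + \<rho>\<^sup>2)) * ennreal (V * \<rho> ^ (n - 1) * ((1 + \<rho>\<^sup>2) / 2)) * indicator {0<..} \<rho>)
        * (ennreal (q ^ n) * indicator {0<..<2 / (1 + \<rho>\<^sup>2)} q) \<partial>lborel)" (is "(\<integral>\<^sup>+r. ?f r \<partial>_) = ?R")
    proof (cases "0 < q")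
      case True
      \<comment> \<open>Rescaling \<open>r = q * \<rho>\<close>.\<close>
      have "(\<integral>\<^sup>+r. ?f r \<partial>lborel) = ennreal \<bar>q\<bar> * (\<integral>\<^sup>+\<rho>. ?f (0 + q * \<rho>) \<partial>lborel)"
        using True by (intro nn_integral_real_affine) auto
      also have "\<dots> = (\<integral>\<^sup>+\<rho>. ennreal q * ?f (q * \<rho>) \<partial>lborel)"
        using True by (subst nn_integral_cmult) auto
      also have "\<dots> = ?R"
      proof (rule nn_integral_cong)
        fix \<rho> :: real
        show "ennreal q * ?f (q * \<rho>) =
          (H (1 / sqrt (1 + \<rho>\<^sup>2)) * ennreal (V * \<rho> ^ (n - 1) * ((1 + \<rho>\<^sup>2) / 2)) * indicator {0<..} \<rho>)
        * (ennreal (q ^ n) * indicator {0<..<2 / (1 + \<rho>\<^sup>2)} q)"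
        proof (cases "0 < \<rho>")
          case False
          then have "\<not> 0 < q * \<rho>" using True by (simp add: zero_less_mult_iff)
          then show ?thesis using False by simp
        next
          case \<rho>: True
          have t: "(q - (q * \<rho>)\<^sup>2 / q) / 2 = q * (1 - \<rho>\<^sup>2) / 2"
            using True by (simp add: power2_eq_square field_simps)
          have "(q * (1 - \<rho>\<^sup>2) / 2)\<^sup>2 + (q * \<rho>)\<^sup>2 = (q * (1 + \<rho>\<^sup>2) / 2)\<^sup>2"
            by (simp add: power2_eq_square field_simps)
          then have N: "sqrt ((q * (1 - \<rho>\<^sup>2) / 2)\<^sup>2 + (q * \<rho>)\<^sup>2) = q * (1 + \<rho>\<^sup>2) / 2"
            using True sq(2)[of \<rho>] by simp
          have r: "(1 + (q * (1 - \<rho>\<^sup>2) / 2) / (q * (1 + \<rho>\<^sup>2) / 2)) / 2 = 1 / (1 + \<rho>\<^sup>2)"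
          proof -
            have "(q * (1 - P) / 2) / (q * (1 + P) / 2) = (1 - P) / (1 + P)" for P
              using True by simp
            moreover have "(1 + (1 - P) / (1 + P)) / 2 = 1 / (1 + P)" if "1 + P \<noteq> 0" for P :: real
              using that by (simp add: field_simps)
            ultimately show ?thesis using sq(1)[of \<rho>] by metis
          qed
          have \<Psi>: "\<Psi> (q * (1 - \<rho>\<^sup>2) / 2) (q * (1 + \<rho>\<^sup>2) / 2) =
              H (1 / sqrt (1 + \<rho>\<^sup>2)) * indicator {0<..<2 / (1 + \<rho>\<^sup>2)} q"
            unfolding \<Psi>_def r using True sq(2)[of \<rho>]
            by (auto simp: indicator_def field_simps real_sqrt_divide)
          have 1: "1 + (q * \<rho>)\<^sup>2 / q\<^sup>2 = 1 + \<rho>\<^sup>2" using True by (simp add: power_mult_distrib)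
          have 2: "ennreal q * ennreal (V * (q * \<rho>) ^ (n - 1)) * ennreal ((1 + \<rho>\<^sup>2) / 2)
             = ennreal (V * \<rho> ^ (n - 1) * ((1 + \<rho>\<^sup>2) / 2)) * ennreal (q ^ n)"
          proof -
            have "q * (V * (q * \<rho>) ^ (n - 1)) * ((1 + \<rho>\<^sup>2) / 2) = V * \<rho> ^ (n - 1) * ((1 + \<rho>\<^sup>2) / 2) * q ^ n"
              using n(1) by (cases n) (simp_all add: power_mult_distrib)
            then show ?thesis using True \<rho> V by (simp add: ennreal_mult'[symmetric])
          qed
          have ind: "indicator {0<..} (q * \<rho>) = (1::ennreal)" "indicator {0<..} q = (1::ennreal)"
              "indicator {0<..} \<rho> = (1::ennreal)"
            using True \<rho> by simp_all
          show ?thesis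
            unfolding t N \<Psi> 1 ind mult_1_right
            using arg_cong[OF 2, of "\<lambda>x. H (1 / sqrt (1 + \<rho>\<^sup>2)) * indicator {0<..<2 / (1 + \<rho>\<^sup>2)} q * x"]
            by (simp only: mult_ac)
        qed
      qed
      finally show ?thesis .
    qed simp
  qed
  also have "\<dots> = (\<integral>\<^sup>+\<rho>. (\<integral>\<^sup>+q. (H (1 / sqrt (1 + \<rho>\<^sup>2)) * ennreal (V * \<rho> ^ (n - 1) * ((1 + \<rho>\<^sup>2) / 2)) * indicator {0<..} \<rho>)
        * (ennreal (q ^ n) * indicator {0<..<2 / (1 + \<rho>\<^sup>2)} q) \<partial>lborel) \<partial>lborel)"
  proof -
    have [measurable]: "Measurable.pred (borel \<Otimes>\<^sub>M borel) (\<lambda>x::real \<times> real. snd x \<in> {0<..<2 / (1 + (fst x)\<^sup>2)})"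
      unfolding greaterThanLessThan_iff by measurable
    show ?thesis by (rule lborel_pair.Fubini') measurable
  qed
  also have "\<dots> = (\<integral>\<^sup>+\<rho>. ennreal (V * W / c_const DIM('a)) * (H (1 / sqrt (1 + \<rho>\<^sup>2)) * ennreal (\<rho> ^ (n - 1) / (1 + \<rho>\<^sup>2) ^ n) * indicator {0<..} \<rho>) \<partial>lborel)"
  proof (rule nn_integral_cong)
    fix \<rho> :: real
    define m where "m = 2 / (1 + \<rho>\<^sup>2)"
    have m: "0 < m" using sq(2)[of \<rho>] by (simp add: m_def)
    have "(\<integral>\<^sup>+q. ennreal (q ^ n) * indicator {0<..<m} q \<partial>lborel) = (\<integral>\<^sup>+q. ennreal (q ^ n) * indicator {0..m} q \<partial>lborel)"
      using AE_lborel_singleton[of "0::real"] AE_lborel_singleton[of m]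
      by (intro nn_integral_cong_AE, eventually_elim) (auto simp: indicator_def)
    also have "\<dots> = ennreal (m ^ Suc n / real (Suc n) - 0 ^ Suc n / real (Suc n))"
      using m by (intro nn_integral_FTC_Icc) (auto intro!: derivative_eq_intros simp del: power_Suc)
    finally have inner: "(\<integral>\<^sup>+q. ennreal (q ^ n) * indicator {0<..<m} q \<partial>lborel) = ennreal (m ^ Suc n / real (Suc n))"
      by simp
    have const: "V * \<rho> ^ (n - 1) * ((1 + \<rho>\<^sup>2) / 2) * (m ^ Suc n / real (Suc n)) =
        V * W / c_const DIM('a) * (\<rho> ^ (n - 1) / (1 + \<rho>\<^sup>2) ^ n)"
    proof -
      have "W / c_const DIM('a) = 2 ^ n / real (Suc n)"
        using W by (simp add: cW del: of_nat_Suc)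
      then have 1: "V * W / c_const DIM('a) = V * (2 ^ n / real (Suc n))"
        by (metis times_divide_eq_right)
      have 2: "(1 + \<rho>\<^sup>2) / 2 * m ^ Suc n = 2 ^ n / (1 + \<rho>\<^sup>2) ^ n"
        using sq(1)[of \<rho>] by (simp add: m_def power_divide)
      have "V * \<rho> ^ (n - 1) * ((1 + \<rho>\<^sup>2) / 2) * (m ^ Suc n / real (Suc n)) =
          V * \<rho> ^ (n - 1) * ((1 + \<rho>\<^sup>2) / 2 * m ^ Suc n) / real (Suc n)"
      proof -
        have "A * (B / 2) * (C / D) = A * (B / 2 * C) / D" for A B C D :: real by simp
        then show ?thesis .
      qed
      then show ?thesis unfolding 1 2 by (simp add: mult_ac del: of_nat_Suc)
    qed
    show "(\<integral>\<^sup>+q. (H (1 / sqrt (1 + \<rho>\<^sup>2)) * ennreal (V * \<rho> ^ (n - 1) * ((1 + \<rho>\<^sup>2) / 2)) * indicator {0<..} \<rho>)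
        * (ennreal (q ^ n) * indicator {0<..<2 / (1 + \<rho>\<^sup>2)} q) \<partial>lborel) =
      ennreal (V * W / c_const DIM('a)) * (H (1 / sqrt (1 + \<rho>\<^sup>2)) * ennreal (\<rho> ^ (n - 1) / (1 + \<rho>\<^sup>2) ^ n) * indicator {0<..} \<rho>)"
      unfolding m_def[symmetric]
    proof (subst nn_integral_cmult)
      show "H (1 / sqrt (1 + \<rho>\<^sup>2)) * ennreal (V * \<rho> ^ (n - 1) * ((1 + \<rho>\<^sup>2) / 2)) * indicator {0<..} \<rho> *
          (\<integral>\<^sup>+q. ennreal (q ^ n) * indicator {0<..<m} q \<partial>lborel) =
        ennreal (V * W / c_const DIM('a)) * (H (1 / sqrt (1 + \<rho>\<^sup>2)) * ennreal (\<rho> ^ (n - 1) / (1 + \<rho>\<^sup>2) ^ n) * indicator {0<..} \<rho>)"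
      proof (cases "0 < \<rho>")
        case True
        have c: "0 \<le> V * W / c_const DIM('a)"
          using V W by (simp add: cW del: of_nat_Suc)
        have "ennreal (V * \<rho> ^ (n - 1) * ((1 + \<rho>\<^sup>2) / 2)) * ennreal (m ^ Suc n / real (Suc n)) =
            ennreal (V * W / c_const DIM('a)) * ennreal (\<rho> ^ (n - 1) / (1 + \<rho>\<^sup>2) ^ n)"
          using True V m c const by (simp only: ennreal_mult'[symmetric] c) (subst ennreal_mult'[symmetric], auto)
        note eq = this
        have ind: "indicator {0<..} \<rho> = (1::ennreal)" using True by simp
        show ?thesis
          unfolding inner ind mult_1_right
          using arg_cong[OF eq, of "\<lambda>x. H (1 / sqrt (1 + \<rho>\<^sup>2)) * x"] by (simp only: mult_ac)
      qed simp
    qed measurable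
  qed
  also have "\<dots> = ennreal (V * W / c_const DIM('a)) * (\<integral>\<^sup>+\<rho>. H (1 / sqrt (1 + \<rho>\<^sup>2)) * ennreal (\<rho> ^ (n - 1) / (1 + \<rho>\<^sup>2) ^ n) * indicator {0<..} \<rho> \<partial>lborel)"
    by (rule nn_integral_cmult) measurable
  finally have "(\<integral>\<^sup>+\<theta>. H (norm (\<theta> + b) / 2) \<partial>sphere_uniform) =
     ennreal (V * W / c_const DIM('a)) * (\<integral>\<^sup>+\<rho>. H (1 / sqrt (1 + \<rho>\<^sup>2)) * ennreal (\<rho> ^ (n - 1) / (1 + \<rho>\<^sup>2) ^ n) * indicator {0<..} \<rho> \<partial>lborel) / ennreal W"
    by (simp add: nn_integral_sphere_uniform W_def)
  also have "\<dots> = (ennreal (V * W / c_const DIM('a)) / ennreal W) * (\<integral>\<^sup>+\<rho>. H (1 / sqrt (1 + \<rho>\<^sup>2)) * ennreal (\<rho> ^ (n - 1) / (1 + \<rho>\<^sup>2) ^ n) * indicator {0<..} \<rho> \<partial>lborel)"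
    by (simp only: divide_ennreal_def mult_ac)
  also have "ennreal (V * W / c_const DIM('a)) / ennreal W = ennreal (V / c_const DIM('a))"
    using V W by (subst divide_ennreal) (auto simp: cW simp del: of_nat_Suc)
  finally show ?thesis by (simp add: V_def)
qed

lemma nn_integral_sphere_uniform_stereographic:
  fixes e :: "'a::euclidean_space" and H :: "real \<Rightarrow> ennreal"
  assumes e: "norm e = 1" and d: "2 \<le> DIM('a)" and [measurable]: "H \<in> borel_measurable borel"
  defines "n \<equiv> DIM('a) - 1"
  shows "(\<integral>\<^sup>+\<theta>. H (norm (\<theta> - e) / 2) \<partial>sphere_uniform) =
    ennreal (real n * unit_ball_vol (real n) / c_const DIM('a)) *
    (\<integral>\<^sup>+\<rho>. H (1 / sqrt (1 + \<rho>\<^sup>2)) * ennreal (\<rho> ^ (n - 1) / (1 + \<rho>\<^sup>2) ^ n) * indicator {0<..} \<rho> \<partial>lborel)"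
proof -
  obtain b :: 'a where b: "b \<in> Basis" using nonempty_Basis by blast
  have "(\<integral>\<^sup>+\<theta>. H (norm (\<theta> - e) / 2) \<partial>sphere_uniform) = (\<integral>\<^sup>+\<theta>. H (norm (\<theta> - (- b)) / 2) \<partial>sphere_uniform)"
    by (rule nn_integral_sphere_uniform_chord[of "\<lambda>x. H (x / 2)"]) (use e b in auto)
  then show ?thesis
    using nn_integral_sphere_uniform_stereographic_axis[OF b d, of H] by (simp add: n_def)
qed

section \<open>The function $I_d$\<close>

lemma AE_sphere_uniform_norm: "AE \<theta> in (sphere_uniform :: 'a::euclidean_space measure). norm \<theta> = 1"
proof -
  have "AE x in uniform_measure lborel (ball 0 1 :: 'a set). x \<noteq> 0"
    using AE_lborel_singleton[of "0::'a"] by (intro AE_uniform_measureI) (auto elim!: eventually_mono)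
  then have "AE x in uniform_measure lborel (ball 0 1 :: 'a set). norm (x /\<^sub>R norm x) = 1"
    by (elim eventually_mono) simp
  then show ?thesis
    unfolding sphere_uniform_def by (subst AE_distr_iff) auto
qed

text \<open>
  Numerator and denominator arise from the conjugates $\sqrt{\rho^2 + \cosh^2 u} \pm \sinh u$, whose product
  is $1 + \rho^2$.
\<close>

lemma busemann_factor_eq_divide:
  assumes "0 \<le> u"
  shows "busemann_factor u (1 / sqrt (1 + \<rho>\<^sup>2)) = (1 + \<rho>\<^sup>2) / (sqrt (\<rho>\<^sup>2 + (cosh u)\<^sup>2) - sinh u)\<^sup>2"
proof -
  define R where "R = sqrt (\<rho>\<^sup>2 + (cosh u)\<^sup>2)"
  define m where "m = sqrt (1 + \<rho>\<^sup>2)"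
  have m: "0 < m" "m\<^sup>2 = 1 + \<rho>\<^sup>2" by (auto simp: m_def add_pos_nonneg)
  have R2: "R\<^sup>2 = m\<^sup>2 + (sinh u)\<^sup>2" unfolding m(2) by (simp add: R_def cosh_square_eq)
  have R: "sinh u < R"
    using zero_le_power2[of \<rho>] unfolding R_def cosh_square_eq by (intro real_less_rsqrt) linarith
  have "sqrt (1 + (sinh u * (1 / m))\<^sup>2) = sqrt (R\<^sup>2 / m\<^sup>2)"
    using m(1) unfolding R2 by (intro arg_cong[where f = sqrt]) (simp add: field_simps)
  also have "\<dots> = R / m" using m(1) by (simp add: R_def real_sqrt_divide)
  finally have "busemann_factor u (1 / m) = ((R + sinh u) / m)\<^sup>2"
    by (simp add: busemann_factor_def add_divide_distrib)
  also have "\<dots> = m\<^sup>2 / (R - sinh u)\<^sup>2"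
  proof -
    have "(R + sinh u) * (R - sinh u) = m\<^sup>2" using R2 by (simp add: algebra_simps power2_eq_square)
    then have "R + sinh u = m\<^sup>2 / (R - sinh u)" using R by (simp add: field_simps)
    then have "(R + sinh u) / m = m / (R - sinh u)" using m(1) by (simp add: power2_eq_square)
    then show ?thesis by (simp add: power_divide)
  qed
  finally show ?thesis unfolding m(2) by (simp add: m_def R_def)
qed

text \<open>
  The inner integral of $I_d$.  The two conditions confine \<open>\<rho>\<close> to the interval from
  $\sqrt{S + \cosh^2 u} - \sinh u$ to $\sqrt{1 + S}$, which lies in the positive half-line and is never empty.
\<close>

lemma integral_inverse_power_strip:
  assumes n: "0 < n" and u: "0 \<le> u" and S: "0 \<le> S"
  shows "(LINT \<rho>:{0<..}|lborel. 1 / \<rho> ^ (2 * n + 1) * of_bool ((\<rho> + sinh u)\<^sup>2 \<ge> S + (cosh u)\<^sup>2) * of_bool (\<rho>\<^sup>2 \<le> 1 + S))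
    = (1 / (sqrt (S + (cosh u)\<^sup>2) - sinh u) ^ (2 * n) - 1 / (1 + S) ^ n) / (2 * real n)"
    and "1 / (1 + S) ^ n \<le> 1 / (sqrt (S + (cosh u)\<^sup>2) - sinh u) ^ (2 * n)"
proof -
  define s where "s = sinh u"
  define R where "R = sqrt (S + (cosh u)\<^sup>2)"
  define lo where "lo = R - s"
  define hi where "hi = sqrt (1 + S)"
  have s: "0 \<le> s" using u by (simp add: s_def)
  have R2: "R\<^sup>2 = 1 + S + s\<^sup>2" using S by (simp add: R_def s_def cosh_square_eq)
  have R: "s < R" unfolding R_def cosh_square_eq s_def using S by (intro real_less_rsqrt) simp
  have hi: "0 < hi" "hi\<^sup>2 = 1 + S" using S by (auto simp: hi_def)
  have lo: "0 < lo" using R by (simp add: lo_def)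
  have lohi: "lo \<le> hi"
  proof -
    have "R \<le> hi + s"
      unfolding R_def cosh_square_eq s_def[symmetric]
      using hi s S by (intro real_le_lsqrt) (auto simp: power2_sum)
    then show ?thesis by (simp add: lo_def)
  qed
  have hin: "hi ^ (2 * n) = (1 + S) ^ n" by (simp add: power_mult hi(2))
  have "(LINT \<rho>:{0<..}|lborel. 1 / \<rho> ^ (2 * n + 1) * of_bool ((\<rho> + s)\<^sup>2 \<ge> S + (cosh u)\<^sup>2) * of_bool (\<rho>\<^sup>2 \<le> 1 + S))
      = (\<integral>\<rho>. (1 / \<rho> ^ (2 * n + 1)) * indicator {lo..hi} \<rho> \<partial>lborel)"
    unfolding set_lebesgue_integral_def
  proof (intro Bochner_Integration.integral_cong refl)
    fix \<rho> :: real
    show "indicator {0<..} \<rho> *\<^sub>R (1 / \<rho> ^ (2 * n + 1) * of_bool ((\<rho> + s)\<^sup>2 \<ge> S + (cosh u)\<^sup>2) * of_bool (\<rho>\<^sup>2 \<le> 1 + S))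
        = 1 / \<rho> ^ (2 * n + 1) * indicator {lo..hi} \<rho>"
    proof (cases "0 < \<rho>")
      case False
      then show ?thesis using lo by auto
    next
      case True
      have "S + (cosh u)\<^sup>2 = R\<^sup>2" using S by (simp add: R_def)
      then have "(\<rho> + s)\<^sup>2 \<ge> S + (cosh u)\<^sup>2 \<longleftrightarrow> R \<le> \<rho> + s"
        using True s R by (simp add: power_mono_iff)
      moreover have "\<rho>\<^sup>2 \<le> 1 + S \<longleftrightarrow> \<rho> \<le> hi"
        unfolding hi(2)[symmetric] using True hi by (intro power_mono_iff) auto
      ultimately show ?thesis using True by (auto simp: indicator_def lo_def)
    qed
  qed
  also have "\<dots> = - 1 / (2 * real n * hi ^ (2 * n)) - (- 1 / (2 * real n * lo ^ (2 * n)))"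
  proof (rule integral_FTC_Icc_real[OF lohi])
    fix x assume "lo \<le> x" "x \<le> hi"
    then have x: "0 < x" using lo by simp
    have "((\<lambda>x. - 1 / (2 * real n * x ^ (2 * n))) has_real_derivative
        (2 * real n * (real (2 * n) * x ^ (2 * n - 1))) / (2 * real n * x ^ (2 * n))\<^sup>2) (at x)"
      using x n by (auto intro!: derivative_eq_intros simp: power2_eq_square)
    also have "(2 * real n * (real (2 * n) * x ^ (2 * n - 1))) / (2 * real n * x ^ (2 * n))\<^sup>2 = 1 / x ^ (2 * n + 1)"
    proof -
      have "x ^ (2 * n) * x ^ (2 * n) = x ^ (2 * n - 1) * x ^ (2 * n + 1)"
        using n unfolding power_add[symmetric] by (intro arg_cong[where f = "power x"]) simp
      then show ?thesis using x n by (simp add: power2_eq_square field_simps)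
    qed
    finally show "((\<lambda>x. - 1 / (2 * real n * x ^ (2 * n))) has_real_derivative 1 / x ^ (2 * n + 1)) (at x)" .
    show "isCont (\<lambda>\<rho>. 1 / \<rho> ^ (2 * n + 1)) x" using x by (intro continuous_intros) auto
  qed
  also have "\<dots> = (1 / lo ^ (2 * n) - 1 / (1 + S) ^ n) / (2 * real n)"
    unfolding hin using n by (simp add: diff_divide_distrib mult.commute)
  finally show "(LINT \<rho>:{0<..}|lborel. 1 / \<rho> ^ (2 * n + 1) * of_bool ((\<rho> + sinh u)\<^sup>2 \<ge> S + (cosh u)\<^sup>2) * of_bool (\<rho>\<^sup>2 \<le> 1 + S))
    = (1 / (sqrt (S + (cosh u)\<^sup>2) - sinh u) ^ (2 * n) - 1 / (1 + S) ^ n) / (2 * real n)"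
    by (simp only: lo_def R_def s_def)
  have "lo ^ (2 * n) \<le> (1 + S) ^ n" unfolding hin[symmetric] using lo lohi by (intro power_mono) auto
  then show "1 / (1 + S) ^ n \<le> 1 / (sqrt (S + (cosh u)\<^sup>2) - sinh u) ^ (2 * n)"
    using lo S unfolding lo_def R_def s_def by (intro divide_left_mono) auto
qed

lemma busemann_factor_le_exp:
  assumes u: "0 \<le> u" and x: "0 \<le> x" "x \<le> 1"
  shows "busemann_factor u x \<le> exp (2 * u)"
proof -
  have s: "0 \<le> sinh u" using u by simp
  have sx: "sinh u * x \<le> sinh u" using s x by (simp add: mult_left_le)
  have "sqrt (1 + (sinh u * x)\<^sup>2) \<le> sqrt (1 + (sinh u)\<^sup>2)"
    using sx s x by (intro real_sqrt_le_mono add_left_mono power_mono) auto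
  also have "\<dots> = cosh u"
    using cosh_square_eq[of u] cosh_real_ge_1[of u] by (simp add: real_sqrt_unique add.commute)
  finally have "sqrt (1 + (sinh u * x)\<^sup>2) + sinh u * x \<le> exp u"
    using sx cosh_plus_sinh[of u] by linarith
  then have "busemann_factor u x \<le> (exp u)\<^sup>2"
    unfolding busemann_factor_def using s x by (intro power_mono) auto
  then show ?thesis by (simp add: exp_double)
qed

lemma busemann_factor_ge_1:
  assumes u: "0 \<le> u" and x: "0 \<le> x"
  shows "1 \<le> busemann_factor u x"
proof -
  have "1 \<le> sqrt (1 + (sinh u * x)\<^sup>2)" by simp
  then have "1 \<le> sqrt (1 + (sinh u * x)\<^sup>2) + sinh u * x" using u x by (simp add: add_increasing2)
  then show ?thesis unfolding busemann_factor_def by simp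
qed

text \<open>
  Let $\sinh w = x \sinh u$ and $\sinh w' = y \sinh u$.  Multiplying out $e^w e^{w'}$ and using
  $\cosh w \cosh w' \ge \cosh u$ and $x + y \ge 1$ gives $e^{w + w'} \ge \cosh u + \sinh u = e^u$; the claim then follows from the
  inequality between arithmetic and geometric mean.  It applies to $x = |\theta - e|/2$ and
  $y = |\theta + e|/2$ for unit vectors.
\<close>

lemma busemann_factor_antipodal:
  assumes u: "0 \<le> u" and x: "0 \<le> x" and y: "0 \<le> y" and xy: "x\<^sup>2 + y\<^sup>2 = 1"
  shows "2 * exp (real n * u) \<le> busemann_factor u x ^ n + busemann_factor u y ^ n"
proof -
  define s where "s = sinh u"
  define p where "p = sqrt (1 + (s * x)\<^sup>2)"
  define q where "q = sqrt (1 + (s * y)\<^sup>2)"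
  have s: "0 \<le> s" using u by (simp add: s_def)
  have p: "1 \<le> p" and q: "1 \<le> q" by (auto simp: p_def q_def)
  have "(cosh u)\<^sup>2 = 1 + s\<^sup>2 * (x\<^sup>2 + y\<^sup>2)" by (simp add: xy s_def cosh_square_eq)
  also have "\<dots> \<le> (1 + (s * x)\<^sup>2) * (1 + (s * y)\<^sup>2)" by (simp add: algebra_simps)
  also have "\<dots> = (p * q)\<^sup>2" by (simp add: p_def q_def power_mult_distrib)
  finally have pq: "cosh u \<le> p * q" using p q by (intro power2_le_imp_le[of "cosh u"]) auto
  have "1 \<le> (x + y)\<^sup>2" using x y xy by (simp add: power2_sum)
  then have xy1: "1 \<le> x + y" using x y by (intro power2_le_imp_le[of 1]) auto
  have "s \<le> s * (x + y)" using mult_left_mono[OF xy1 s] by simp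
  also have "\<dots> \<le> s * x * q + s * y * p"
    using s x y p q mult_left_mono[of 1 q "s * x"] mult_left_mono[of 1 p "s * y"] by (simp add: algebra_simps)
  finally have "exp u \<le> p * q + s * x * q + s * y * p + s * x * (s * y)"
    using pq mult_nonneg_nonneg[OF mult_nonneg_nonneg[OF s x] mult_nonneg_nonneg[OF s y]]
      cosh_plus_sinh[of u] unfolding s_def by linarith
  also have "\<dots> = (p + s * x) * (q + s * y)" by (simp add: algebra_simps)
  finally have AB: "exp u \<le> (p + s * x) * (q + s * y)" .
  define A where "A = (p + s * x) ^ n"
  define B where "B = (q + s * y) ^ n"
  have "exp (real n * u) = exp u ^ n" by (simp add: exp_of_nat_mult)
  also have "\<dots> \<le> A * B" unfolding A_def B_def power_mult_distrib[symmetric] using AB by (intro power_mono) auto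
  finally have "2 * exp (real n * u) \<le> 2 * A * B" by simp
  also have "\<dots> \<le> A\<^sup>2 + B\<^sup>2" using sum_squares_bound[of A B] .
  also have "A\<^sup>2 = busemann_factor u x ^ n"
    by (simp add: A_def busemann_factor_def p_def s_def power_mult[symmetric] mult.commute)
  also have "B\<^sup>2 = busemann_factor u y ^ n"
    by (simp add: B_def busemann_factor_def q_def s_def power_mult[symmetric] mult.commute)
  finally show ?thesis .
qed

lemma borel_measurable_busemann_factor[measurable]: "busemann_factor u \<in> borel_measurable borel"
  unfolding busemann_factor_def by measurable

text \<open>
  After the inner integration the integrand of $I_d$ is a difference of two terms.  By
  \<open>busemann_factor_eq_divide\<close> they are the density of the stereographic law multiplied by the factor in
  question, and that density itself.  So $I_d(u)$ is an expectation minus 1.  The second equation keeps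
  the expectation as a one-dimensional integral for the beta-type formula.
\<close>

lemma nn_integral_busemann_factor:
  fixes e :: "'a::euclidean_space"
  assumes e: "norm e = 1" and d: "2 \<le> DIM('a)" and u: "0 \<le> u"
  defines "n \<equiv> DIM('a) - 1"
  defines "K \<equiv> real n * unit_ball_vol (real n) / c_const DIM('a)"
  shows "(\<integral>\<^sup>+\<theta>. ennreal (busemann_factor u (norm (\<theta> - e) / 2) ^ n) \<partial>sphere_uniform) = ennreal (1 + I_fun DIM('a) u)"
    and "ennreal (1 + I_fun DIM('a) u) = ennreal K *
      (\<integral>\<^sup>+\<rho>. ennreal (\<rho> ^ (n - 1) / (sqrt (\<rho>\<^sup>2 + (cosh u)\<^sup>2) - sinh u) ^ (2 * n)) * indicator {0<..} \<rho> \<partial>lborel)"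
    and "0 \<le> I_fun DIM('a) u"
proof -
  interpret \<sigma>: prob_space "sphere_uniform :: 'a measure" by (rule prob_space_sphere_uniform)
  have n: "0 < n" "DIM('a) = Suc n" using d by (auto simp: n_def)
  define c where "c = c_const DIM('a)"
  have c: "0 < c"
    unfolding c_def c_const_def using d by (auto intro!: divide_pos_pos mult_pos_pos Gamma_real_pos)
  define V where "V = unit_ball_vol (real n)"
  have V: "0 < V" unfolding V_def by (rule unit_ball_vol_pos) simp
  have K: "0 < K" using n c V unfolding K_def V_def[symmetric] c_def[symmetric] by simp
  define f where "f \<rho> = 1 / (sqrt (\<rho>\<^sup>2 + (cosh u)\<^sup>2) - sinh u) ^ (2 * n)" for \<rho>
  define g where "g \<rho> = 1 / (1 + \<rho>\<^sup>2) ^ n" for \<rho> :: real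
  have gf: "0 \<le> g \<rho>" "g \<rho> \<le> f \<rho>" for \<rho>
    using integral_inverse_power_strip(2)[OF n(1) u, of "\<rho>\<^sup>2"] by (auto simp: f_def g_def)
  have [measurable]: "f \<in> borel_measurable borel" "g \<in> borel_measurable borel"
    unfolding f_def g_def by measurable
  define P where "P = (\<integral>\<^sup>+\<rho>. ennreal (f \<rho>) * ennreal (\<rho> ^ (n - 1)) * indicator {0<..} \<rho> \<partial>lborel)"
  define Q where "Q = (\<integral>\<^sup>+\<rho>. ennreal (g \<rho>) * ennreal (\<rho> ^ (n - 1)) * indicator {0<..} \<rho> \<partial>lborel)"
  define D where "D = (\<integral>\<^sup>+\<rho>. ennreal (f \<rho> - g \<rho>) * ennreal (\<rho> ^ (n - 1)) * indicator {0<..} \<rho> \<partial>lborel)"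
  define E where "E = (\<integral>\<^sup>+\<theta>. ennreal (busemann_factor u (norm (\<theta> - e) / 2) ^ n) \<partial>sphere_uniform)"
  have KQ: "ennreal K * Q = 1"
  proof -
    have "1 = (\<integral>\<^sup>+\<theta>. 1 \<partial>(sphere_uniform :: 'a measure))" by (simp add: \<sigma>.emeasure_space_1)
    also have "\<dots> = ennreal K * (\<integral>\<^sup>+\<rho>. 1 * ennreal (\<rho> ^ (n - 1) / (1 + \<rho>\<^sup>2) ^ n) * indicator {0<..} \<rho> \<partial>lborel)"
      unfolding K_def n_def by (rule nn_integral_sphere_uniform_stereographic[OF e d]) simp
    also have "(\<integral>\<^sup>+\<rho>. 1 * ennreal (\<rho> ^ (n - 1) / (1 + \<rho>\<^sup>2) ^ n) * indicator {0<..} \<rho> \<partial>lborel) = Q"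
      unfolding Q_def
      by (intro nn_integral_cong) (auto simp: indicator_def g_def ennreal_mult'[symmetric])
    finally show ?thesis ..
  qed
  have E_eq: "E = ennreal K * P"
  proof -
    have "E = ennreal K * (\<integral>\<^sup>+\<rho>. ennreal (busemann_factor u (1 / sqrt (1 + \<rho>\<^sup>2)) ^ n) *
        ennreal (\<rho> ^ (n - 1) / (1 + \<rho>\<^sup>2) ^ n) * indicator {0<..} \<rho> \<partial>lborel)"
      unfolding K_def n_def E_def by (rule nn_integral_sphere_uniform_stereographic[OF e d]) simp
    also have "(\<integral>\<^sup>+\<rho>. ennreal (busemann_factor u (1 / sqrt (1 + \<rho>\<^sup>2)) ^ n) *
        ennreal (\<rho> ^ (n - 1) / (1 + \<rho>\<^sup>2) ^ n) * indicator {0<..} \<rho> \<partial>lborel) = P"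
      unfolding P_def
    proof (rule nn_integral_cong)
      fix \<rho> :: real
      have 1: "0 < 1 + \<rho>\<^sup>2" by (simp add: add_pos_nonneg)
      have "busemann_factor u (1 / sqrt (1 + \<rho>\<^sup>2)) ^ n * (\<rho> ^ (n - 1) / (1 + \<rho>\<^sup>2) ^ n) = f \<rho> * \<rho> ^ (n - 1)"
        using 1 unfolding busemann_factor_eq_divide[OF u] f_def by (simp add: power_divide power_mult)
      then show "ennreal (busemann_factor u (1 / sqrt (1 + \<rho>\<^sup>2)) ^ n) * ennreal (\<rho> ^ (n - 1) / (1 + \<rho>\<^sup>2) ^ n) * indicator {0<..} \<rho>
          = ennreal (f \<rho>) * ennreal (\<rho> ^ (n - 1)) * indicator {0<..} \<rho>"
        using gf[of \<rho>] 1 busemann_factor_pos[of u "1 / sqrt (1 + \<rho>\<^sup>2)"]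
        by (auto simp: indicator_def ennreal_mult'[symmetric] less_imp_le)
    qed
    finally show ?thesis .
  qed
  have E_fin: "E < \<top>"
  proof -
    have "E \<le> (\<integral>\<^sup>+\<theta>. ennreal (exp (2 * u) ^ n) \<partial>(sphere_uniform :: 'a measure))"
      unfolding E_def
    proof (rule nn_integral_mono_AE)
      show "AE \<theta> in sphere_uniform. ennreal (busemann_factor u (norm (\<theta> - e) / 2) ^ n) \<le> ennreal (exp (2 * u) ^ n)"
        using AE_sphere_uniform_norm
      proof eventually_elim
        case (elim \<theta>)
        have "norm (\<theta> - e) \<le> 2" using norm_triangle_ineq4[of \<theta> e] elim e by simp
        then show ?case
          using u by (intro ennreal_leI power_mono busemann_factor_le_exp less_imp_le[OF busemann_factor_pos]) auto
      qed
    qed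
    also have "\<dots> < \<top>" by (simp add: \<sigma>.emeasure_space_1 ennreal_less_top)
    finally show ?thesis .
  qed
  \<comment> \<open>\<open>D\<close> is a finite integral of a difference; the equation \<open>P = D + Q\<close> avoids subtraction in \<^typ>\<open>ennreal\<close>.\<close>
  have PDQ: "P = D + Q"
  proof -
    have "ennreal (f \<rho>) = ennreal (f \<rho> - g \<rho>) + ennreal (g \<rho>)" for \<rho>
      using gf[of \<rho>] by (simp add: ennreal_plus[symmetric] del: ennreal_plus)
    then show ?thesis
      unfolding P_def D_def Q_def by (subst nn_integral_add[symmetric]) (auto simp: distrib_right)
  qed
  have fin: "P < \<top>" "Q < \<top>" "D < \<top>"
  proof -
    show "P < \<top>" using E_fin K unfolding E_eq by (auto simp: ennreal_mult_less_top)
    then show "Q < \<top>" "D < \<top>" unfolding PDQ by auto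
  qed
  have I: "I_fun DIM('a) u = K * enn2real D"
  proof -
    define N where "N x = sqrt (\<Sum>i<n. (x i)\<^sup>2)" for x :: "nat \<Rightarrow> real"
    have N2: "(N x)\<^sup>2 = (\<Sum>i<n. (x i)\<^sup>2)" for x by (simp add: N_def sum_nonneg)
    have [measurable]: "N \<in> borel_measurable (\<Pi>\<^sub>M i\<in>{..<n}. lborel)"
      unfolding N_def by measurable
    have "I_fun DIM('a) u = 2 * real n / c * (\<integral>x. (f (N x) - g (N x)) / (2 * real n) \<partial>(\<Pi>\<^sub>M i\<in>{..<n}. lborel))"
      using integral_inverse_power_strip(1)[OF n(1) u zero_le_power2]
      by (simp add: I_fun_def n(2) c_def N2[symmetric] f_def g_def)
    also have "(\<integral>x. (f (N x) - g (N x)) / (2 * real n) \<partial>(\<Pi>\<^sub>M i\<in>{..<n}. lborel)) =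
        enn2real (\<integral>\<^sup>+x. ennreal ((f (N x) - g (N x)) / (2 * real n)) \<partial>(\<Pi>\<^sub>M i\<in>{..<n}. lborel))"
      using gf by (intro integral_eq_nn_integral) auto
    also have "(\<integral>\<^sup>+x. ennreal ((f (N x) - g (N x)) / (2 * real n)) \<partial>(\<Pi>\<^sub>M i\<in>{..<n}. lborel)) =
        (\<integral>\<^sup>+r. ennreal ((f r - g r) / (2 * real n)) * ennreal (real n * V * r ^ (n - 1)) * indicator {0<..} r \<partial>lborel)"
      using nn_integral_PiM_radial[of "{..<n}" "\<lambda>r. ennreal ((f r - g r) / (2 * real n))"] n(1)
      by (simp add: N_def V_def lessThan_empty_iff)
    also have "\<dots> = (\<integral>\<^sup>+r. ennreal (V / 2) * (ennreal (f r - g r) * ennreal (r ^ (n - 1)) * indicator {0<..} r) \<partial>lborel)"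
      using gf V n(1) by (intro nn_integral_cong) (auto simp: indicator_def ennreal_mult'[symmetric])
    also have "\<dots> = ennreal (V / 2) * D" unfolding D_def by (rule nn_integral_cmult) measurable
    also have "enn2real (ennreal (V / 2) * D) = V / 2 * enn2real D" using V by (simp add: enn2real_mult)
    finally show ?thesis by (simp add: K_def c_def V_def)
  qed
  show "0 \<le> I_fun DIM('a) u" unfolding I using K by simp
  have "ennreal (1 + I_fun DIM('a) u) = ennreal K * Q + ennreal K * D"
    unfolding KQ I using K fin(3) by (simp add: ennreal_plus ennreal_mult')
  then have E1: "ennreal (1 + I_fun DIM('a) u) = ennreal K * P"
    unfolding PDQ by (simp add: distrib_left add.commute)
  then show "(\<integral>\<^sup>+\<theta>. ennreal (busemann_factor u (norm (\<theta> - e) / 2) ^ n) \<partial>sphere_uniform) = ennreal (1 + I_fun DIM('a) u)"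
    unfolding E_eq[symmetric] E_def ..
  have "P = (\<integral>\<^sup>+\<rho>. ennreal (\<rho> ^ (n - 1) / (sqrt (\<rho>\<^sup>2 + (cosh u)\<^sup>2) - sinh u) ^ (2 * n)) * indicator {0<..} \<rho> \<partial>lborel)"
    unfolding P_def
  proof (rule nn_integral_cong)
    fix \<rho> :: real
    show "ennreal (f \<rho>) * ennreal (\<rho> ^ (n - 1)) * indicator {0<..} \<rho> =
        ennreal (\<rho> ^ (n - 1) / (sqrt (\<rho>\<^sup>2 + (cosh u)\<^sup>2) - sinh u) ^ (2 * n)) * indicator {0<..} \<rho>"
      using gf[of \<rho>] by (auto simp: indicator_def ennreal_mult'[symmetric] f_def)
  qed
  then show "ennreal (1 + I_fun DIM('a) u) = ennreal K *
      (\<integral>\<^sup>+\<rho>. ennreal (\<rho> ^ (n - 1) / (sqrt (\<rho>\<^sup>2 + (cosh u)\<^sup>2) - sinh u) ^ (2 * n)) * indicator {0<..} \<rho> \<partial>lborel)"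
    using E1 by simp
qed

text \<open>
  By \<open>nn_integral_busemann_factor\<close>, $1 + I_d(u)$ is the mean of the ratio over the sphere.  The upper
  bound holds pointwise, and the lower bound holds for the average over each pair of antipodal points.
\<close>

lemma I_fun_bounds:
  assumes d: "2 \<le> DIM('a::euclidean_space)" and u: "0 \<le> u"
  shows "1 + I_fun DIM('a) u \<le> exp (2 * (real DIM('a) - 1) * u)"
    and "exp ((real DIM('a) - 1) * u) \<le> 1 + I_fun DIM('a) u"
proof -
  interpret \<sigma>: prob_space "sphere_uniform :: 'a measure" by (rule prob_space_sphere_uniform)
  define n where "n = DIM('a) - 1"
  have n: "real DIM('a) - 1 = real n" using d by (simp add: n_def)
  obtain e :: 'a where "e \<in> Basis" using nonempty_Basis by blast
  then have e: "norm e = 1" "norm (- e) = 1" by auto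
  have I: "0 \<le> I_fun DIM('a) u" by (rule nn_integral_busemann_factor(3)[OF e(1) d u])
  let ?W = "\<lambda>x. busemann_factor u x ^ n"
  have E: "(\<integral>\<^sup>+\<theta>. ennreal (?W (norm (\<theta> - v) / 2)) \<partial>sphere_uniform) = ennreal (1 + I_fun DIM('a) u)"
    if "norm v = 1" for v :: 'a
    unfolding n_def by (rule nn_integral_busemann_factor(1)[OF that d u])
  have "ennreal (1 + I_fun DIM('a) u) \<le> (\<integral>\<^sup>+\<theta>. ennreal (exp (2 * u) ^ n) \<partial>(sphere_uniform :: 'a measure))"
    unfolding E[OF e(1), symmetric]
  proof (rule nn_integral_mono_AE)
    show "AE \<theta> in sphere_uniform. ennreal (?W (norm (\<theta> - e) / 2)) \<le> ennreal (exp (2 * u) ^ n)"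
      using AE_sphere_uniform_norm
    proof eventually_elim
      case (elim \<theta>)
      have "norm (\<theta> - e) \<le> 2" using norm_triangle_ineq4[of \<theta> e] elim e by simp
      then show ?case
        using u by (intro ennreal_leI power_mono busemann_factor_le_exp less_imp_le[OF busemann_factor_pos]) auto
    qed
  qed
  also have "\<dots> = ennreal (exp (2 * u) ^ n)" by (simp add: \<sigma>.emeasure_space_1)
  finally have "1 + I_fun DIM('a) u \<le> exp (2 * u) ^ n" by simp
  then show "1 + I_fun DIM('a) u \<le> exp (2 * (real DIM('a) - 1) * u)"
    by (simp add: n exp_of_nat_mult[symmetric] mult_ac)
  have "ennreal (2 * exp (real n * u)) = (\<integral>\<^sup>+\<theta>. ennreal (2 * exp (real n * u)) \<partial>(sphere_uniform :: 'a measure))"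
    by (simp add: \<sigma>.emeasure_space_1)
  also have "\<dots> \<le> (\<integral>\<^sup>+\<theta>. ennreal (?W (norm (\<theta> - e) / 2)) + ennreal (?W (norm (\<theta> - (- e)) / 2)) \<partial>sphere_uniform)"
  proof (rule nn_integral_mono_AE)
    show "AE \<theta> in sphere_uniform. ennreal (2 * exp (real n * u)) \<le>
        ennreal (?W (norm (\<theta> - e) / 2)) + ennreal (?W (norm (\<theta> - (- e)) / 2))"
      using AE_sphere_uniform_norm
    proof eventually_elim
      case (elim \<theta>)
      have "(norm (\<theta> - e) / 2)\<^sup>2 + (norm (\<theta> - (- e)) / 2)\<^sup>2 = 1"
        using elim e(1) dot_norm[of \<theta> e] dot_norm_neg[of \<theta> e] by (simp add: power_divide)
      then have "2 * exp (real n * u) \<le> ?W (norm (\<theta> - e) / 2) + ?W (norm (\<theta> - (- e)) / 2)"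
        by (intro busemann_factor_antipodal u) auto
      then show ?case
        using busemann_factor_pos[of u "norm (\<theta> - e) / 2"] busemann_factor_pos[of u "norm (\<theta> - (- e)) / 2"]
        by (subst ennreal_plus[symmetric]) (auto intro!: ennreal_leI simp del: ennreal_plus)
    qed
  qed
  also have "\<dots> = ennreal (1 + I_fun DIM('a) u) + ennreal (1 + I_fun DIM('a) u)"
    using E[OF e(1)] E[OF e(2)] by (subst nn_integral_add) auto
  also have "\<dots> = ennreal (2 * (1 + I_fun DIM('a) u))"
    using I by (simp add: ennreal_plus[symmetric] del: ennreal_plus)
  finally have "2 * exp (real n * u) \<le> 2 * (1 + I_fun DIM('a) u)"
    using I by (subst (asm) ennreal_le_iff) auto
  then show "exp ((real DIM('a) - 1) * u) \<le> 1 + I_fun DIM('a) u"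
    by (simp add: n)
qed

text \<open>
  The substitution is $y = \cosh u\,\sqrt{1 - t^2}/t$ in the one-dimensional integral for $1 + I_d(u)$.  It
  decreases from infinity to 0 on $(0,1)$, so the substitution rule is applied to $z = -y$.
\<close>

lemma I_fun_beta_integral:
  assumes d: "2 \<le> DIM('a::euclidean_space)" and u: "0 \<le> u"
  shows "1 + I_fun DIM('a) u =
        2 ^ (DIM('a) - 1) * Gamma (real DIM('a) / 2) / (sqrt pi * Gamma ((real DIM('a) - 1) / 2))
        * cosh u powr (1 - real DIM('a))
        * (LBINT t:{0..1}. t ^ (DIM('a) - 2) * (1 - t\<^sup>2) powr ((real DIM('a) - 3) / 2)
                            / (1 - t * tanh u) ^ (2 * DIM('a) - 2))"
proof -
  define n where "n = DIM('a) - 1"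
  have n: "0 < n" "DIM('a) = Suc n" using d by (auto simp: n_def)
  define c where "c = cosh u"
  define s where "s = sinh u"
  define T where "T = tanh u"
  have c: "1 \<le> c" unfolding c_def by (rule cosh_real_ge_1)
  have T: "0 \<le> T" "T < 1" "c * T = s" using u c tanh_real_lt_1[of u] by (auto simp: T_def tanh_def c_def s_def)
  have sT: "0 < 1 - t * T" if "0 \<le> t" "t \<le> 1" for t
  proof -
    have "t * T \<le> 1 * T" using that T by (intro mult_right_mono) auto
    then show ?thesis using T by simp
  qed
  define K where "K = real n * unit_ball_vol (real n) / c_const DIM('a)"
  obtain e :: 'a where "e \<in> Basis" using nonempty_Basis by blast
  then have e: "norm e = 1" by simp
  have I: "0 \<le> I_fun DIM('a) u" by (rule nn_integral_busemann_factor(3)[OF e d u])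
  define G where "G y = y ^ (n - 1) / (sqrt (y\<^sup>2 + c\<^sup>2) - s) ^ (2 * n)" for y
  define B where "B t = t ^ (n - 1) * (1 - t\<^sup>2) powr ((real n - 2) / 2) / (1 - t * T) ^ (2 * n)" for t
  have [measurable]: "G \<in> borel_measurable borel" "B \<in> borel_measurable borel"
    unfolding G_def B_def by measurable
  define g where "g t = - c * sqrt (1 - t\<^sup>2) / t" for t
  define g' where "g' t = c / (t\<^sup>2 * sqrt (1 - t\<^sup>2))" for t
  \<comment> \<open>The intervals from \<open>a k\<close> to \<open>b k\<close> exhaust the open unit interval; the 3 makes them non-degenerate.\<close>
  define a where "a k = 1 / (real k + 3)" for k
  define b where "b k = 1 - 1 / (real k + 3)" for k
  have ab: "0 < a k" "a k < b k" "b k < 1" for k by (auto simp: a_def b_def field_simps)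
  have a_dec: "a l \<le> a k" and b_inc: "b k \<le> b l" if "k \<le> l" for k l
    using that by (auto simp: a_def b_def frac_le)
  have g_mono: "g p \<le> g q" if "0 < p" "p \<le> q" "q < 1" for p q
  proof -
    have "sqrt (1 - q\<^sup>2) \<le> sqrt (1 - p\<^sup>2)" using that by (simp add: power_mono)
    moreover have "0 \<le> sqrt (1 - q\<^sup>2)" "0 \<le> sqrt (1 - p\<^sup>2)" using that by (simp_all add: abs_square_le_1)
    ultimately have "sqrt (1 - q\<^sup>2) / q \<le> sqrt (1 - p\<^sup>2) / p" using that by (intro frac_le) auto
    then have "c * (sqrt (1 - q\<^sup>2) / q) \<le> c * (sqrt (1 - p\<^sup>2) / p)" using c by (intro mult_left_mono) auto
    then show ?thesis by (simp add: g_def)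
  qed
  have Icc: "\<exists>k. q \<in> {a k..b k}" if q: "0 < q" "q < 1" for q
  proof -
    obtain k1 where k1: "1 / q < real k1" using reals_Archimedean2 by blast
    obtain k2 where k2: "1 / (1 - q) < real k2" using reals_Archimedean2 by blast
    let ?k = "max k1 k2"
    have "1 / q \<le> real ?k + 3" "1 / (1 - q) \<le> real ?k + 3" using k1 k2 by linarith+
    then have "a ?k \<le> q" "1 / (real ?k + 3) \<le> 1 - q" using q by (auto simp: a_def field_simps)
    then show ?thesis by (auto simp: b_def intro!: exI[of _ ?k])
  qed
  have sq: "t\<^sup>2 < 1" if "0 < t" "t < 1" for t :: real using that by (simp add: abs_square_less_1)
  have "(\<integral>\<^sup>+y. ennreal (G y) * indicator {0<..} y \<partial>lborel) = (\<integral>\<^sup>+z. ennreal (G (- z)) * indicator {..<0} z \<partial>lborel)"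
    by (subst nn_integral_real_affine[where c = "-1" and t = 0]) (auto intro!: nn_integral_cong simp: indicator_def)
  also have "\<dots> = (\<integral>\<^sup>+t. ennreal (G (- g t)) * ennreal (g' t) * indicator {0<..<1} t \<partial>lborel)"
  proof (rule nn_integral_substitution_UN[where a = a and b = b])
    show "g \<in> borel_measurable borel" "g' \<in> borel_measurable borel" unfolding g_def g'_def by measurable
    fix k t assume "t \<in> {a k..b k}"
    then have t: "0 < t" "t < 1" using ab(1)[of k] ab(3)[of k] by auto
    define m where "m = sqrt (1 - t\<^sup>2)"
    have m: "0 < m" "m * m = 1 - t * t" using sq[OF t] by (auto simp: m_def power2_eq_square)
    have "(g has_real_derivative (- c * (- (2 * t) * (inverse m / 2)) * t - (- c * m)) / (t * t)) (at t)"
    proof -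
      have "((\<lambda>t. - c * sqrt (1 - t\<^sup>2)) has_real_derivative - c * (- (2 * t) * (inverse m / 2))) (at t)"
        unfolding m_def using sq[OF t] by (auto intro!: derivative_eq_intros)
      from DERIV_divide[OF this DERIV_ident] t show ?thesis by (simp add: g_def[abs_def] m_def)
    qed
    also have "(- c * (- (2 * t) * (inverse m / 2)) * t - (- c * m)) / (t * t) = c * (t * t + m * m) / (m * (t * t))"
      using m(1) t by (simp add: field_simps)
    also have "\<dots> = g' t" unfolding m(2) by (simp add: g'_def m_def power2_eq_square mult.commute)
    finally show "(g has_real_derivative g' t) (at t)" .
    show "0 \<le> g' t" using c t sq[OF t] by (simp add: g'_def)
  next
    fix k show "continuous_on {a k..b k} g'"
    proof -
      have "t\<^sup>2 * sqrt (1 - t\<^sup>2) \<noteq> 0" if "t \<in> {a k..b k}" for t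
        using that ab(1)[of k] ab(3)[of k] sq[of t] by auto
      then show ?thesis unfolding g'_def by (intro continuous_intros) auto
    qed
    show "a k < b k" by (rule ab)
  next
    show "incseq (\<lambda>k. {a k..b k})" using a_dec b_inc by (force simp: incseq_def)
    have "g (a l) \<le> g (a k)" "g (b k) \<le> g (b l)" if "k \<le> l" for k l
      using g_mono[OF ab(1) a_dec[OF that]] g_mono[OF _ b_inc[OF that] ab(3)] ab[of k] by auto
    then show "incseq (\<lambda>k. {g (a k)..g (b k)})"
      by (auto simp: incseq_def intro: order_trans)
    show "{0<..<1} = (\<Union>k. {a k..b k})"
      using Icc by (auto intro: less_le_trans[OF ab(1)] le_less_trans[OF _ ab(3)])
    show "{..<0} = (\<Union>k. {g (a k)..g (b k)})"
    proof (intro equalityI subsetI)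
      fix z assume "z \<in> {..<0::real}"
      then have z: "z < 0" by simp
      define r where "r = sqrt (z\<^sup>2 + c\<^sup>2)"
      define t where "t = c / r"
      have r: "c < r" "r\<^sup>2 = z\<^sup>2 + c\<^sup>2" using z c unfolding r_def by (auto intro!: real_less_rsqrt)
      have t: "0 < t" "t < 1" using r c by (auto simp: t_def)
      have "1 - t\<^sup>2 = (z / r)\<^sup>2"
        using r c by (simp add: t_def power_divide field_simps)
      then have "sqrt (1 - t\<^sup>2) = - z / r" using z r c by (simp add: real_sqrt_abs)
      then have gt: "g t = z" using r c by (simp add: g_def t_def)
      obtain k where k: "t \<in> {a k..b k}" using Icc[OF t] by blast
      then have "g t \<in> {g (a k)..g (b k)}"
        using g_mono[OF ab(1)[of k], of t] g_mono[OF t(1) _ ab(3)[of k]] t by auto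
      then show "z \<in> (\<Union>k. {g (a k)..g (b k)})" unfolding gt by blast
    next
      fix z assume "z \<in> (\<Union>k. {g (a k)..g (b k)})"
      then obtain k where "z \<le> g (b k)" by auto
      moreover have "g (b k) < 0"
        using c ab[of k] sq[of "b k"] by (simp add: g_def divide_neg_pos)
      ultimately show "z \<in> {..<0}" by simp
    qed
  qed auto
  also have "\<dots> = (\<integral>\<^sup>+t. ennreal (c powr (- real n)) * (ennreal (B t) * indicator {0<..<1} t) \<partial>lborel)"
  proof (rule nn_integral_cong)
    fix t :: real
    show "ennreal (G (- g t)) * ennreal (g' t) * indicator {0<..<1} t =
        ennreal (c powr (- real n)) * (ennreal (B t) * indicator {0<..<1} t)"
    proof (cases "0 < t \<and> t < 1")
      case True
      then have t: "0 < t" "t < 1" by auto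
      define m where "m = sqrt (1 - t\<^sup>2)"
      have m: "0 < m" "m\<^sup>2 = 1 - t\<^sup>2" using sq[OF t] by (auto simp: m_def)
      have "(c * m / t)\<^sup>2 + c\<^sup>2 = c\<^sup>2 * (m\<^sup>2 + t\<^sup>2) / t\<^sup>2"
        using t by (simp add: power_divide power_mult_distrib field_simps)
      then have "(c * m / t)\<^sup>2 + c\<^sup>2 = (c / t)\<^sup>2"
        unfolding m(2) by (simp add: power_divide)
      then have R: "sqrt ((c * m / t)\<^sup>2 + c\<^sup>2) = c / t" using c t by simp
      have cs: "c / t - s = c / t * (1 - t * T)" using t T(3) by (simp add: field_simps)
      have pm: "(1 - t\<^sup>2) powr ((real n - 2) / 2) = m ^ (n - 1) / m"
      proof -
        have "(1 - t\<^sup>2) powr ((real n - 2) / 2) = m powr (2 * ((real n - 2) / 2))"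
          unfolding powr_powr[symmetric] m(2)[symmetric] using m(1) by simp
        also have "2 * ((real n - 2) / 2) = real n - 2" by simp
        finally have "(1 - t\<^sup>2) powr ((real n - 2) / 2) = m powr (real n - 2)" .
        also have "m powr (real n - 2) = m powr (real (n - 1) - 1)" using n(1) by simp
        also have "\<dots> = m ^ (n - 1) / m"
          using m by (simp add: powr_diff powr_realpow)
        finally show ?thesis .
      qed
      have w: "0 < 1 - t * T" using sT t by simp
      have "G (- g t) * g' t = (c * m / t) ^ (n - 1) / (c / t * (1 - t * T)) ^ (2 * n) * (c / (t\<^sup>2 * m))"
        unfolding G_def g'_def g_def m_def[symmetric] using R cs by simp
      also have "\<dots> = (1 / c ^ n) * B t"
      proof -
        obtain k where k: "n = Suc k" using n(1) by (cases n) auto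
        define W where "W = (1 - t * T) ^ (2 * n)"
        have W: "W \<noteq> 0" using w by (simp add: W_def)
        have 1: "(c * m / t) ^ k = (c / t) ^ k * m ^ k"
          by (simp add: power_mult_distrib power_divide)
        have 2: "(c / t * (1 - t * T)) ^ (2 * n) = (c / t) ^ k * (c / t) ^ (k + 2) * W"
          unfolding power_mult_distrib W_def power_add[symmetric] k by (simp add: mult_2)
        have 3: "(c / t) ^ (k + 2) = c ^ n * c / (t ^ k * t\<^sup>2)"
          unfolding k power_divide power_add by (simp add: power2_eq_square)
        have 4: "n - 1 = k" by (simp add: k)
        have "(x * M) / (x * (P * c / (Q * S)) * W) * (c / (S * m)) = (1 / P) * (Q * (M / m) / W)"
          if "x \<noteq> 0" "P \<noteq> 0" "Q \<noteq> 0" "S \<noteq> 0" for x M P Q S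
          using that W c m(1) by (simp add: field_simps)
        from this[of "(c / t) ^ k" "c ^ n" "t ^ k" "t\<^sup>2" "m ^ k"] show ?thesis
          unfolding B_def pm 4 W_def[symmetric] 1 2 3 using c t by simp
      qed
      also have "1 / c ^ n = c powr (- real n)" using c by (simp add: powr_minus powr_realpow divide_inverse)
      finally have "G (- g t) * g' t = c powr (- real n) * B t" .
      moreover have "0 \<le> g' t" "0 \<le> B t" using c t m w by (auto simp: g'_def B_def m_def[symmetric])
      ultimately show ?thesis using t by (simp add: ennreal_mult''[symmetric])
    qed auto
  qed
  also have "\<dots> = ennreal (c powr (- real n)) * (\<integral>\<^sup>+t. ennreal (B t) * indicator {0<..<1} t \<partial>lborel)"
    by (rule nn_integral_cmult) measurable
  also have "(\<integral>\<^sup>+t. ennreal (B t) * indicator {0<..<1} t \<partial>lborel) = (\<integral>\<^sup>+t. ennreal (indicator {0..1} t *\<^sub>R B t) \<partial>lborel)"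
    using AE_lborel_singleton[of "0::real"] AE_lborel_singleton[of "1::real"]
    by (intro nn_integral_cong_AE, eventually_elim) (auto simp: indicator_def)
  finally have *: "ennreal (1 + I_fun DIM('a) u) =
      ennreal K * (ennreal (c powr (- real n)) * (\<integral>\<^sup>+t. ennreal (indicator {0..1} t *\<^sub>R B t) \<partial>lborel))"
    using nn_integral_busemann_factor(2)[OF e d u] by (simp add: K_def n_def G_def c_def s_def)
  have B0: "0 \<le> indicator {0..1} t *\<^sub>R B t" for t
    using sT[of t] by (auto simp: indicator_def B_def)
  have cpos: "0 < c_const DIM('a)"
    unfolding c_const_def using d by (auto intro!: divide_pos_pos mult_pos_pos Gamma_real_pos)
  have "1 + I_fun DIM('a) u = enn2real (ennreal (1 + I_fun DIM('a) u))"
    using I by (intro enn2real_ennreal[symmetric]) simp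
  also have "\<dots> = K * (c powr (- real n) * (LBINT t:{0..1}. B t))"
    unfolding * set_lebesgue_integral_def
    by (subst integral_eq_nn_integral) (use B0 cpos in \<open>auto simp: enn2real_mult K_def\<close>)
  also have "K = 2 ^ n * Gamma (real (Suc n) / 2) / (sqrt pi * Gamma (real n / 2))"
  proof -
    have G: "Gamma (real n / 2 + 1) = real n / 2 * Gamma (real n / 2)"
      using n(1) by (intro Gamma_plus1) (auto elim!: nonpos_Ints_cases)
    have Gp: "0 < Gamma (real n / 2)" "0 < Gamma (real (Suc n) / 2)" using n(1) by (auto intro!: Gamma_real_pos)
    have p: "pi powr (real (Suc n) / 2) = pi powr (real n / 2) * sqrt pi"
      by (simp add: add_divide_distrib powr_add powr_half_sqrt)
    have "2 powr (2 - real (Suc n)) = 2 powr (1 - real n)" by simp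
    also have "\<dots> = 2 / 2 ^ n" by (simp add: powr_diff powr_realpow)
    finally have 2: "2 powr (2 - real (Suc n)) = 2 / 2 ^ n" .
    show ?thesis
      unfolding K_def c_const_def unit_ball_vol_def n(2) G p 2 using n(1) Gp by (simp add: field_simps)
  qed
  finally show ?thesis
    by (simp add: n(2) B_def c_def T_def mult.assoc)
qed

section \<open>Stochastic domination by exponential laws\<close>

lemma Exp_law_greaterThan:
  assumes a: "0 < a"
  shows "measure (Exp_law a) {x<..} = (if x = \<infinity> then 0 else if x < 0 then 1 else exp (- a * real_of_ereal x))"
proof -
  let ?D = "density lborel (exponential_density a)"
  interpret D: prob_space ?D by (rule prob_space_exponential_density[OF a])
  have m: "measure (Exp_law a) {x<..} = measure ?D (ereal -` {x<..})" 
    unfolding Exp_law_def by (subst measure_distr) auto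
  have dist: "distributed ?D lborel (\<lambda>x. x) (exponential_density a)"
    using a by (auto simp: distributed_def distr_id2 intro!: exponential_density_nonneg)
  show ?thesis
  proof (cases x)
    case PInf
    then show ?thesis unfolding m by (simp add: vimage_def)
  next
    case MInf
    then show ?thesis unfolding m using D.prob_space by (simp add: vimage_def)
  next
    case (real r)
    have "measure ?D (ereal -` {x<..}) = measure ?D {r<..}"
      by (simp add: real vimage_def greaterThan_def)
    moreover have "measure ?D {r<..} = exp (- a * r)" if "0 \<le> r"
      using D.exponential_distributedD_gt[OF dist that a] by (simp add: greaterThan_def mult.commute)
    moreover have "measure ?D {r<..} = 1" if "r < 0"
    proof -
      have "measure ?D {0<..} \<le> measure ?D {r<..}" using that by (intro D.finite_measure_mono) auto
      moreover have "measure ?D {0<..} = 1"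
        using D.exponential_distributedD_gt[OF dist order_refl a] by (simp add: greaterThan_def)
      ultimately show ?thesis using D.prob_le_1[of "{r<..}"] by simp
    qed
    ultimately show ?thesis unfolding m using real by auto
  qed
qed

lemma borel_eq_atLeast_ereal: "borel = sigma UNIV (range (atLeast :: ereal \<Rightarrow> ereal set))"
proof (safe intro!: borel_eq_sigmaI1[OF borel_Iio])
  fix x :: ereal
  have eq: "{..<x} = space (sigma UNIV (range atLeast)) - {x..}" by auto
  show "{..<x} \<in> sets (sigma UNIV (range atLeast))"
    unfolding eq by (intro sets.compl_sets) auto
qed auto

text \<open>
  The strict tail is at most the weak one; the value \<open>\<infinity>\<close> and negative arguments give no condition.
\<close>

lemma stoch_le_Exp_lawI:
  assumes \<mu>: "prob_space \<mu>" "sets \<mu> = sets borel" and a: "0 < a"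
    and le: "\<And>u. 0 \<le> u \<Longrightarrow> measure \<mu> {ereal u..} \<le> exp (- a * u)"
  shows "stoch_le \<mu> (Exp_law a)"
  unfolding stoch_le_def
proof
  interpret \<mu>: prob_space \<mu> by fact
  fix x :: ereal
  show "measure \<mu> {x<..} \<le> measure (Exp_law a) {x<..}"
    unfolding Exp_law_greaterThan[OF a]
  proof (cases "x = \<infinity> \<or> x < 0")
    case True
    moreover have "{\<infinity><..} = ({} :: ereal set)" by auto
    ultimately show "measure \<mu> {x<..} \<le> (if x = \<infinity> then 0 else if x < 0 then 1 else exp (- a * real_of_ereal x))" by auto
  next
    case False
    then obtain u where u: "x = ereal u" "0 \<le> u" by (cases x) auto
    have "measure \<mu> {x<..} \<le> measure \<mu> {ereal u..}"
      unfolding u using \<mu>(2) by (intro \<mu>.finite_measure_mono) auto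
    then show "measure \<mu> {x<..} \<le> (if x = \<infinity> then 0 else if x < 0 then 1 else exp (- a * real_of_ereal x))"
      using le[OF u(2)] u by simp
  qed
qed

section \<open>Counts of Poisson points\<close>

locale unit_poisson = prob_space M for M :: "'w measure" +
  fixes R :: "nat \<Rightarrow> 'w \<Rightarrow> real"
  assumes points: "unit_poisson_points M R"
begin

abbreviation points_in :: "real set \<Rightarrow> 'w \<Rightarrow> nat set" where
  "points_in A \<omega> \<equiv> {i. R i \<omega> \<in> A}"

lemma R_measurable[measurable]: "R i \<in> borel_measurable M"
  using points by (simp add: unit_poisson_points_def)

lemma R_pos: "\<omega> \<in> space M \<Longrightarrow> 0 < R i \<omega>"
  using points by (simp add: unit_poisson_points_def)

lemma R_less_iff: "\<omega> \<in> space M \<Longrightarrow> R i \<omega> < R j \<omega> \<longleftrightarrow> i < j"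
proof -
  assume "\<omega> \<in> space M"
  then have "strict_mono (\<lambda>i. R i \<omega>)" using points by (simp add: unit_poisson_points_def)
  then show ?thesis by (rule strict_mono_less)
qed

lemma prob_card_eq:
  assumes "A \<in> sets borel" "A \<subseteq> {0..}" "emeasure lborel A < \<infinity>"
  shows "prob {\<omega> \<in> space M. finite (points_in A \<omega>) \<and> card (points_in A \<omega>) = k} =
     measure lborel A ^ k / fact k * exp (- measure lborel A)"
  using points assms unfolding unit_poisson_points_def by blast

lemma AE_finite_points:
  assumes A: "A \<in> sets borel" "A \<subseteq> {0..}" "emeasure lborel A < \<infinity>"
  shows "AE \<omega> in M. finite (points_in A \<omega>)"
proof -
  note [measurable] = A(1)
  define L where "L = measure lborel A"
  define E where "E k = {\<omega> \<in> space M. finite (points_in A \<omega>) \<and> card (points_in A \<omega>) = k}" for k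
  have E: "E k \<in> sets M" for k unfolding E_def using A(1) by measurable
  have "(\<lambda>k. prob (E k)) sums prob (\<Union>k. E k)"
    using E by (intro finite_measure_UNION) (auto simp: disjoint_family_on_def E_def)
  moreover have "(\<lambda>k. prob (E k)) sums (exp L * exp (- L))"
    unfolding E_def prob_card_eq[OF A] L_def[symmetric]
    using exp_converges[of L] by (intro sums_mult2) (simp add: divide_inverse mult.commute)
  ultimately have "prob (\<Union>k. E k) = 1"
    by (metis exp_minus_inverse sums_unique2)
  then have "AE \<omega> in M. \<omega> \<in> (\<Union>k. E k)"
    using E by (subst prob_eq_1[symmetric]) auto
  then show ?thesis by (elim eventually_mono) (auto simp: E_def)
qed

text \<open>
  The cardinality agrees almost surely with the honest number of points, because infinite index sets,
  on which \<^const>\<open>card\<close> is 0, have probability 0.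
\<close>

lemma nn_integral_card_points:
  fixes h :: "nat \<Rightarrow> ennreal"
  assumes A: "A \<in> sets borel" "A \<subseteq> {0..}" "emeasure lborel A < \<infinity>"
  shows "(\<integral>\<^sup>+\<omega>. h (card (points_in A \<omega>)) \<partial>M) =
    (\<Sum>k. h k * ennreal (measure lborel A ^ k / fact k * exp (- measure lborel A)))"
proof -
  note [measurable] = A(1)
  define E where "E k = {\<omega> \<in> space M. finite (points_in A \<omega>) \<and> card (points_in A \<omega>) = k}" for k
  have [measurable]: "E k \<in> sets M" for k unfolding E_def using A(1) by measurable
  have "(\<integral>\<^sup>+\<omega>. h (card (points_in A \<omega>)) \<partial>M) = (\<integral>\<^sup>+\<omega>. (\<Sum>k. h k * indicator (E k) \<omega>) \<partial>M)"
  proof (rule nn_integral_cong_AE)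
    show "AE \<omega> in M. h (card (points_in A \<omega>)) = (\<Sum>k. h k * indicator (E k) \<omega>)"
      using AE_finite_points[OF A] AE_space
    proof eventually_elim
    case (elim \<omega>)
    have "(\<Sum>k. h k * indicator (E k) \<omega>) = (\<Sum>k\<in>{card (points_in A \<omega>)}. h k * indicator (E k) \<omega>)"
      using elim by (intro suminf_finite) (auto simp: E_def indicator_def)
    then show ?case using elim by (simp add: E_def)
    qed
  qed
  also have "\<dots> = (\<Sum>k. h k * emeasure M (E k))"
    by (subst nn_integral_suminf) (auto simp: nn_integral_cmult_indicator)
  also have "\<dots> = (\<Sum>k. h k * ennreal (measure lborel A ^ k / fact k * exp (- measure lborel A)))"
    unfolding emeasure_eq_measure E_def prob_card_eq[OF A] ..
  finally show ?thesis .
qed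

lemma nn_integral_card_eq_0:
  assumes "A \<in> sets borel" "A \<subseteq> {0..}" "emeasure lborel A < \<infinity>"
  shows "(\<integral>\<^sup>+\<omega>. indicator {0} (card (points_in A \<omega>)) \<partial>M) = ennreal (exp (- measure lborel A))"
proof -
  have "(\<integral>\<^sup>+\<omega>. indicator {0} (card (points_in A \<omega>)) \<partial>M) =
      (\<Sum>k. indicator {0} k * ennreal (measure lborel A ^ k / fact k * exp (- measure lborel A)))"
    by (rule nn_integral_card_points[OF assms])
  also have "\<dots> = (\<Sum>k\<in>{0}. indicator {0} k * ennreal (measure lborel A ^ k / fact k * exp (- measure lborel A)))"
    by (intro suminf_finite) auto
  finally show ?thesis by simp
qed

lemma nn_integral_card_eq_1:
  assumes "A \<in> sets borel" "A \<subseteq> {0..}" "emeasure lborel A < \<infinity>"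
  shows "(\<integral>\<^sup>+\<omega>. indicator {1} (card (points_in A \<omega>)) \<partial>M) = ennreal (measure lborel A * exp (- measure lborel A))"
proof -
  have "(\<integral>\<^sup>+\<omega>. indicator {1} (card (points_in A \<omega>)) \<partial>M) =
      (\<Sum>k. indicator {1} k * ennreal (measure lborel A ^ k / fact k * exp (- measure lborel A)))"
    by (rule nn_integral_card_points[OF assms])
  also have "\<dots> = (\<Sum>k\<in>{1}. indicator {1} k * ennreal (measure lborel A ^ k / fact k * exp (- measure lborel A)))"
    by (intro suminf_finite) auto
  finally show ?thesis by simp
qed

lemma nn_integral_card_ge_1:
  assumes A: "A \<in> sets borel" "A \<subseteq> {0..}" "emeasure lborel A < \<infinity>"
  shows "(\<integral>\<^sup>+\<omega>. indicator {1..} (card (points_in A \<omega>)) \<partial>M) \<le> ennreal (measure lborel A)"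
proof -
  define L where "L = measure lborel A"
  note [measurable] = A(1)
  have card: "(\<lambda>\<omega>. card (points_in A \<omega>)) \<in> M \<rightarrow>\<^sub>M count_space UNIV" by measurable
  have [measurable]: "(\<lambda>\<omega>. indicator K (card (points_in A \<omega>)) :: ennreal) \<in> borel_measurable M" for K
    by (rule measurable_compose[OF card]) simp
  have "ennreal (exp (- L)) + (\<integral>\<^sup>+\<omega>. indicator {1..} (card (points_in A \<omega>)) \<partial>M) =
      (\<integral>\<^sup>+\<omega>. indicator {0} (card (points_in A \<omega>)) + indicator {1..} (card (points_in A \<omega>)) \<partial>M)"
    unfolding L_def nn_integral_card_eq_0[OF A, symmetric] by (rule nn_integral_add[symmetric]) measurable
  also have "\<dots> = (\<integral>\<^sup>+\<omega>. 1 \<partial>M)"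
    by (intro nn_integral_cong) (auto simp: indicator_def)
  finally have "ennreal (exp (- L)) + (\<integral>\<^sup>+\<omega>. indicator {1..} (card (points_in A \<omega>)) \<partial>M) = 1"
    by (simp add: emeasure_space_1)
  also have "1 \<le> ennreal (exp (- L)) + ennreal L"
    using exp_ge_add_one_self[of "- L"] unfolding ennreal_1[symmetric]
    by (subst ennreal_plus[symmetric]) (auto simp: L_def intro!: ennreal_leI simp del: ennreal_1 ennreal_plus)
  finally show ?thesis
    by (simp add: L_def ennreal_add_left_cancel_le)
qed

lemma nn_integral_power_card_points:
  assumes A: "A \<in> sets borel" "A \<subseteq> {0..}" "emeasure lborel A < \<infinity>" and v: "0 \<le> v"
  shows "(\<integral>\<^sup>+\<omega>. ennreal (v ^ card (points_in A \<omega>)) \<partial>M) = ennreal (exp (- (1 - v) * measure lborel A))"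
proof -
  define L where "L = measure lborel A"
  have L: "0 \<le> L" by (simp add: L_def)
  have sums: "(\<lambda>k. v ^ k * (L ^ k / fact k * exp (- L))) sums (exp (v * L) * exp (- L))"
  proof -
    have "(\<lambda>k. (v * L) ^ k /\<^sub>R fact k * exp (- L)) sums (exp (v * L) * exp (- L))"
      by (intro sums_mult2 exp_converges)
    moreover have "(v * L) ^ k /\<^sub>R fact k * exp (- L) = v ^ k * (L ^ k / fact k * exp (- L))" for k
      by (simp add: power_mult_distrib divide_inverse)
    ultimately show ?thesis by simp
  qed
  have "(\<integral>\<^sup>+\<omega>. ennreal (v ^ card (points_in A \<omega>)) \<partial>M) = (\<Sum>k. ennreal (v ^ k) * ennreal (L ^ k / fact k * exp (- L)))"
    unfolding L_def by (rule nn_integral_card_points[OF A])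
  also have "\<dots> = (\<Sum>k. ennreal (v ^ k * (L ^ k / fact k * exp (- L))))"
    using v L by (simp add: ennreal_mult[symmetric])
  also have "\<dots> = ennreal (exp (v * L) * exp (- L))"
    using sums v L by (subst suminf_ennreal2) (auto simp: sums_iff)
  also have "exp (v * L) * exp (- L) = exp (- (1 - v) * L)"
    by (simp add: exp_add[symmetric] algebra_simps)
  finally show ?thesis by (simp add: L_def)
qed

lemma nn_integral_prod_card_points:
  fixes h :: "nat \<Rightarrow> nat \<Rightarrow> ennreal"
  assumes A: "\<And>j. j < n \<Longrightarrow> A j \<in> sets borel \<and> A j \<subseteq> {0..} \<and> emeasure lborel (A j) < \<infinity>"
    and disj: "disjoint_family_on A {..<n}"
  shows "(\<integral>\<^sup>+\<omega>. (\<Prod>j<n. h j (card (points_in (A j) \<omega>))) \<partial>M) =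
    (\<Prod>j<n. \<integral>\<^sup>+\<omega>. h j (card (points_in (A j) \<omega>)) \<partial>M)"
proof -
  have "indep_vars (\<lambda>_. count_space UNIV) (\<lambda>j \<omega>. card (points_in (A j) \<omega>)) {..<n}"
    using points A disj unfolding unit_poisson_points_def by blast
  then have "indep_vars (\<lambda>_. borel) (\<lambda>j \<omega>. h j (card (points_in (A j) \<omega>))) {..<n}"
    by (rule indep_vars_compose2) simp
  then show ?thesis by (intro indep_vars_nn_integral) auto
qed

text \<open>
  The generating functional for step functions: independence over disjoint sets reduces it to Poisson
  generating functions.  The sets $[0,a]$ and $(a,b]$ are carried along to locate the first point.
\<close>

lemma nn_integral_prod_step:
  fixes D :: "nat \<Rightarrow> real set" and v :: "nat \<Rightarrow> real"
  assumes ab: "0 \<le> a" "a \<le> b"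
    and D: "\<And>k. k \<le> m \<Longrightarrow> D k \<in> sets borel \<and> D k \<subseteq> {b<..c}"
    and disj: "disjoint_family_on D {..m}" and v: "\<And>k. 0 \<le> v k"
  shows "(\<integral>\<^sup>+\<omega>. indicator {0} (card (points_in {0..a} \<omega>)) * indicator K (card (points_in {a<..b} \<omega>)) *
      (\<Prod>k\<le>m. ennreal (v k ^ card (points_in (D k) \<omega>))) \<partial>M) =
    (\<integral>\<^sup>+\<omega>. indicator {0} (card (points_in {0..a} \<omega>)) \<partial>M) * (\<integral>\<^sup>+\<omega>. indicator K (card (points_in {a<..b} \<omega>)) \<partial>M)
      * ennreal (exp (- (\<Sum>k\<le>m. (1 - v k) * measure lborel (D k))))"
proof -
  define A where "A j = (case j of 0 \<Rightarrow> {0..a} | Suc 0 \<Rightarrow> {a<..b} | Suc (Suc k) \<Rightarrow> D k)" for j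
  define h where "h j = (case j of 0 \<Rightarrow> indicator {0} | Suc 0 \<Rightarrow> indicator K | Suc (Suc k) \<Rightarrow> (\<lambda>N. ennreal (v k ^ N)))" for j :: nat
  have Dfin: "emeasure lborel (D k) < \<infinity>" if "k \<le> m" for k
  proof -
    have "emeasure lborel (D k) \<le> emeasure lborel {b<..c}" using D[OF that] by (intro emeasure_mono) auto
    also have "\<dots> < \<infinity>" by (cases "b \<le> c") (auto simp: ennreal_less_top)
    finally show ?thesis .
  qed
  have A: "A j \<in> sets borel \<and> A j \<subseteq> {0..} \<and> emeasure lborel (A j) < \<infinity>" if "j < Suc (Suc (Suc m))" for j
  proof -
    consider "j = 0" | "j = 1" | k where "j = Suc (Suc k)" by (cases j; cases "j - 1") auto
    then show ?thesis
    proof cases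
      case 3
      then have "k \<le> m" using that by simp
      then show ?thesis using 3 D[of k] Dfin[of k] ab by (auto simp: A_def)
    qed (use ab in \<open>auto simp: A_def ennreal_less_top\<close>)
  qed
  have "A i \<inter> A j = {}" if ij: "i < j" "j < Suc (Suc (Suc m))" for i j
  proof -
    consider "i = 0" "j = 1" | k where "i = 0" "j = Suc (Suc k)" | k where "i = 1" "j = Suc (Suc k)"
      | k l where "i = Suc (Suc k)" "j = Suc (Suc l)"
      using ij by (cases i; cases "i - 1"; cases j; cases "j - 1") auto
    then show ?thesis
    proof cases
      case 4
      then show ?thesis using disj ij by (auto simp: A_def disjoint_family_on_def)
    next
      case 1
      then show ?thesis by (auto simp: A_def)
    next
      case (2 k)
      then have "k \<le> m" using ij by simp
      then show ?thesis using 2 D[of k] ab by (force simp: A_def)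
    next
      case (3 k)
      then have "k \<le> m" using ij by simp
      then show ?thesis using 3 D[of k] ab by (force simp: A_def)
    qed
  qed
  then have "disjoint_family_on A {..<Suc (Suc (Suc m))}"
    unfolding disjoint_family_on_def by (metis Int_commute lessThan_iff linorder_neqE_nat)
  note disj_A = this
  have split: "(\<Prod>j<Suc (Suc (Suc m)). F j) = F 0 * (F (Suc 0) * (\<Prod>k\<le>m. F (Suc (Suc k))))" for F :: "nat \<Rightarrow> ennreal"
    by (subst prod.lessThan_Suc_shift, subst prod.lessThan_Suc_shift) (simp only: lessThan_Suc_atMost)
  from nn_integral_prod_card_points[OF A disj_A, of h]
  have "(\<integral>\<^sup>+\<omega>. indicator {0} (card (points_in {0..a} \<omega>)) * (indicator K (card (points_in {a<..b} \<omega>)) *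
      (\<Prod>k\<le>m. ennreal (v k ^ card (points_in (D k) \<omega>)))) \<partial>M) =
    (\<integral>\<^sup>+\<omega>. indicator {0} (card (points_in {0..a} \<omega>)) \<partial>M) * ((\<integral>\<^sup>+\<omega>. indicator K (card (points_in {a<..b} \<omega>)) \<partial>M)
      * (\<Prod>k\<le>m. \<integral>\<^sup>+\<omega>. ennreal (v k ^ card (points_in (D k) \<omega>)) \<partial>M))"
    unfolding split by (simp add: A_def h_def)
  also have "(\<Prod>k\<le>m. \<integral>\<^sup>+\<omega>. ennreal (v k ^ card (points_in (D k) \<omega>)) \<partial>M) =
      (\<Prod>k\<le>m. ennreal (exp (- (1 - v k) * measure lborel (D k))))"
  proof (intro prod.cong refl nn_integral_power_card_points v)
    fix k assume "k \<in> {..m}"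
    then have "k \<le> m" by simp
    then show "D k \<in> sets borel" "D k \<subseteq> {0..}" "emeasure lborel (D k) < \<infinity>"
      using D[of k] Dfin[of k] ab by auto
  qed
  also have "\<dots> = ennreal (exp (- (\<Sum>k\<le>m. (1 - v k) * measure lborel (D k))))"
    by (simp add: prod_ennreal exp_sum[symmetric] sum_negf[symmetric] algebra_simps)
  finally show ?thesis by (simp only: mult.assoc)
qed

text \<open>
  The probability generating functional of the Poisson process.  Rounding \<open>f\<close> down or up to a
  multiple of $1/m$ makes it a step function, and it changes the exponent by at most $(c - b)/m$.
\<close>

lemma nn_integral_prod_points:
  fixes K :: "nat set"
  assumes ab: "0 \<le> a" "a \<le> b" "b \<le> c"
    and f[measurable]: "f \<in> borel_measurable borel" and f01: "\<And>r. 0 \<le> f r \<and> f r \<le> 1"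
  defines "P \<equiv> (\<integral>\<^sup>+\<omega>. indicator {0} (card (points_in {0..a} \<omega>)) \<partial>M) * (\<integral>\<^sup>+\<omega>. indicator K (card (points_in {a<..b} \<omega>)) \<partial>M)"
  shows "(\<integral>\<^sup>+\<omega>. indicator {0} (card (points_in {0..a} \<omega>)) * indicator K (card (points_in {a<..b} \<omega>)) *
      (\<Prod>i\<in>points_in {b<..c} \<omega>. ennreal (f (R i \<omega>))) \<partial>M) =
    P * ennreal (exp (- (\<integral>r. (1 - f r) * indicator {b<..c} r \<partial>lborel)))"
proof -
  define X where "X = (\<integral>\<^sup>+\<omega>. indicator {0} (card (points_in {0..a} \<omega>)) * indicator K (card (points_in {a<..b} \<omega>)) *
      (\<Prod>i\<in>points_in {b<..c} \<omega>. ennreal (f (R i \<omega>))) \<partial>M)"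
  define J where "J = (\<integral>r. (1 - f r) * indicator {b<..c} r \<partial>lborel)"
  define len where "len = c - b"
  have P: "P < \<top>"
  proof -
    have "(\<integral>\<^sup>+\<omega>. indicator K (card (points_in A \<omega>)) \<partial>M) < \<top>" for A K
    proof -
      have "(\<integral>\<^sup>+\<omega>. indicator K (card (points_in A \<omega>)) \<partial>M) \<le> (\<integral>\<^sup>+\<omega>. 1 \<partial>M)"
        by (intro nn_integral_mono) (simp add: indicator_def)
      also have "\<dots> < \<top>" by (simp add: emeasure_space_1)
      finally show ?thesis .
    qed
    then show ?thesis unfolding P_def ennreal_mult_less_top by blast
  qed
  have main: "P * ennreal (exp (- J - len / real m)) \<le> X \<and> X \<le> P * ennreal (exp (- J + len / real m))"
    if m: "0 < m" for m :: nat
  proof -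
    \<comment> \<open>The level of \<open>r\<close> is \<open>m * f r\<close> rounded down, and \<open>D k\<close> is the level set.\<close>
    define lev where "lev r = nat \<lfloor>real m * f r\<rfloor>" for r
    define D where "D k = {r \<in> {b<..c}. lev r = k}" for k
    have [measurable]: "lev \<in> borel \<rightarrow>\<^sub>M count_space UNIV" unfolding lev_def by measurable
    have lev: "lev r \<le> m" "real (lev r) / real m \<le> f r" "f r \<le> (real (lev r) + 1) / real m" for r
    proof -
      have "0 \<le> real m * f r" "real m * f r \<le> real m"
        using f01[of r] by (auto simp: mult_left_le)
      then have "lev r \<le> m" "real (lev r) \<le> real m * f r" "real m * f r \<le> real (lev r) + 1"
        unfolding lev_def by (linarith | simp add: nat_le_iff floor_le_iff le_floor_iff)+
      then show "lev r \<le> m" "real (lev r) / real m \<le> f r" "f r \<le> (real (lev r) + 1) / real m"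
        using m by (auto simp: field_simps)
    qed
    have D[measurable]: "D k \<in> sets borel" for k unfolding D_def by measurable
    have Dsub: "D k \<subseteq> {b<..c}" for k by (auto simp: D_def)
    have Dfin: "emeasure lborel (D k) < \<infinity>" for k
    proof -
      have "emeasure lborel (D k) \<le> emeasure lborel {b<..c}" using Dsub by (intro emeasure_mono) auto
      also have "\<dots> < \<infinity>" using ab by (auto simp: ennreal_less_top)
      finally show ?thesis .
    qed
    have disj: "disjoint_family_on D {..m}" by (auto simp: disjoint_family_on_def D_def)
    have ind: "(\<Sum>k\<le>m. w k * indicator (D k) r) = w (lev r) * indicator {b<..c} r" for w :: "nat \<Rightarrow> real" and r
    proof -
      have "(\<Sum>k\<le>m. w k * indicator (D k) r) = (\<Sum>k\<le>m. if k = lev r then w (lev r) * indicator {b<..c} r else 0)"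
        by (intro sum.cong) (auto simp: D_def indicator_def)
      then show ?thesis using lev(1)[of r] by simp
    qed
    have integ: "integrable lborel (\<lambda>r. w k * indicator (D k) r)" for w :: "nat \<Rightarrow> real" and k
      using Dfin[of k] by simp
    have sum_int: "(\<Sum>k\<le>m. w k * measure lborel (D k)) = (\<integral>r. w (lev r) * indicator {b<..c} r \<partial>lborel)" for w
    proof -
      have "(\<integral>r. w (lev r) * indicator {b<..c} r \<partial>lborel) = (\<integral>r. (\<Sum>k\<le>m. w k * indicator (D k) r) \<partial>lborel)"
        unfolding ind ..
      also have "\<dots> = (\<Sum>k\<le>m. \<integral>r. w k * indicator (D k) r \<partial>lborel)"
        by (rule Bochner_Integration.integral_sum[OF integ])
      finally show ?thesis by simp
    qed
    have int_lev: "integrable lborel (\<lambda>r. w (lev r) * indicator {b<..c} r)" for w :: "nat \<Rightarrow> real"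
    proof -
      have "integrable lborel (\<lambda>r. (\<Sum>k\<le>m. w k * indicator (D k) r))"
        by (intro Bochner_Integration.integrable_sum integ)
      then show ?thesis unfolding ind .
    qed
    have int_bc: "integrable lborel (\<lambda>r. indicator {b<..c} r :: real)"
      using ab by simp
    have int_f: "integrable lborel (\<lambda>r. (1 - f r) * indicator {b<..c} r)"
      using f01 by (intro Bochner_Integration.integrable_bound[OF int_bc]) (auto simp: indicator_def)
    have Jup: "(\<Sum>k\<le>m. (1 - real k / real m) * measure lborel (D k)) \<le> J + len / real m"
    proof -
      have "(\<Sum>k\<le>m. (1 - real k / real m) * measure lborel (D k)) =
          (\<integral>r. (1 - real (lev r) / real m) * indicator {b<..c} r \<partial>lborel)" by (rule sum_int)
      also have "\<dots> \<le> (\<integral>r. (1 - f r) * indicator {b<..c} r + 1 / real m * indicator {b<..c} r \<partial>lborel)"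
      proof (intro integral_mono int_lev Bochner_Integration.integrable_add int_f integrable_mult_right int_bc)
        fix r
        have "1 - real (lev r) / real m \<le> 1 - f r + 1 / real m"
          using lev(3)[of r] by (simp add: add_divide_distrib)
        then show "(1 - real (lev r) / real m) * indicator {b<..c} r \<le> (1 - f r) * indicator {b<..c} r + 1 / real m * indicator {b<..c} r"
          by (simp add: indicator_def)
      qed
      also have "\<dots> = J + (\<integral>r. 1 / real m * indicator {b<..c} r \<partial>lborel)"
        unfolding J_def by (intro Bochner_Integration.integral_add int_f integrable_mult_right int_bc)
      also have "(\<integral>r. 1 / real m * indicator {b<..c} r \<partial>lborel) = len / real m"
        using ab by (simp add: len_def)
      finally show ?thesis .
    qed
    have Jlo: "J - len / real m \<le> (\<Sum>k\<le>m. (1 - (real k + 1) / real m) * measure lborel (D k))"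
    proof -
      have "J - len / real m = (\<integral>r. (1 - f r) * indicator {b<..c} r \<partial>lborel) - (\<integral>r. 1 / real m * indicator {b<..c} r \<partial>lborel)"
        using ab by (simp add: len_def J_def)
      also have "\<dots> = (\<integral>r. (1 - f r) * indicator {b<..c} r - 1 / real m * indicator {b<..c} r \<partial>lborel)"
        by (intro Bochner_Integration.integral_diff[symmetric] int_f integrable_mult_right int_bc)
      also have "\<dots> \<le> (\<integral>r. (1 - (real (lev r) + 1) / real m) * indicator {b<..c} r \<partial>lborel)"
      proof (intro integral_mono int_lev[of "\<lambda>k. 1 - (real k + 1) / real m"] Bochner_Integration.integrable_diff int_f integrable_mult_right int_bc)
        fix r
        have "1 - f r - 1 / real m \<le> 1 - (real (lev r) + 1) / real m"
          using lev(2)[of r] by (simp add: add_divide_distrib)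
        then show "(1 - f r) * indicator {b<..c} r - 1 / real m * indicator {b<..c} r \<le> (1 - (real (lev r) + 1) / real m) * indicator {b<..c} r"
          by (simp add: indicator_def)
      qed
      also have "\<dots> = (\<Sum>k\<le>m. (1 - (real k + 1) / real m) * measure lborel (D k))"
        by (rule sum_int[of "\<lambda>k. 1 - (real k + 1) / real m", symmetric])
      finally show ?thesis .
    qed
    have fin_bc: "AE \<omega> in M. finite (points_in {b<..c} \<omega>)"
      using ab by (intro AE_finite_points) (auto simp: ennreal_less_top)
    have grp: "(\<Prod>k\<le>m. v k ^ card (points_in (D k) \<omega>)) = (\<Prod>i\<in>points_in {b<..c} \<omega>. v (lev (R i \<omega>)))"
      if "finite (points_in {b<..c} \<omega>)" for v :: "nat \<Rightarrow> real" and \<omega>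
    proof -
      have "(\<Prod>i\<in>points_in {b<..c} \<omega>. v (lev (R i \<omega>))) =
          (\<Prod>k\<le>m. \<Prod>i\<in>{i. i \<in> points_in {b<..c} \<omega> \<and> lev (R i \<omega>) = k}. v (lev (R i \<omega>)))"
        using that lev(1) by (intro prod.group[symmetric]) auto
      also have "\<dots> = (\<Prod>k\<le>m. \<Prod>i\<in>points_in (D k) \<omega>. v k)"
        by (intro prod.cong) (auto simp: D_def)
      finally show ?thesis by simp
    qed
    have "P * ennreal (exp (- (\<Sum>k\<le>m. (1 - real k / real m) * measure lborel (D k)))) =
      (\<integral>\<^sup>+\<omega>. indicator {0} (card (points_in {0..a} \<omega>)) * indicator K (card (points_in {a<..b} \<omega>)) *
      (\<Prod>k\<le>m. ennreal ((real k / real m) ^ card (points_in (D k) \<omega>))) \<partial>M)"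
      unfolding P_def using D Dsub by (intro nn_integral_prod_step[symmetric] ab disj) auto
    also have "\<dots> \<le> X"
      unfolding X_def
    proof (rule nn_integral_mono_AE, rule eventually_mono[OF fin_bc])
      fix \<omega> assume elim: "finite (points_in {b<..c} \<omega>)"
      have "(\<Prod>k\<le>m. (real k / real m) ^ card (points_in (D k) \<omega>)) \<le> (\<Prod>i\<in>points_in {b<..c} \<omega>. f (R i \<omega>))"
        unfolding grp[OF elim, of "\<lambda>k. real k / real m"] using lev(2) by (intro prod_mono) auto
      then have "(\<Prod>k\<le>m. ennreal ((real k / real m) ^ card (points_in (D k) \<omega>))) \<le> (\<Prod>i\<in>points_in {b<..c} \<omega>. ennreal (f (R i \<omega>)))"
        using f01 by (simp add: prod_ennreal ennreal_leI)
      then show "indicator {0} (card (points_in {0..a} \<omega>)) * indicator K (card (points_in {a<..b} \<omega>)) *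
          (\<Prod>k\<le>m. ennreal ((real k / real m) ^ card (points_in (D k) \<omega>))) \<le>
          indicator {0} (card (points_in {0..a} \<omega>)) * indicator K (card (points_in {a<..b} \<omega>)) *
          (\<Prod>i\<in>points_in {b<..c} \<omega>. ennreal (f (R i \<omega>)))"
        by (intro mult_left_mono) auto
    qed
    finally have lower: "P * ennreal (exp (- (\<Sum>k\<le>m. (1 - real k / real m) * measure lborel (D k)))) \<le> X" .
    have "X \<le> (\<integral>\<^sup>+\<omega>. indicator {0} (card (points_in {0..a} \<omega>)) * indicator K (card (points_in {a<..b} \<omega>)) *
      (\<Prod>k\<le>m. ennreal (((real k + 1) / real m) ^ card (points_in (D k) \<omega>))) \<partial>M)"
      unfolding X_def
    proof (rule nn_integral_mono_AE, rule eventually_mono[OF fin_bc])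
      fix \<omega> assume elim: "finite (points_in {b<..c} \<omega>)"
      have "(\<Prod>i\<in>points_in {b<..c} \<omega>. f (R i \<omega>)) \<le> (\<Prod>k\<le>m. ((real k + 1) / real m) ^ card (points_in (D k) \<omega>))"
        unfolding grp[OF elim, of "\<lambda>k. (real k + 1) / real m"] using lev(3) f01 by (intro prod_mono) auto
      then have "(\<Prod>i\<in>points_in {b<..c} \<omega>. ennreal (f (R i \<omega>))) \<le> (\<Prod>k\<le>m. ennreal (((real k + 1) / real m) ^ card (points_in (D k) \<omega>)))"
        using f01 by (simp add: prod_ennreal ennreal_leI)
      then show "indicator {0} (card (points_in {0..a} \<omega>)) * indicator K (card (points_in {a<..b} \<omega>)) *
          (\<Prod>i\<in>points_in {b<..c} \<omega>. ennreal (f (R i \<omega>))) \<le>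
          indicator {0} (card (points_in {0..a} \<omega>)) * indicator K (card (points_in {a<..b} \<omega>)) *
          (\<Prod>k\<le>m. ennreal (((real k + 1) / real m) ^ card (points_in (D k) \<omega>)))"
        by (intro mult_left_mono) auto
    qed
    also have "\<dots> = P * ennreal (exp (- (\<Sum>k\<le>m. (1 - (real k + 1) / real m) * measure lborel (D k))))"
      unfolding P_def using D Dsub by (intro nn_integral_prod_step ab disj) auto
    finally have upper: "X \<le> P * ennreal (exp (- (\<Sum>k\<le>m. (1 - (real k + 1) / real m) * measure lborel (D k))))" .
    show ?thesis
    proof
      have "P * ennreal (exp (- J - len / real m)) \<le> P * ennreal (exp (- (\<Sum>k\<le>m. (1 - real k / real m) * measure lborel (D k))))"
        using Jup by (intro mult_left_mono ennreal_leI) auto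
      then show "P * ennreal (exp (- J - len / real m)) \<le> X" using lower by (rule order_trans)
      have "P * ennreal (exp (- (\<Sum>k\<le>m. (1 - (real k + 1) / real m) * measure lborel (D k)))) \<le> P * ennreal (exp (- J + len / real m))"
        using Jlo by (intro mult_left_mono ennreal_leI) auto
      with upper show "X \<le> P * ennreal (exp (- J + len / real m))" by (rule order_trans)
    qed
  qed
  have l0: "(\<lambda>m. len / real (Suc m)) \<longlonglongrightarrow> 0"
    by (rule LIMSEQ_Suc[OF lim_const_over_n])
  have lim: "(\<lambda>m. P * ennreal (exp (- J + s * (len / real (Suc m))))) \<longlonglongrightarrow> P * ennreal (exp (- J + s * 0))" for s
    by (intro ennreal_tendsto_cmult P tendsto_ennrealI tendsto_exp tendsto_add tendsto_const tendsto_mult l0)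
  have "X \<le> P * ennreal (exp (- J))"
    using lim[of 1] main by (intro LIMSEQ_le_const[where X = "\<lambda>m. P * ennreal (exp (- J + 1 * (len / real (Suc m))))"]) (auto simp del: of_nat_Suc)
  moreover have "P * ennreal (exp (- J)) \<le> X"
    using lim[of "-1"] main by (intro LIMSEQ_le_const2[where X = "\<lambda>m. P * ennreal (exp (- J + (-1) * (len / real (Suc m))))"]) (auto simp del: of_nat_Suc)
  ultimately show ?thesis unfolding X_def J_def by (rule antisym)
qed

end

section \<open>Poisson points with independent angles\<close>

lemma emeasure_sphere_uniform_chord_le:
  fixes e e' :: "'a::euclidean_space"
  assumes "norm e = norm e'" and [measurable]: "w \<in> borel_measurable borel"
  shows "emeasure sphere_uniform {\<phi>. w (norm (\<phi> - e)) \<le> (x::real)} = emeasure sphere_uniform {\<phi>. w (norm (\<phi> - e')) \<le> x}"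
proof -
  have *: "emeasure sphere_uniform {\<phi>. w (norm (\<phi> - e)) \<le> x} = (\<integral>\<^sup>+\<phi>. indicator {..x} (w (norm (\<phi> - e))) \<partial>sphere_uniform)"
    for e :: 'a
  proof -
    have "{\<phi> \<in> space borel. w (norm (\<phi> - e)) \<le> x} \<in> sets borel" by measurable
    then have "{\<phi>. w (norm (\<phi> - e)) \<le> x} \<in> sets (sphere_uniform :: 'a measure)" by simp
    then have "emeasure sphere_uniform {\<phi>. w (norm (\<phi> - e)) \<le> x} = (\<integral>\<^sup>+\<phi>. indicator {\<phi>. w (norm (\<phi> - e)) \<le> x} \<phi> \<partial>sphere_uniform)"
      by simp
    also have "\<dots> = (\<integral>\<^sup>+\<phi>. indicator {..x} (w (norm (\<phi> - e))) \<partial>sphere_uniform)"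
      by (intro nn_integral_cong) (simp add: indicator_def)
    finally show ?thesis .
  qed
  show ?thesis
    unfolding * by (rule nn_integral_sphere_uniform_chord[OF _ assms(1), of "\<lambda>y. indicator {..x} (w y)"]) measurable
qed

locale ideal_nuclei_process =
  fixes M :: "'w measure" and \<Theta> :: "nat \<Rightarrow> 'w \<Rightarrow> 'a::euclidean_space" and R :: "nat \<Rightarrow> 'w \<Rightarrow> real"
  assumes nuclei: "ideal_nuclei M \<Theta> R" and dim: "2 \<le> DIM('a)"

sublocale ideal_nuclei_process \<subseteq> unit_poisson M R
  using nuclei by (simp add: ideal_nuclei_def unit_poisson_def unit_poisson_axioms_def)

context ideal_nuclei_process
begin

lemma Theta_measurable[measurable]: "\<Theta> i \<in> borel_measurable M"
  using nuclei by (simp add: ideal_nuclei_def)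

lemma norm_Theta: "\<omega> \<in> space M \<Longrightarrow> norm (\<Theta> i \<omega>) = 1"
  using nuclei by (simp add: ideal_nuclei_def)

definition ratio :: "real \<Rightarrow> 'a \<Rightarrow> 'a \<Rightarrow> real" where
  "ratio u \<theta> \<phi> = busemann_factor u (norm (\<phi> - \<theta>) / 2) ^ (DIM('a) - 1)"

lemma ratio_measurable[measurable]:
  assumes [measurable]: "f \<in> borel_measurable N" "g \<in> borel_measurable N"
  shows "(\<lambda>x. ratio u (f x) (g x)) \<in> borel_measurable N"
  unfolding ratio_def by measurable

lemma ratio_bounds:
  assumes "0 \<le> u" "norm \<theta> = 1" "norm \<phi> = 1"
  shows "1 \<le> ratio u \<theta> \<phi>" "ratio u \<theta> \<phi> \<le> exp (2 * u) ^ (DIM('a) - 1)"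
proof -
  have "norm (\<phi> - \<theta>) \<le> 2" using norm_triangle_ineq4[of \<phi> \<theta>] assms by simp
  then show "ratio u \<theta> \<phi> \<le> exp (2 * u) ^ (DIM('a) - 1)"
    unfolding ratio_def using assms(1)
    by (intro power_mono busemann_factor_le_exp less_imp_le[OF busemann_factor_pos]) auto
  show "1 \<le> ratio u \<theta> \<phi>"
    unfolding ratio_def using assms(1) by (intro one_le_power busemann_factor_ge_1) auto
qed

text \<open>
  A reference direction: by rotation invariance, laws of ratios may be computed relative to it.
\<close>

definition pole :: 'a where "pole = (SOME e. norm e = 1)"

lemma norm_pole: "norm pole = 1"
proof -
  obtain b :: 'a where "b \<in> Basis" using nonempty_Basis by blast
  then have "norm b = 1" by simp
  then show ?thesis unfolding pole_def by (rule someI)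
qed

definition ratio_cdf :: "real \<Rightarrow> real \<Rightarrow> real" where
  "ratio_cdf u x = measure sphere_uniform {\<phi>. ratio u pole \<phi> \<le> x}"

lemma emeasure_ratio_le:
  assumes "norm e = 1"
  shows "emeasure sphere_uniform {\<phi>. ratio u e \<phi> \<le> x} = ennreal (ratio_cdf u x)"
proof -
  interpret \<sigma>: prob_space "sphere_uniform :: 'a measure" by (rule prob_space_sphere_uniform)
  have "emeasure sphere_uniform {\<phi>. ratio u e \<phi> \<le> x} = emeasure sphere_uniform {\<phi>. ratio u pole \<phi> \<le> x}"
    unfolding ratio_def
    by (rule emeasure_sphere_uniform_chord_le[of _ _ "\<lambda>y. busemann_factor u (y / 2) ^ (DIM('a) - 1)"]) (simp_all add: assms norm_pole)
  then show ?thesis by (simp add: ratio_cdf_def \<sigma>.emeasure_eq_measure)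
qed

lemma ratio_cdf_01: "0 \<le> ratio_cdf u x \<and> ratio_cdf u x \<le> 1"
proof -
  interpret \<sigma>: prob_space "sphere_uniform :: 'a measure" by (rule prob_space_sphere_uniform)
  show ?thesis by (simp add: ratio_cdf_def)
qed

lemma ratio_cdf_measurable[measurable]: "ratio_cdf u \<in> borel_measurable borel"
proof -
  interpret \<sigma>: prob_space "sphere_uniform :: 'a measure" by (rule prob_space_sphere_uniform)
  have "{\<phi> \<in> space borel. ratio u pole \<phi> \<le> x} \<in> sets borel" for x by measurable
  then have "{\<phi>. ratio u pole \<phi> \<le> x} \<in> sets (sphere_uniform :: 'a measure)" for x by simp
  then have "mono (ratio_cdf u)"
    unfolding ratio_cdf_def by (intro monoI \<sigma>.finite_measure_mono) auto
  then show ?thesis by (rule borel_measurable_mono)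
qed

text \<open>
  Given the reference angle \<open>\<Theta> 0\<close>, the ratios for the other indices are independent with distribution
  function \<open>ratio_cdf\<close>.  That function does not depend on the value of \<open>\<Theta> 0\<close>, so the ratios are
  independent without conditioning as well.
\<close>

lemma emeasure_marks_le:
  assumes J: "finite J" "0 \<notin> J"
  shows "emeasure M {\<omega> \<in> space M. \<forall>j\<in>J. ratio u (\<Theta> 0 \<omega>) (\<Theta> j \<omega>) \<le> x j} = (\<Prod>j\<in>J. ennreal (ratio_cdf u (x j)))"
proof -
  let ?\<sigma> = "sphere_uniform :: 'a measure"
  interpret \<sigma>: prob_space ?\<sigma> by (rule prob_space_sphere_uniform)
  interpret product_sigma_finite "\<lambda>_::nat. ?\<sigma>" by standard
  let ?I = "insert 0 J"
  have ind: "indep_vars (\<lambda>_. borel) \<Theta> ?I"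
    using nuclei by (auto simp: ideal_nuclei_def intro: indep_vars_subset)
  have law: "distr M (\<Pi>\<^sub>M i\<in>?I. borel) (\<lambda>\<omega>. \<lambda>i\<in>?I. \<Theta> i \<omega>) = (\<Pi>\<^sub>M i\<in>?I. ?\<sigma>)"
  proof -
    have "distr M borel (\<Theta> i) = ?\<sigma>" for i using nuclei by (simp add: ideal_nuclei_def)
    then show ?thesis
      using ind by (subst (asm) indep_vars_iff_distr_eq_PiM) auto
  qed
  define B where "B = {y \<in> space (\<Pi>\<^sub>M i\<in>?I. borel). \<forall>j\<in>J. ratio u (y 0) (y j) \<le> x j}"
  have B: "B \<in> sets (\<Pi>\<^sub>M i\<in>?I. borel)"
    unfolding B_def using J by measurable
  have sets_eq: "sets (\<Pi>\<^sub>M i\<in>?I. ?\<sigma>) = sets (\<Pi>\<^sub>M i\<in>?I. (borel :: 'a measure))"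
    by (intro sets_PiM_cong) auto
  have "emeasure M {\<omega> \<in> space M. \<forall>j\<in>J. ratio u (\<Theta> 0 \<omega>) (\<Theta> j \<omega>) \<le> x j} =
      emeasure (distr M (\<Pi>\<^sub>M i\<in>?I. borel) (\<lambda>\<omega>. \<lambda>i\<in>?I. \<Theta> i \<omega>)) B"
    using B by (subst emeasure_distr) (auto intro!: arg_cong[where f = "emeasure M"] simp: B_def space_PiM)
  also have "\<dots> = (\<integral>\<^sup>+y. indicator B y \<partial>(\<Pi>\<^sub>M i\<in>?I. ?\<sigma>))"
    unfolding law using B sets_eq by simp
  also have "\<dots> = (\<integral>\<^sup>+y. (\<Prod>j\<in>J. indicator {..x j} (ratio u (y 0) (y j))) \<partial>(\<Pi>\<^sub>M i\<in>?I. ?\<sigma>))"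
  proof (rule nn_integral_cong)
    fix y assume "y \<in> space (\<Pi>\<^sub>M i\<in>?I. ?\<sigma>)"
    then have "y \<in> space (\<Pi>\<^sub>M i\<in>?I. (borel :: 'a measure))" using sets_eq_imp_space_eq[OF sets_eq] by simp
    then have "indicator B y = (if \<forall>j\<in>J. ratio u (y 0) (y j) \<le> x j then 1 else 0 :: ennreal)"
      by (simp add: B_def)
    also have "\<dots> = (\<Prod>j\<in>J. indicator {..x j} (ratio u (y 0) (y j)))"
      using J(1) by (auto simp: indicator_def intro!: prod_zero[symmetric])
    finally show "indicator B y = (\<Prod>j\<in>J. indicator {..x j} (ratio u (y 0) (y j)) :: ennreal)" .
  qed
  also have "\<dots> = (\<integral>\<^sup>+\<theta>. (\<integral>\<^sup>+y. (\<Prod>j\<in>J. indicator {..x j} (ratio u \<theta> (y j))) \<partial>(\<Pi>\<^sub>M i\<in>J. ?\<sigma>)) \<partial>?\<sigma>)"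
  proof (subst product_nn_integral_insert_rev)
    show "(\<lambda>y. \<Prod>j\<in>J. indicator {..x j} (ratio u (y 0) (y j)) :: ennreal) \<in> borel_measurable (\<Pi>\<^sub>M i\<in>?I. ?\<sigma>)"
    proof (rule borel_measurable_prod_ennreal)
      fix j assume "j \<in> J"
      then have [measurable]: "(\<lambda>y. y j) \<in> borel_measurable (\<Pi>\<^sub>M i\<in>?I. ?\<sigma>)"
          "(\<lambda>y. y 0) \<in> borel_measurable (\<Pi>\<^sub>M i\<in>?I. ?\<sigma>)"
        using measurable_component_singleton[of j ?I "\<lambda>_. ?\<sigma>"] measurable_component_singleton[of 0 ?I "\<lambda>_. ?\<sigma>"]
        by (simp_all cong: measurable_cong_sets)
      show "(\<lambda>y. indicator {..x j} (ratio u (y 0) (y j)) :: ennreal) \<in> borel_measurable (\<Pi>\<^sub>M i\<in>?I. ?\<sigma>)"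
        by measurable
    qed
    show "(\<integral>\<^sup>+\<theta>. (\<integral>\<^sup>+y. (\<Prod>j\<in>J. indicator {..x j} (ratio u ((y(0 := \<theta>)) 0) ((y(0 := \<theta>)) j))) \<partial>(\<Pi>\<^sub>M i\<in>J. ?\<sigma>)) \<partial>?\<sigma>)
      = (\<integral>\<^sup>+\<theta>. (\<integral>\<^sup>+y. (\<Prod>j\<in>J. indicator {..x j} (ratio u \<theta> (y j))) \<partial>(\<Pi>\<^sub>M i\<in>J. ?\<sigma>)) \<partial>?\<sigma>)"
      using J by (intro nn_integral_cong prod.cong) auto
  qed (use J in auto)
  also have "\<dots> = (\<integral>\<^sup>+\<theta>. (\<Prod>j\<in>J. \<integral>\<^sup>+\<phi>. indicator {..x j} (ratio u \<theta> \<phi>) \<partial>?\<sigma>) \<partial>?\<sigma>)"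
    by (intro nn_integral_cong product_nn_integral_prod) (use J in auto)
  also have "\<dots> = (\<integral>\<^sup>+\<theta>. (\<Prod>j\<in>J. ennreal (ratio_cdf u (x j))) \<partial>?\<sigma>)"
  proof (rule nn_integral_cong_AE)
    show "AE \<theta> in ?\<sigma>. (\<Prod>j\<in>J. \<integral>\<^sup>+\<phi>. indicator {..x j} (ratio u \<theta> \<phi>) \<partial>?\<sigma>) = (\<Prod>j\<in>J. ennreal (ratio_cdf u (x j)))"
      using AE_sphere_uniform_norm
    proof eventually_elim
      case (elim \<theta>)
      have "(\<integral>\<^sup>+\<phi>. indicator {..y} (ratio u \<theta> \<phi>) \<partial>?\<sigma>) = ennreal (ratio_cdf u y)" for y
      proof -
        have "{\<phi> \<in> space borel. ratio u \<theta> \<phi> \<le> y} \<in> sets borel" by measurable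
        then have "{\<phi>. ratio u \<theta> \<phi> \<le> y} \<in> sets ?\<sigma>" by simp
        then have "(\<integral>\<^sup>+\<phi>. indicator {\<phi>. ratio u \<theta> \<phi> \<le> y} \<phi> \<partial>?\<sigma>) = ennreal (ratio_cdf u y)"
          using emeasure_ratio_le[OF elim] by simp
        then show ?thesis by (simp add: indicator_def)
      qed
      then show ?case by simp
    qed
  qed
  also have "\<dots> = (\<Prod>j\<in>J. ennreal (ratio_cdf u (x j)))" by (simp add: \<sigma>.emeasure_space_1)
  finally show ?thesis .
qed

lemma nn_integral_independent_marks:
  fixes G :: "(nat \<Rightarrow> 'a) \<times> (nat \<Rightarrow> real) \<Rightarrow> ennreal"
  assumes [measurable]: "G \<in> borel_measurable ((\<Pi>\<^sub>M i\<in>UNIV. borel) \<Otimes>\<^sub>M (\<Pi>\<^sub>M i\<in>UNIV. borel))"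
  shows "(\<integral>\<^sup>+\<omega>. G ((\<lambda>i. \<Theta> i \<omega>), (\<lambda>i. R i \<omega>)) \<partial>M) = (\<integral>\<^sup>+\<omega>. (\<integral>\<^sup>+\<omega>'. G ((\<lambda>i. \<Theta> i \<omega>'), (\<lambda>i. R i \<omega>)) \<partial>M) \<partial>M)"
proof -
  let ?S = "\<Pi>\<^sub>M i\<in>(UNIV::nat set). (borel :: 'a measure)" and ?T = "\<Pi>\<^sub>M i\<in>(UNIV::nat set). (borel :: real measure)"
  let ?\<Theta> = "\<lambda>\<omega> i. \<Theta> i \<omega>" and ?R = "\<lambda>\<omega> i. R i \<omega>"
  have rv[measurable]: "?\<Theta> \<in> M \<rightarrow>\<^sub>M ?S" "?R \<in> M \<rightarrow>\<^sub>M ?T" by (auto intro!: measurable_PiM_single')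
  interpret S: prob_space "distr M ?S ?\<Theta>" by (rule prob_space_distr) simp
  interpret T: prob_space "distr M ?T ?R" by (rule prob_space_distr) simp
  interpret P: pair_sigma_finite "distr M ?S ?\<Theta>" "distr M ?T ?R" ..
  have law: "distr M ?S ?\<Theta> \<Otimes>\<^sub>M distr M ?T ?R = distr M (?S \<Otimes>\<^sub>M ?T) (\<lambda>\<omega>. (?\<Theta> \<omega>, ?R \<omega>))"
  proof (rule pair_measure_eqI)
    fix A B assume "A \<in> sets (distr M ?S ?\<Theta>)" "B \<in> sets (distr M ?T ?R)"
    then have A[measurable]: "A \<in> sets ?S" and B[measurable]: "B \<in> sets ?T" by simp_all
    have "prob ((?\<Theta> -` A \<inter> space M) \<inter> (?R -` B \<inter> space M)) = prob (?\<Theta> -` A \<inter> space M) * prob (?R -` B \<inter> space M)"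
    proof (rule indep_setD)
      show "indep_set (sets (vimage_algebra (space M) ?\<Theta> ?S)) (sets (vimage_algebra (space M) ?R ?T))"
        using nuclei by (simp add: ideal_nuclei_def)
    qed (use A B in \<open>auto intro: in_vimage_algebra\<close>)
    moreover have "(\<lambda>\<omega>. (?\<Theta> \<omega>, ?R \<omega>)) -` (A \<times> B) \<inter> space M = (?\<Theta> -` A \<inter> space M) \<inter> (?R -` B \<inter> space M)"
      by auto
    ultimately show "emeasure (distr M ?S ?\<Theta>) A * emeasure (distr M ?T ?R) B =
        emeasure (distr M (?S \<Otimes>\<^sub>M ?T) (\<lambda>\<omega>. (?\<Theta> \<omega>, ?R \<omega>))) (A \<times> B)"
      by (simp add: emeasure_distr emeasure_eq_measure ennreal_mult[symmetric])
  qed (auto intro: S.sigma_finite_measure_axioms T.sigma_finite_measure_axioms cong: sets_pair_measure_cong)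
  have "(\<integral>\<^sup>+\<omega>. G (?\<Theta> \<omega>, ?R \<omega>) \<partial>M) = (\<integral>\<^sup>+x. G x \<partial>(distr M ?S ?\<Theta> \<Otimes>\<^sub>M distr M ?T ?R))"
    unfolding law by (subst nn_integral_distr) auto
  also have "\<dots> = (\<integral>\<^sup>+r. (\<integral>\<^sup>+\<theta>. G (\<theta>, r) \<partial>distr M ?S ?\<Theta>) \<partial>distr M ?T ?R)"
    by (subst P.nn_integral_snd[symmetric]) simp_all
  also have "\<dots> = (\<integral>\<^sup>+r. (\<integral>\<^sup>+\<omega>'. G (?\<Theta> \<omega>', r) \<partial>M) \<partial>distr M ?T ?R)"
    by (intro nn_integral_cong nn_integral_distr) (auto simp: space_PiM)
  also have "\<dots> = (\<integral>\<^sup>+\<omega>. (\<integral>\<^sup>+\<omega>'. G (?\<Theta> \<omega>', ?R \<omega>) \<partial>M) \<partial>M)"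
    by (subst nn_integral_distr) auto
  finally show ?thesis .
qed

text \<open>
  Once the radii are fixed, each point \<open>r\<close> of $(b,c]$ independently violates the condition on its angle
  with probability \<open>1 - ratio_cdf u (r / t)\<close>; averaging over the radii is the generating functional.  The condition
  \<open>0 \<notin> K\<close> forces a point in $(a,b]$.  Then index 0, whose angle is the reference, does not belong to
  $(b,c]$.
\<close>

lemma prob_thinned_event:
  fixes K :: "nat set"
  assumes ab: "0 \<le> a" "a \<le> b" "b \<le> c" and t: "0 < t" and K: "0 \<notin> K"
  shows "emeasure M {\<omega> \<in> space M. card (points_in {0..a} \<omega>) = 0 \<and> card (points_in {a<..b} \<omega>) \<in> K \<and>
        (\<forall>j. R j \<omega> \<in> {b<..c} \<longrightarrow> t * ratio u (\<Theta> 0 \<omega>) (\<Theta> j \<omega>) \<le> R j \<omega>)} =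
    (\<integral>\<^sup>+\<omega>. indicator {0} (card (points_in {0..a} \<omega>)) \<partial>M) * (\<integral>\<^sup>+\<omega>. indicator K (card (points_in {a<..b} \<omega>)) \<partial>M) *
    ennreal (exp (- (\<integral>r. (1 - ratio_cdf u (r / t)) * indicator {b<..c} r \<partial>lborel)))"
proof -
  let ?S = "\<Pi>\<^sub>M i\<in>(UNIV::nat set). (borel :: 'a measure)" and ?T = "\<Pi>\<^sub>M i\<in>(UNIV::nat set). (borel :: real measure)"
  have [measurable]: "(\<lambda>x. fst x j) \<in> borel_measurable (?S \<Otimes>\<^sub>M ?T)" "(\<lambda>x. snd x j) \<in> borel_measurable (?S \<Otimes>\<^sub>M ?T)" for j
    by measurable
  define E where "E = {x \<in> space (?S \<Otimes>\<^sub>M ?T). card {i. snd x i \<in> {0..a}} = 0 \<and> card {i. snd x i \<in> {a<..b}} \<in> K \<and>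
        (\<forall>j. snd x j \<in> {b<..c} \<longrightarrow> t * ratio u (fst x 0) (fst x j) \<le> snd x j)}"
  have E[measurable]: "E \<in> sets (?S \<Otimes>\<^sub>M ?T)"
    unfolding E_def by measurable
  have meas: "{\<omega> \<in> space M. card (points_in {0..a} \<omega>) = 0 \<and> card (points_in {a<..b} \<omega>) \<in> K \<and>
        (\<forall>j. R j \<omega> \<in> {b<..c} \<longrightarrow> t * ratio u (\<Theta> 0 \<omega>) (\<Theta> j \<omega>) \<le> R j \<omega>)} \<in> sets M"
    by measurable
  have "emeasure M {\<omega> \<in> space M. card (points_in {0..a} \<omega>) = 0 \<and> card (points_in {a<..b} \<omega>) \<in> K \<and>
        (\<forall>j. R j \<omega> \<in> {b<..c} \<longrightarrow> t * ratio u (\<Theta> 0 \<omega>) (\<Theta> j \<omega>) \<le> R j \<omega>)} =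
      (\<integral>\<^sup>+\<omega>. indicator E ((\<lambda>i. \<Theta> i \<omega>), (\<lambda>i. R i \<omega>)) \<partial>M)"
    unfolding nn_integral_indicator[OF meas, symmetric]
    by (intro nn_integral_cong) (simp add: E_def indicator_def space_pair_measure space_PiM)
  also have "\<dots> = (\<integral>\<^sup>+\<omega>. (\<integral>\<^sup>+\<omega>'. indicator E ((\<lambda>i. \<Theta> i \<omega>'), (\<lambda>i. R i \<omega>)) \<partial>M) \<partial>M)"
    by (rule nn_integral_independent_marks) measurable
  also have "\<dots> = (\<integral>\<^sup>+\<omega>. indicator {0} (card (points_in {0..a} \<omega>)) * indicator K (card (points_in {a<..b} \<omega>)) *
      (\<Prod>i\<in>points_in {b<..c} \<omega>. ennreal (ratio_cdf u (R i \<omega> / t))) \<partial>M)"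
  proof (rule nn_integral_cong_AE)
    have fin: "AE \<omega> in M. finite (points_in {b<..c} \<omega>)"
      using ab by (intro AE_finite_points) (auto simp: ennreal_less_top)
    show "AE \<omega> in M. (\<integral>\<^sup>+\<omega>'. indicator E ((\<lambda>i. \<Theta> i \<omega>'), (\<lambda>i. R i \<omega>)) \<partial>M) =
        indicator {0} (card (points_in {0..a} \<omega>)) * indicator K (card (points_in {a<..b} \<omega>)) *
      (\<Prod>i\<in>points_in {b<..c} \<omega>. ennreal (ratio_cdf u (R i \<omega> / t)))"
      using fin AE_space
    proof eventually_elim
      case (elim \<omega>)
      show ?case
      proof (cases "card (points_in {0..a} \<omega>) = 0 \<and> card (points_in {a<..b} \<omega>) \<in> K")
        case False
        then have "indicator E ((\<lambda>i. \<Theta> i \<omega>'), (\<lambda>i. R i \<omega>)) = (0 :: ennreal)" for \<omega>'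
          by (auto simp: E_def)
        then show ?thesis using False by auto
      next
        case True
        have "points_in {a<..b} \<omega> \<noteq> {}" using True K by (metis card.empty)
        then obtain i where "R i \<omega> \<le> b" by auto
        then have "R 0 \<omega> \<le> b" using R_less_iff[of \<omega> 0 i] elim by (cases "i = 0") auto
        then have J: "0 \<notin> points_in {b<..c} \<omega>" by auto
        have "(\<integral>\<^sup>+\<omega>'. indicator E ((\<lambda>i. \<Theta> i \<omega>'), (\<lambda>i. R i \<omega>)) \<partial>M) =
            (\<integral>\<^sup>+\<omega>'. indicator {\<omega>' \<in> space M. \<forall>j\<in>points_in {b<..c} \<omega>. ratio u (\<Theta> 0 \<omega>') (\<Theta> j \<omega>') \<le> R j \<omega> / t} \<omega>' \<partial>M)"
          using True t
          by (intro nn_integral_cong) (simp add: E_def indicator_def space_pair_measure space_PiM pos_le_divide_eq mult.commute)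
        also have "\<dots> = emeasure M {\<omega>' \<in> space M. \<forall>j\<in>points_in {b<..c} \<omega>. ratio u (\<Theta> 0 \<omega>') (\<Theta> j \<omega>') \<le> R j \<omega> / t}"
          using elim by (intro nn_integral_indicator) measurable
        also have "\<dots> = (\<Prod>j\<in>points_in {b<..c} \<omega>. ennreal (ratio_cdf u (R j \<omega> / t)))"
          using elim J by (intro emeasure_marks_le) auto
        finally show ?thesis using True by simp
      qed
    qed
  qed
  also have "\<dots> = (\<integral>\<^sup>+\<omega>. indicator {0} (card (points_in {0..a} \<omega>)) \<partial>M) * (\<integral>\<^sup>+\<omega>. indicator K (card (points_in {a<..b} \<omega>)) \<partial>M) *
    ennreal (exp (- (\<integral>r. (1 - ratio_cdf u (r / t)) * indicator {b<..c} r \<partial>lborel)))"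
    using ratio_cdf_01 by (intro nn_integral_prod_points[OF ab, of "\<lambda>r. ratio_cdf u (r / t)"]) auto
  finally show ?thesis .
qed

text \<open>
  The integrand is the probability that \<open>t\<close> times the ratio exceeds \<open>r\<close>; by Fubini it integrates to the
  mean excess over \<open>b\<close>.  The assumption \<open>tc\<close> makes the cut-off at \<open>c\<close> ineffective.
\<close>

lemma integral_ratio_tail:
  assumes u: "0 \<le> u" and t: "0 < t" and bc: "b \<le> c" and tc: "t * exp (2 * u) ^ (DIM('a) - 1) \<le> c"
  defines "J \<equiv> (\<integral>r. (1 - ratio_cdf u (r / t)) * indicator {b<..c} r \<partial>lborel)"
  shows "0 \<le> J" and "ennreal J = (\<integral>\<^sup>+\<phi>. ennreal (t * ratio u pole \<phi> - b) \<partial>sphere_uniform)"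
proof -
  let ?\<sigma> = "sphere_uniform :: 'a measure"
  interpret \<sigma>: prob_space ?\<sigma> by (rule prob_space_sphere_uniform)
  interpret P: pair_sigma_finite ?\<sigma> "lborel :: real measure" ..
  have nonneg: "0 \<le> (1 - ratio_cdf u (r / t)) * indicator {b<..c} r" for r
    using ratio_cdf_01[of u "r / t"] by simp
  show "0 \<le> J" unfolding J_def using nonneg by simp
  have "integrable lborel (\<lambda>r. indicator {b<..c} r :: real)" using bc by simp
  then have "integrable lborel (\<lambda>r. (1 - ratio_cdf u (r / t)) * indicator {b<..c} r)"
    by (rule Bochner_Integration.integrable_bound) (use ratio_cdf_01 in \<open>auto simp: indicator_def\<close>)
  then have "ennreal J = (\<integral>\<^sup>+r. ennreal ((1 - ratio_cdf u (r / t)) * indicator {b<..c} r) \<partial>lborel)"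
    unfolding J_def using nonneg by (intro nn_integral_eq_integral[symmetric]) auto
  also have "\<dots> = (\<integral>\<^sup>+r. (\<integral>\<^sup>+\<phi>. indicator {b<..c} r * indicator {r<..} (t * ratio u pole \<phi>) \<partial>?\<sigma>) \<partial>lborel)"
  proof (rule nn_integral_cong)
    fix r :: real
    have "{\<phi> \<in> space borel. ratio u pole \<phi> \<le> r / t} \<in> sets borel" by measurable
    then have m: "{\<phi>. ratio u pole \<phi> \<le> r / t} \<in> sets ?\<sigma>" by simp
    have "ennreal (1 - ratio_cdf u (r / t)) = emeasure ?\<sigma> (space ?\<sigma> - {\<phi>. ratio u pole \<phi> \<le> r / t})"
      unfolding ratio_cdf_def \<sigma>.emeasure_eq_measure using m by (subst \<sigma>.prob_compl) auto
    also have "\<dots> = (\<integral>\<^sup>+\<phi>. indicator (space ?\<sigma> - {\<phi>. ratio u pole \<phi> \<le> r / t}) \<phi> \<partial>?\<sigma>)"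
      by (intro nn_integral_indicator[symmetric] sets.compl_sets m)
    also have "\<dots> = (\<integral>\<^sup>+\<phi>. indicator {r<..} (t * ratio u pole \<phi>) \<partial>?\<sigma>)"
      using t by (intro nn_integral_cong) (auto simp: indicator_def pos_le_divide_eq mult.commute not_le)
    finally show "ennreal ((1 - ratio_cdf u (r / t)) * indicator {b<..c} r) =
        (\<integral>\<^sup>+\<phi>. indicator {b<..c} r * indicator {r<..} (t * ratio u pole \<phi>) \<partial>?\<sigma>)"
      by (simp add: nn_integral_cmult indicator_def)
  qed
  also have "\<dots> = (\<integral>\<^sup>+\<phi>. (\<integral>\<^sup>+r. indicator {b<..c} r * indicator {r<..} (t * ratio u pole \<phi>) \<partial>lborel) \<partial>?\<sigma>)"
  proof (rule P.Fubini')
    have [measurable]: "Measurable.pred (?\<sigma> \<Otimes>\<^sub>M lborel) (\<lambda>x. t * ratio u pole (fst x) \<in> {snd x<..})"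
      unfolding greaterThan_iff by measurable
    show "(\<lambda>(\<phi>, r). indicator {b<..c} r * indicator {r<..} (t * ratio u pole \<phi>) :: ennreal) \<in> borel_measurable (?\<sigma> \<Otimes>\<^sub>M lborel)"
      by measurable
  qed
  also have "\<dots> = (\<integral>\<^sup>+\<phi>. ennreal (t * ratio u pole \<phi> - b) \<partial>?\<sigma>)"
  proof (rule nn_integral_cong_AE)
    show "AE \<phi> in ?\<sigma>. (\<integral>\<^sup>+r. indicator {b<..c} r * indicator {r<..} (t * ratio u pole \<phi>) \<partial>lborel) = ennreal (t * ratio u pole \<phi> - b)"
      using AE_sphere_uniform_norm
    proof eventually_elim
      case (elim \<phi>)
      have "t * ratio u pole \<phi> \<le> t * exp (2 * u) ^ (DIM('a) - 1)"
        using t ratio_bounds(2)[OF u norm_pole elim] by (intro mult_left_mono) auto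
      then have le: "t * ratio u pole \<phi> \<le> c" using tc by simp
      have "(\<integral>\<^sup>+r. indicator {b<..c} r * indicator {r<..} (t * ratio u pole \<phi>) \<partial>lborel) =
          (\<integral>\<^sup>+r. indicator {b<..<t * ratio u pole \<phi>} r \<partial>lborel)"
        using le by (intro nn_integral_cong) (auto simp: indicator_def)
      also have "\<dots> = ennreal (t * ratio u pole \<phi> - b)"
        by (cases "b \<le> t * ratio u pole \<phi>") (auto simp: ennreal_neg)
      finally show ?case .
    qed
  qed
  finally show "ennreal J = (\<integral>\<^sup>+\<phi>. ennreal (t * ratio u pole \<phi> - b) \<partial>?\<sigma>)" .
qed

lemma nn_integral_ratio:
  assumes u: "0 \<le> u"
  shows "(\<integral>\<^sup>+\<phi>. ennreal (ratio u pole \<phi>) \<partial>sphere_uniform) = ennreal (1 + I_fun DIM('a) u)"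
  unfolding ratio_def by (rule nn_integral_busemann_factor(1)[OF norm_pole dim u])

lemma integral_ratio_tail_eq:
  assumes u: "0 \<le> u" and b: "0 < b" and c: "b * exp (2 * u) ^ (DIM('a) - 1) = c"
  shows "(\<integral>r. (1 - ratio_cdf u (r / b)) * indicator {b<..c} r \<partial>lborel) = b * I_fun DIM('a) u"
proof -
  let ?\<sigma> = "sphere_uniform :: 'a measure"
  interpret \<sigma>: prob_space ?\<sigma> by (rule prob_space_sphere_uniform)
  define J where "J = (\<integral>r. (1 - ratio_cdf u (r / b)) * indicator {b<..c} r \<partial>lborel)"
  have I: "0 \<le> I_fun DIM('a) u" by (rule nn_integral_busemann_factor(3)[OF norm_pole dim u])
  have "b * 1 \<le> c" unfolding c[symmetric] using b u by (intro mult_left_mono one_le_power) auto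
  then have J: "0 \<le> J" "ennreal J = (\<integral>\<^sup>+\<phi>. ennreal (b * ratio u pole \<phi> - b) \<partial>?\<sigma>)"
    unfolding J_def using c by (intro integral_ratio_tail u b; simp)+
  have "ennreal J + ennreal b = (\<integral>\<^sup>+\<phi>. ennreal (b * ratio u pole \<phi> - b) + ennreal b \<partial>?\<sigma>)"
    unfolding J(2) by (subst nn_integral_add) (auto simp: \<sigma>.emeasure_space_1)
  also have "\<dots> = (\<integral>\<^sup>+\<phi>. ennreal b * ennreal (ratio u pole \<phi>) \<partial>?\<sigma>)"
  proof (rule nn_integral_cong_AE)
    show "AE \<phi> in ?\<sigma>. ennreal (b * ratio u pole \<phi> - b) + ennreal b = ennreal b * ennreal (ratio u pole \<phi>)"
      using AE_sphere_uniform_norm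
    proof eventually_elim
      case (elim \<phi>)
      have "b * 1 \<le> b * ratio u pole \<phi>"
        using b ratio_bounds(1)[OF u norm_pole elim] by (intro mult_left_mono) auto
      then show ?case using b by (simp add: ennreal_plus[symmetric] ennreal_mult'[symmetric] del: ennreal_plus)
    qed
  qed
  also have "\<dots> = ennreal b * ennreal (1 + I_fun DIM('a) u)"
    by (subst nn_integral_cmult) (auto simp: nn_integral_ratio[OF u])
  also have "\<dots> = ennreal (b * (1 + I_fun DIM('a) u))"
    using b by (subst ennreal_mult') auto
  also have "ennreal J + ennreal b = ennreal (J + b)" using J b by simp
  finally have "J + b = b * (1 + I_fun DIM('a) u)"
    using J b I by (subst (asm) ennreal_inj) auto
  then show ?thesis by (simp add: J_def algebra_simps)
qed

lemma integral_ratio_tail_ge: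
  assumes u: "0 \<le> u" and a: "0 < a" and b: "a \<le> b" and c: "b * exp (2 * u) ^ (DIM('a) - 1) = c"
  shows "a * (1 + I_fun DIM('a) u) - b \<le> (\<integral>r. (1 - ratio_cdf u (r / a)) * indicator {b<..c} r \<partial>lborel)"
proof -
  let ?\<sigma> = "sphere_uniform :: 'a measure"
  interpret \<sigma>: prob_space ?\<sigma> by (rule prob_space_sphere_uniform)
  define J where "J = (\<integral>r. (1 - ratio_cdf u (r / a)) * indicator {b<..c} r \<partial>lborel)"
  have I: "0 \<le> I_fun DIM('a) u" by (rule nn_integral_busemann_factor(3)[OF norm_pole dim u])
  have "b * 1 \<le> c" unfolding c[symmetric] using a b u by (intro mult_left_mono one_le_power) auto
  moreover have "a * exp (2 * u) ^ (DIM('a) - 1) \<le> c"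
    unfolding c[symmetric] using a b by (intro mult_right_mono) auto
  ultimately have J: "0 \<le> J" "ennreal J = (\<integral>\<^sup>+\<phi>. ennreal (a * ratio u pole \<phi> - b) \<partial>?\<sigma>)"
    unfolding J_def by (intro integral_ratio_tail u a; simp)+
  have "ennreal (a * (1 + I_fun DIM('a) u)) = ennreal a * ennreal (1 + I_fun DIM('a) u)"
    using a by (subst ennreal_mult') auto
  also have "\<dots> = (\<integral>\<^sup>+\<phi>. ennreal a * ennreal (ratio u pole \<phi>) \<partial>?\<sigma>)"
    by (subst nn_integral_cmult) (auto simp: nn_integral_ratio[OF u])
  also have "\<dots> \<le> (\<integral>\<^sup>+\<phi>. ennreal (a * ratio u pole \<phi> - b) + ennreal b \<partial>?\<sigma>)"
  proof (rule nn_integral_mono)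
    fix \<phi>
    have "ennreal a * ennreal (ratio u pole \<phi>) = ennreal (a * ratio u pole \<phi>)"
      using a by (simp add: ennreal_mult'[symmetric])
    also have "\<dots> \<le> ennreal (max 0 (a * ratio u pole \<phi> - b) + b)"
      by (intro ennreal_leI) auto
    also have "\<dots> = ennreal (a * ratio u pole \<phi> - b) + ennreal b"
      using a b by (subst ennreal_plus) (auto simp: max_def ennreal_neg)
    finally show "ennreal a * ennreal (ratio u pole \<phi>) \<le> ennreal (a * ratio u pole \<phi> - b) + ennreal b" .
  qed
  also have "\<dots> = ennreal J + ennreal b"
    unfolding J(2) by (subst nn_integral_add) (auto simp: \<sigma>.emeasure_space_1)
  also have "\<dots> = ennreal (J + b)" using J a b by simp
  finally have "a * (1 + I_fun DIM('a) u) \<le> J + b"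
    using J a b by (subst (asm) ennreal_le_iff) auto
  then show ?thesis by (simp add: J_def)
qed

section \<open>The joint law of the first radius and the containment event\<close>

text \<open>
  By \<open>hyp_cball_subset_cell_iff\<close> and for $u \ge 0$, this is the event that the ball of radius \<open>u\<close> lies in
  the zero cell; the present form shows only radii and angles.
\<close>

definition ball_event :: "real \<Rightarrow> 'w set" where
  "ball_event u = {\<omega> \<in> space M. \<forall>j. j \<noteq> 0 \<longrightarrow> R 0 \<omega> * ratio u (\<Theta> 0 \<omega>) (\<Theta> j \<omega>) \<le> R j \<omega>}"

lemma ball_event_sets[measurable]: "ball_event u \<in> sets M"
  unfolding ball_event_def by measurable

text \<open>
  If the first point lies in $(a,b]$, replacing its radius by \<open>b\<close> in the condition on the other points
  makes the condition stronger, and replacing it by \<open>a\<close> makes it weaker.  Both modified events are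
  covered by \<open>prob_thinned_event\<close>: for the lower bound exactly one point is required in $(a,b]$, for
  the upper bound at least one.  Points beyond $c = b e^{2(d-1)u}$ satisfy the condition anyway, since
  the ratio is at most $e^{2(d-1)u}$.
\<close>

lemma prob_increment_bounds:
  assumes u: "0 \<le> u" and ab: "0 < a" "a \<le> b"
  defines "\<kappa> \<equiv> 1 + I_fun DIM('a) u"
  defines "E \<equiv> {\<omega> \<in> ball_event u. a < R 0 \<omega> \<and> R 0 \<omega> \<le> b}"
  shows "(b - a) * exp (- (\<kappa> * b)) \<le> prob E" "prob E \<le> (b - a) * exp (- (\<kappa> * a) + (b - a))"
proof -
  define G where "G = exp (2 * u) ^ (DIM('a) - 1)"
  \<comment> \<open>Beyond \<open>c\<close> the condition on a point holds for every angle.\<close>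
  define c where "c = b * G"
  have G: "1 \<le> G" unfolding G_def using u by (intro one_le_power) simp
  have bc: "b \<le> c" unfolding c_def using ab G by simp
  have W: "ratio u (\<Theta> 0 \<omega>) (\<Theta> j \<omega>) \<le> G" "1 \<le> ratio u (\<Theta> 0 \<omega>) (\<Theta> j \<omega>)" if "\<omega> \<in> space M" for \<omega> j
    using ratio_bounds[OF u norm_Theta[OF that] norm_Theta[OF that]] by (auto simp: G_def)
  have E[measurable]: "E \<in> sets M"
  proof -
    have "E = {\<omega> \<in> space M. \<omega> \<in> ball_event u \<and> a < R 0 \<omega> \<and> R 0 \<omega> \<le> b}"
      by (auto simp: E_def ball_event_def)
    also have "\<dots> \<in> sets M" by measurable
    finally show ?thesis .
  qed
  \<comment> \<open>\<open>t = b\<close> gives the stronger condition, \<open>t = a\<close> the weaker one.\<close>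
  define S where "S K t = {\<omega> \<in> space M. card (points_in {0..a} \<omega>) = 0 \<and> card (points_in {a<..b} \<omega>) \<in> K \<and>
        (\<forall>j. R j \<omega> \<in> {b<..c} \<longrightarrow> t * ratio u (\<Theta> 0 \<omega>) (\<Theta> j \<omega>) \<le> R j \<omega>)}" for K :: "nat set" and t
  have S[measurable]: "S K t \<in> sets M" for K t unfolding S_def by measurable
  have fin: "AE \<omega> in M. finite (points_in {0..a} \<omega>)" "AE \<omega> in M. finite (points_in {a<..b} \<omega>)"
  proof -
    have "{a<..b} \<subseteq> {0..}" using ab by auto
    then show "AE \<omega> in M. finite (points_in {0..a} \<omega>)" "AE \<omega> in M. finite (points_in {a<..b} \<omega>)"
      using AE_finite_points[of "{0..a}"] AE_finite_points[of "{a<..b}"] ab by (simp_all add: ennreal_less_top)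
  qed
  have sub1: "AE \<omega> in M. \<omega> \<in> S {1} b \<longrightarrow> \<omega> \<in> E"
    using fin(1) AE_space
  proof (eventually_elim, intro impI)
    fix \<omega> assume \<omega>: "\<omega> \<in> space M" and f: "finite (points_in {0..a} \<omega>)" and s: "\<omega> \<in> S {1} b"
    have "points_in {0..a} \<omega> = {}" using f s by (simp add: S_def)
    then have gt: "a < R j \<omega>" for j using R_pos[OF \<omega>, of j] by (force simp: not_le)
    have "card (points_in {a<..b} \<omega>) = 1" using s by (simp add: S_def)
    then obtain i where i: "points_in {a<..b} \<omega> = {i}" by (rule card_1_singletonE)
    then have "R i \<omega> \<le> b" by auto
    then have "R 0 \<omega> \<le> b" using R_less_iff[OF \<omega>, of 0 i] by (cases "i = 0") auto
    then have "0 \<in> points_in {a<..b} \<omega>" using gt by auto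
    then have i0: "points_in {a<..b} \<omega> = {0}" using i by auto
    have "R 0 \<omega> * ratio u (\<Theta> 0 \<omega>) (\<Theta> j \<omega>) \<le> R j \<omega>" if "j \<noteq> 0" for j
    proof -
      have "j \<notin> points_in {a<..b} \<omega>" using that i0 by auto
      then have bj: "b < R j \<omega>" using gt[of j] by auto
      have "R 0 \<omega> * ratio u (\<Theta> 0 \<omega>) (\<Theta> j \<omega>) \<le> b * ratio u (\<Theta> 0 \<omega>) (\<Theta> j \<omega>)"
        using \<open>R 0 \<omega> \<le> b\<close> W(2)[OF \<omega>, of j] by (intro mult_right_mono) auto
      also have "\<dots> \<le> R j \<omega>"
      proof (cases "R j \<omega> \<le> c")
        case True
        then show ?thesis using s bj by (simp add: S_def)
      next
        case False
        have "b * ratio u (\<Theta> 0 \<omega>) (\<Theta> j \<omega>) \<le> c"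
          unfolding c_def using W(1)[OF \<omega>, of j] ab by (intro mult_left_mono) auto
        then show ?thesis using False by simp
      qed
      finally show ?thesis .
    qed
    then show "\<omega> \<in> E" using \<omega> gt \<open>R 0 \<omega> \<le> b\<close> by (simp add: E_def ball_event_def)
  qed
  have sub2: "AE \<omega> in M. \<omega> \<in> E \<longrightarrow> \<omega> \<in> S {1..} a"
    using fin(2)
  proof (eventually_elim, intro impI)
    fix \<omega> assume f: "finite (points_in {a<..b} \<omega>)" and e: "\<omega> \<in> E"
    have \<omega>: "\<omega> \<in> space M" and R0: "a < R 0 \<omega>" "R 0 \<omega> \<le> b" using e by (auto simp: E_def ball_event_def)
    have gt: "a < R j \<omega>" for j using R_less_iff[OF \<omega>, of 0 j] R0 by (cases "j = 0") auto
    then have e0: "points_in {0..a} \<omega> = {}" by (force simp: not_le)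
    have "0 \<in> points_in {a<..b} \<omega>" using R0 by simp
    then have "card (points_in {a<..b} \<omega>) \<noteq> 0" using f by auto
    then have c1: "card (points_in {a<..b} \<omega>) \<in> {1..}" by simp
    have "a * ratio u (\<Theta> 0 \<omega>) (\<Theta> j \<omega>) \<le> R j \<omega>" if "R j \<omega> \<in> {b<..c}" for j
    proof -
      have "j \<noteq> 0"
      proof
        assume "j = 0"
        then show False using that R0 by simp
      qed
      have "a * ratio u (\<Theta> 0 \<omega>) (\<Theta> j \<omega>) \<le> R 0 \<omega> * ratio u (\<Theta> 0 \<omega>) (\<Theta> j \<omega>)"
        using R0 W(2)[OF \<omega>, of j] by (intro mult_right_mono) auto
      also have "\<dots> \<le> R j \<omega>" using e \<open>j \<noteq> 0\<close> by (simp add: E_def ball_event_def)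
      finally show ?thesis .
    qed
    then show "\<omega> \<in> S {1..} a" unfolding S_def mem_Collect_eq e0 using \<omega> c1 by simp
  qed
  have P0: "(\<integral>\<^sup>+\<omega>. indicator {0} (card (points_in {0..a} \<omega>)) \<partial>M) = ennreal (exp (- a))"
    using ab by (subst nn_integral_card_eq_0) (auto simp: ennreal_less_top)
  have "ennreal ((b - a) * exp (- (\<kappa> * b))) =
      ennreal (exp (- a)) * ennreal ((b - a) * exp (- (b - a))) * ennreal (exp (- (b * I_fun DIM('a) u)))"
  proof -
    have "(b - a) * exp (- (\<kappa> * b)) = exp (- a) * ((b - a) * exp (- (b - a))) * exp (- (b * I_fun DIM('a) u))"
    proof -
      have "exp (- (\<kappa> * b)) = exp (- a) * exp (- (b - a)) * exp (- (b * I_fun DIM('a) u))"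
        unfolding exp_add[symmetric] by (simp add: \<kappa>_def algebra_simps)
      then show ?thesis by simp
    qed
    then show ?thesis using ab by (simp add: ennreal_mult[symmetric])
  qed
  also have "\<dots> = emeasure M (S {1} b)"
    unfolding S_def
  proof (subst prob_thinned_event)
    have "(\<integral>r. (1 - ratio_cdf u (r / b)) * indicator {b<..c} r \<partial>lborel) = b * I_fun DIM('a) u"
      using ab by (intro integral_ratio_tail_eq u) (auto simp: c_def G_def)
    moreover have "(\<integral>\<^sup>+\<omega>. indicator {1} (card (points_in {a<..b} \<omega>)) \<partial>M) = ennreal ((b - a) * exp (- (b - a)))"
      using ab by (subst nn_integral_card_eq_1) (auto simp: ennreal_less_top)
    ultimately show "ennreal (exp (- a)) * ennreal ((b - a) * exp (- (b - a))) * ennreal (exp (- (b * I_fun DIM('a) u))) =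
      (\<integral>\<^sup>+\<omega>. indicator {0} (card (points_in {0..a} \<omega>)) \<partial>M) * (\<integral>\<^sup>+\<omega>. indicator {1} (card (points_in {a<..b} \<omega>)) \<partial>M) *
      ennreal (exp (- (\<integral>r. (1 - ratio_cdf u (r / b)) * indicator {b<..c} r \<partial>lborel)))"
      unfolding P0 by (simp only:)
  qed (use ab bc in auto)
  also have "\<dots> \<le> emeasure M E"
    using sub1 by (intro emeasure_mono_AE) auto
  finally show "(b - a) * exp (- (\<kappa> * b)) \<le> prob E"
    by (simp add: emeasure_eq_measure)
  define J where "J = (\<integral>r. (1 - ratio_cdf u (r / a)) * indicator {b<..c} r \<partial>lborel)"
  have J: "a * \<kappa> - b \<le> J"
    unfolding \<kappa>_def J_def using ab by (intro integral_ratio_tail_ge u) (auto simp: c_def G_def)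
  have "emeasure M E \<le> emeasure M (S {1..} a)"
    using sub2 by (intro emeasure_mono_AE) auto
  also have "\<dots> = ennreal (exp (- a)) * (\<integral>\<^sup>+\<omega>. indicator {1..} (card (points_in {a<..b} \<omega>)) \<partial>M) * ennreal (exp (- J))"
    unfolding S_def P0[symmetric] J_def using ab bc by (intro prob_thinned_event) auto
  also have "\<dots> \<le> ennreal (exp (- a)) * ennreal (b - a) * ennreal (exp (- (a * \<kappa> - b)))"
  proof -
    have "{a<..b} \<subseteq> {0..}" using ab by auto
    then have "(\<integral>\<^sup>+\<omega>. indicator {1..} (card (points_in {a<..b} \<omega>)) \<partial>M) \<le> ennreal (b - a)"
      using nn_integral_card_ge_1[of "{a<..b}"] ab by (simp add: ennreal_less_top)
    then show ?thesis using J by (intro mult_mono ennreal_leI) auto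
  qed
  also have "\<dots> = ennreal ((b - a) * exp (- (\<kappa> * a) + (b - a)))"
  proof -
    have "exp (- a) * (b - a) * exp (- (a * \<kappa> - b)) = (b - a) * exp (- (\<kappa> * a) + (b - a))"
    proof -
      have "exp (- (\<kappa> * a) + (b - a)) = exp (- a) * exp (- (a * \<kappa> - b))"
        unfolding exp_add[symmetric] by (simp add: algebra_simps)
      then show ?thesis by simp
    qed
    then show ?thesis using ab by (simp add: ennreal_mult[symmetric])
  qed
  finally show "prob E \<le> (b - a) * exp (- (\<kappa> * a) + (b - a))"
    using ab by (simp add: emeasure_eq_measure)
qed

text \<open>
  The bounds on increments say that the left side, as a function of \<open>t\<close>, has derivative
  $e^{-\kappa t}$ on the positive half-line.  It vanishes at $0+$, because the first radius is positive.
\<close>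

lemma prob_ball_event_first_le:
  assumes u: "0 \<le> u" and t: "0 < t"
  defines "\<kappa> \<equiv> 1 + I_fun DIM('a) u"
  shows "prob {\<omega> \<in> ball_event u. R 0 \<omega> \<le> t} = (1 - exp (- (\<kappa> * t))) / \<kappa>"
proof -
  have I: "0 \<le> I_fun DIM('a) u" by (rule nn_integral_busemann_factor(3)[OF norm_pole dim u])
  then have \<kappa>: "0 < \<kappa>" by (simp add: \<kappa>_def)
  define m where "m x = prob {\<omega> \<in> ball_event u. R 0 \<omega> \<le> x}" for x
  have sets_le: "{\<omega> \<in> ball_event u. R 0 \<omega> \<le> x} \<in> sets M" for x
  proof -
    have "{\<omega> \<in> ball_event u. R 0 \<omega> \<le> x} = {\<omega> \<in> space M. \<omega> \<in> ball_event u \<and> R 0 \<omega> \<le> x}"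
      by (auto simp: ball_event_def)
    also have "\<dots> \<in> sets M" by measurable
    finally show ?thesis .
  qed
  have diff: "(y - x) * exp (- (\<kappa> * y)) \<le> m y - m x \<and> m y - m x \<le> (y - x) * exp (- (\<kappa> * x) + (y - x))"
    if "0 < x" "x \<le> y" for x y
  proof -
    have "m y - m x = prob ({\<omega> \<in> ball_event u. R 0 \<omega> \<le> y} - {\<omega> \<in> ball_event u. R 0 \<omega> \<le> x})"
      unfolding m_def using that sets_le by (intro finite_measure_Diff[symmetric]) auto
    also have "{\<omega> \<in> ball_event u. R 0 \<omega> \<le> y} - {\<omega> \<in> ball_event u. R 0 \<omega> \<le> x} = {\<omega> \<in> ball_event u. x < R 0 \<omega> \<and> R 0 \<omega> \<le> y}"
      by auto
    finally show ?thesis using prob_increment_bounds[OF u that] by (simp add: \<kappa>_def)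
  qed
  have deriv: "(m has_real_derivative exp (- (\<kappa> * x))) (at x)" if x: "0 < x" for x
    unfolding has_field_derivative_iff
  proof (rule tendsto_sandwich)
    \<comment> \<open>The bounds on increments, divided by the length of the interval between \<open>x\<close> and \<open>y\<close>.\<close>
    let ?L = "\<lambda>y. exp (- (\<kappa> * max x y))" and ?U = "\<lambda>y. exp (- (\<kappa> * min x y) + \<bar>y - x\<bar>)"
    have ev: "\<forall>\<^sub>F y in at x. 0 < y \<and> y \<noteq> x"
    proof (rule eventually_conj)
      show "\<forall>\<^sub>F y in at x. 0 < y" using x by (intro order_tendstoD(1)[OF tendsto_ident_at]) auto
      show "\<forall>\<^sub>F y in at x. y \<noteq> x" by (simp add: eventually_at_filter)
    qed
    have bounds: "?L y \<le> (m y - m x) / (y - x) \<and> (m y - m x) / (y - x) \<le> ?U y" if "0 < y \<and> y \<noteq> x" for y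
    proof (cases "x < y")
      case True
      then show ?thesis
        using diff[of x y] x by (auto simp: field_simps max_def min_def)
    next
      case False
      then have "y < x" using that by auto
      moreover have "(m y - m x) / (y - x) = (m x - m y) / (x - y)"
        by (metis minus_diff_eq minus_divide_divide)
      ultimately show ?thesis
        using diff[of y x] that by (auto simp: field_simps max_def min_def)
    qed
    show "\<forall>\<^sub>F y in at x. ?L y \<le> (m y - m x) / (y - x)" "\<forall>\<^sub>F y in at x. (m y - m x) / (y - x) \<le> ?U y"
      using ev bounds by (auto elim!: eventually_mono)
    have "(?L \<longlongrightarrow> exp (- (\<kappa> * max x x))) (at x)" "(?U \<longlongrightarrow> exp (- (\<kappa> * min x x) + \<bar>x - x\<bar>)) (at x)"
      by (intro tendsto_intros)+
    then show "(?L \<longlongrightarrow> exp (- (\<kappa> * x))) (at x)" "(?U \<longlongrightarrow> exp (- (\<kappa> * x))) (at x)"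
      by simp_all
  qed
  define \<phi> where "\<phi> x = m x + exp (- (\<kappa> * x)) / \<kappa>" for x
  have "\<exists>c. \<forall>x\<in>{0<..}. \<phi> x = c"
  proof (rule has_field_derivative_zero_constant)
    fix x :: real assume "x \<in> {0<..}"
    then have "(\<phi> has_real_derivative exp (- (\<kappa> * x)) + exp (- (\<kappa> * x)) * (- \<kappa>) / \<kappa>) (at x)"
      unfolding \<phi>_def[abs_def] using \<kappa> by (auto intro!: derivative_eq_intros deriv)
    then show "(\<phi> has_real_derivative 0) (at x within {0<..})"
      using \<kappa> by (auto intro: has_field_derivative_at_within)
  qed simp
  then obtain c where c: "\<And>x. 0 < x \<Longrightarrow> \<phi> x = c" by auto
  have "(\<lambda>k. m (inverse (real (Suc k)))) \<longlonglongrightarrow> prob (\<Inter>k. {\<omega> \<in> ball_event u. R 0 \<omega> \<le> inverse (real (Suc k))})"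
    unfolding m_def
  proof (rule finite_Lim_measure_decseq)
    show "range (\<lambda>k. {\<omega> \<in> ball_event u. R 0 \<omega> \<le> inverse (real (Suc k))}) \<subseteq> sets M" using sets_le by auto
    have "inverse (real (Suc l)) \<le> inverse (real (Suc k))" if "k \<le> l" for k l
      using that by (intro le_imp_inverse_le) auto
    then show "decseq (\<lambda>k. {\<omega> \<in> ball_event u. R 0 \<omega> \<le> inverse (real (Suc k))})"
      by (auto simp: decseq_def intro: order_trans simp del: of_nat_Suc)
  qed
  also have "(\<Inter>k. {\<omega> \<in> ball_event u. R 0 \<omega> \<le> inverse (real (Suc k))}) = {}"
  proof -
    have "\<exists>k. \<not> R 0 \<omega> \<le> inverse (real (Suc k))" if "\<omega> \<in> ball_event u" for \<omega>
      using reals_Archimedean[OF R_pos[of \<omega> 0]] that by (auto simp: ball_event_def not_le)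
    then show ?thesis by blast
  qed
  finally have m0: "(\<lambda>k. m (inverse (real (Suc k)))) \<longlonglongrightarrow> 0" by simp
  have "(\<lambda>k. exp (- (\<kappa> * inverse (real (Suc k)))) / \<kappa>) \<longlonglongrightarrow> exp (- (\<kappa> * 0)) / \<kappa>"
    using \<kappa> by (intro tendsto_intros LIMSEQ_inverse_real_of_nat) auto
  from tendsto_add[OF m0 this] have "(\<lambda>k. \<phi> (inverse (real (Suc k)))) \<longlonglongrightarrow> 1 / \<kappa>"
    by (simp add: \<phi>_def)
  moreover have "(\<lambda>k. \<phi> (inverse (real (Suc k)))) = (\<lambda>k. c)" by (simp add: c)
  ultimately have "c = 1 / \<kappa>" by (simp add: LIMSEQ_const_iff)
  then have "m t + exp (- (\<kappa> * t)) / \<kappa> = 1 / \<kappa>" using c[OF t] by (simp add: \<phi>_def)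
  then show ?thesis by (simp add: m_def diff_divide_distrib)
qed

lemma emeasure_ball_event_first:
  assumes u: "0 \<le> u" and B: "B \<in> sets borel"
  shows "emeasure M {\<omega> \<in> ball_event u. R 0 \<omega> \<in> B} =
    (\<integral>\<^sup>+s. ennreal (exp (- ((1 + I_fun DIM('a) u) * s))) * indicator {0<..} s * indicator B s \<partial>lborel)"
proof -
  define \<kappa> where "\<kappa> = 1 + I_fun DIM('a) u"
  have I: "0 \<le> I_fun DIM('a) u" by (rule nn_integral_busemann_factor(3)[OF norm_pole dim u])
  then have \<kappa>: "0 < \<kappa>" by (simp add: \<kappa>_def)
  define \<mu> where "\<mu> = distr (density M (indicator (ball_event u))) borel (R 0)"
  define \<nu> where "\<nu> = density lborel (\<lambda>s. ennreal (exp (- (\<kappa> * s))) * indicator {0<..} s)"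
  have e\<mu>: "emeasure \<mu> A = emeasure M {\<omega> \<in> ball_event u. R 0 \<omega> \<in> A}" if [measurable]: "A \<in> sets borel" for A
  proof -
    have "emeasure \<mu> A = (\<integral>\<^sup>+\<omega>. indicator (ball_event u) \<omega> * indicator (R 0 -` A \<inter> space M) \<omega> \<partial>M)"
      unfolding \<mu>_def by (simp add: emeasure_distr emeasure_density)
    also have "\<dots> = (\<integral>\<^sup>+\<omega>. indicator {\<omega> \<in> space M. \<omega> \<in> ball_event u \<and> R 0 \<omega> \<in> A} \<omega> \<partial>M)"
      by (intro nn_integral_cong) (auto simp: indicator_def)
    also have "\<dots> = emeasure M {\<omega> \<in> space M. \<omega> \<in> ball_event u \<and> R 0 \<omega> \<in> A}" by simp
    also have "{\<omega> \<in> space M. \<omega> \<in> ball_event u \<and> R 0 \<omega> \<in> A} = {\<omega> \<in> ball_event u. R 0 \<omega> \<in> A}"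
      by (auto simp: ball_event_def)
    finally show ?thesis .
  qed
  have AE0: "AE s::real in lborel. s \<noteq> 0" by (rule AE_lborel_singleton)
  have F: "((\<lambda>s. - exp (- (\<kappa> * s)) / \<kappa>) has_real_derivative exp (- (\<kappa> * s))) (at s)" for s
    using \<kappa> by (auto intro!: derivative_eq_intros)
  have e\<nu>: "emeasure \<nu> {..x} = (if 0 < x then ennreal ((1 - exp (- (\<kappa> * x))) / \<kappa>) else 0)" for x
  proof (cases "0 < x")
    case True
    have "emeasure \<nu> {..x} = (\<integral>\<^sup>+s. ennreal (exp (- (\<kappa> * s))) * indicator {0<..} s * indicator {..x} s \<partial>lborel)"
      unfolding \<nu>_def by (rule emeasure_density) auto
    also have "\<dots> = (\<integral>\<^sup>+s. ennreal (exp (- (\<kappa> * s))) * indicator {0..x} s \<partial>lborel)"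
      using AE0 by (intro nn_integral_cong_AE) (auto simp: indicator_def elim!: eventually_mono)
    also have "\<dots> = ennreal (- exp (- (\<kappa> * x)) / \<kappa> - (- exp (- (\<kappa> * 0)) / \<kappa>))"
      using True by (intro nn_integral_FTC_Icc F) auto
    finally show ?thesis using True by (simp add: diff_divide_distrib)
  next
    case False
    have "emeasure \<nu> {..x} = (\<integral>\<^sup>+s. ennreal (exp (- (\<kappa> * s))) * indicator {0<..} s * indicator {..x} s \<partial>lborel)"
      unfolding \<nu>_def by (rule emeasure_density) auto
    also have "\<dots> = (\<integral>\<^sup>+(s::real). 0 \<partial>lborel)"
      using False by (intro nn_integral_cong) (auto simp: indicator_def)
    finally show ?thesis using False by simp
  qed
  have "\<mu> = \<nu>"
  proof (rule cdf_unique')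
    show "finite_borel_measure \<mu>"
    proof (intro finite_borel_measure.intro finite_measureI finite_borel_measure_axioms.intro)
      show "emeasure \<mu> (space \<mu>) \<noteq> \<infinity>" using e\<mu>[of UNIV] by (simp add: \<mu>_def)
      show "sets \<mu> = sets borel" by (simp add: \<mu>_def)
    qed
    show "finite_borel_measure \<nu>"
    proof (intro finite_borel_measure.intro finite_measureI finite_borel_measure_axioms.intro)
      have "emeasure \<nu> (space \<nu>) = (\<integral>\<^sup>+s. ennreal (exp (- (\<kappa> * s))) * indicator {0<..} s \<partial>lborel)"
        unfolding \<nu>_def by (subst emeasure_density) auto
      also have "\<dots> = (\<integral>\<^sup>+s. ennreal (exp (- (\<kappa> * s))) * indicator {0..} s \<partial>lborel)"
        using AE0 by (intro nn_integral_cong_AE) (auto simp: indicator_def elim!: eventually_mono)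
      also have "\<dots> = 0 - (- exp (- (\<kappa> * 0)) / \<kappa>)"
      proof (rule nn_integral_FTC_atLeast)
        have "((\<lambda>s. exp (- (\<kappa> * s))) \<longlongrightarrow> 0) at_top"
          using \<kappa> by (intro filterlim_compose[OF exp_at_bot] filterlim_uminus_at_bot_at_top filterlim_compose[OF filterlim_uminus_at_bot_at_top]
            filterlim_tendsto_pos_mult_at_top[OF tendsto_const _ filterlim_ident]) auto
        then have "((\<lambda>s. - exp (- (\<kappa> * s)) / \<kappa>) \<longlongrightarrow> - 0 / \<kappa>) at_top"
          using \<kappa> by (intro tendsto_intros) auto
        then show "((\<lambda>s. - exp (- (\<kappa> * s)) / \<kappa>) \<longlongrightarrow> 0) at_top" by simp
      qed (use F in auto)
      finally show "emeasure \<nu> (space \<nu>) \<noteq> \<infinity>" by simp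
      show "sets \<nu> = sets borel" by (simp add: \<nu>_def)
    qed
    show "cdf \<mu> = cdf \<nu>"
    proof
      fix x
      have "emeasure \<mu> {..x} = emeasure \<nu> {..x}"
      proof (cases "0 < x")
        case True
        then show ?thesis
          using prob_ball_event_first_le[OF u True] e\<mu>[of "{..x}"]
          by (simp add: e\<nu> emeasure_eq_measure \<kappa>_def)
      next
        case False
        then have eq: "{\<omega> \<in> ball_event u. R 0 \<omega> \<in> {..x}} = {}"
          using R_pos[of _ 0] by (force simp: ball_event_def)
        have "emeasure \<mu> {..x} = 0" by (subst e\<mu>, simp) (simp only: eq emeasure_empty)
        then show ?thesis using False by (simp add: e\<nu>)
      qed
      then show "cdf \<mu> x = cdf \<nu> x" by (simp add: cdf_def measure_def)
    qed
  qed
  then have "emeasure M {\<omega> \<in> ball_event u. R 0 \<omega> \<in> B} = emeasure \<nu> B" using e\<mu>[OF B] by simp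
  then show ?thesis using B unfolding \<nu>_def \<kappa>_def by (subst (asm) emeasure_density) auto
qed

section \<open>The distance from the origin to the boundary of the zero cell\<close>

abbreviation boundary_dist :: "'w \<Rightarrow> ereal" where
  "boundary_dist \<omega> \<equiv> origin_boundary_dist (zero_cell \<Theta> R \<omega>)"

lemma ball_in_zero_cell_eq:
  assumes u: "0 \<le> u"
  shows "ball_in_zero_cell M \<Theta> R u = ball_event u"
proof -
  have "hyp_cball 0 u \<subseteq> zero_cell \<Theta> R \<omega> \<longleftrightarrow> (\<forall>j. j \<noteq> 0 \<longrightarrow> R 0 \<omega> * ratio u (\<Theta> 0 \<omega>) (\<Theta> j \<omega>) \<le> R j \<omega>)"
    if "\<omega> \<in> space M" for \<omega>
    unfolding zero_cell_def ratio_def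
    by (rule hyp_cball_subset_cell_iff[OF dim norm_Theta[OF that] R_pos[OF that] u])
  then show ?thesis by (auto simp: ball_in_zero_cell_def ball_event_def)
qed

lemma ball_event_0: "ball_event 0 = space M"
proof -
  have "R 0 \<omega> * ratio 0 (\<Theta> 0 \<omega>) (\<Theta> j \<omega>) \<le> R j \<omega>" if "\<omega> \<in> space M" "j \<noteq> 0" for \<omega> j
    using R_less_iff[OF that(1), of 0 j] that(2) by (simp add: ratio_def busemann_factor_def)
  then show ?thesis by (auto simp: ball_event_def)
qed

lemma boundary_dist_ge_iff:
  assumes \<omega>: "\<omega> \<in> space M" and u: "0 \<le> u"
  shows "ereal u \<le> boundary_dist \<omega> \<longleftrightarrow> \<omega> \<in> ball_event u"
proof -
  have "\<exists>K. closed K \<and> zero_cell \<Theta> R \<omega> = ball 0 1 \<inter> K"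
    unfolding zero_cell_def by (rule cell_relatively_closed[OF dim norm_Theta[OF \<omega>] R_pos[OF \<omega>]])
  then obtain K where K: "closed K" "zero_cell \<Theta> R \<omega> = ball 0 1 \<inter> K" by auto
  have "\<omega> \<in> ball_in_zero_cell M \<Theta> R 0" using \<omega> ball_in_zero_cell_eq[of 0] ball_event_0 by simp
  then have "hyp_cball 0 0 \<subseteq> zero_cell \<Theta> R \<omega>" by (simp add: ball_in_zero_cell_def)
  then have "0 \<in> zero_cell \<Theta> R \<omega>" by (auto simp: hyp_cball_origin)
  from origin_boundary_dist_ge_iff[OF K this u]
  have "ereal u \<le> boundary_dist \<omega> \<longleftrightarrow> hyp_cball 0 u \<subseteq> zero_cell \<Theta> R \<omega>" .
  also have "\<dots> \<longleftrightarrow> \<omega> \<in> ball_in_zero_cell M \<Theta> R u"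
    using \<omega> unfolding ball_in_zero_cell_def mem_Collect_eq by blast
  finally show ?thesis unfolding ball_in_zero_cell_eq[OF u] .
qed

text \<open>
  Sets of the form \<open>{x..}\<close> generate the Borel sets, and their preimages are containment events or
  countable intersections of such events.
\<close>

lemma boundary_dist_measurable[measurable]: "boundary_dist \<in> borel_measurable M"
  unfolding borel_eq_atLeast_ereal
proof (rule measurable_sigma_sets)
  fix A :: "ereal set" assume "A \<in> range atLeast"
  then obtain x where A: "A = {x..}" by auto
  show "boundary_dist -` A \<inter> space M \<in> sets M"
  proof (cases "x \<le> 0")
    case True
    then have "boundary_dist -` A \<inter> space M = space M"
      using origin_boundary_dist_nonneg by (auto simp: A intro: order_trans)
    then show ?thesis by simp
  next
    case False
    show ?thesis
    proof (cases x)
      case (real r)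
      then have "boundary_dist -` A \<inter> space M = ball_event r"
        using False boundary_dist_ge_iff[of _ r] by (auto simp: A ball_event_def)
      then show ?thesis by simp
    next
      case PInf
      have "boundary_dist -` A \<inter> space M = (\<Inter>n. ball_event (real n))"
      proof (intro equalityI subsetI)
        fix \<omega> assume "\<omega> \<in> boundary_dist -` A \<inter> space M"
        then show "\<omega> \<in> (\<Inter>n. ball_event (real n))"
          using boundary_dist_ge_iff[of \<omega>] PInf by (auto simp: A)
      next
        fix \<omega> assume *: "\<omega> \<in> (\<Inter>n. ball_event (real n))"
        then have \<omega>: "\<omega> \<in> space M" by (auto simp: ball_event_def)
        have "ereal (real n) \<le> boundary_dist \<omega>" for n
          using * boundary_dist_ge_iff[OF \<omega>, of "real n"] by auto
        note ge = this
        have "boundary_dist \<omega> = \<infinity>"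
        proof (rule ereal_top)
          fix B
          obtain n where "B \<le> real n" using real_arch_simple by blast
          then have "ereal B \<le> ereal (real n)" by simp
          then show "ereal B \<le> boundary_dist \<omega>" using ge by (rule order_trans)
        qed
        then show "\<omega> \<in> boundary_dist -` A \<inter> space M" using \<omega> PInf by (simp add: A)
      qed
      then show ?thesis by auto
    qed (use False in auto)
  qed
qed auto

lemma I_nonneg: "0 \<le> u \<Longrightarrow> 0 \<le> I_fun DIM('a) u"
  by (rule nn_integral_busemann_factor(3)[OF norm_pole dim])

lemma I_0: "I_fun DIM('a) 0 = 0"
  using I_fun_bounds[OF dim, of 0] by simp

lemma distr_first_radius: "distr M borel (R 0) = density lborel (exponential_density 1)"
proof (rule measure_eqI)
  fix B assume "B \<in> sets (distr M borel (R 0))"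
  then have B[measurable]: "B \<in> sets borel" by simp
  have "emeasure (distr M borel (R 0)) B = emeasure M {\<omega> \<in> ball_event 0. R 0 \<omega> \<in> B}"
    by (subst emeasure_distr) (auto simp: ball_event_0 intro!: arg_cong[where f = "emeasure M"])
  also have "\<dots> = (\<integral>\<^sup>+s. ennreal (exp (- s)) * indicator {0<..} s * indicator B s \<partial>lborel)"
    using emeasure_ball_event_first[of 0, OF order_refl B] by (simp add: I_0)
  also have "\<dots> = (\<integral>\<^sup>+s. ennreal (exponential_density 1 s) * indicator B s \<partial>lborel)"
    using AE_lborel_singleton[of "0::real"]
    by (intro nn_integral_cong_AE) (auto simp: exponential_density_def indicator_def elim!: eventually_mono)
  also have "\<dots> = emeasure (density lborel (exponential_density 1)) B"
    by (subst emeasure_density) auto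
  finally show "emeasure (distr M borel (R 0)) B = emeasure (density lborel (exponential_density 1)) B" .
qed simp

text \<open>
  The density $e^{-(1 + I_d(u)) s}$ is the density of the first radius, which is the case
  \<open>u = 0\<close>, multiplied by the conditional probability $e^{-s I_d(u)}$.
\<close>

lemma emeasure_ball_event_first_exp:
  assumes u: "0 \<le> u" and B[measurable]: "B \<in> sets borel"
  shows "emeasure M {\<omega> \<in> ball_event u. R 0 \<omega> \<in> B} =
    (\<integral>\<^sup>+s. ennreal (exp (- (s * I_fun DIM('a) u))) * indicator B s \<partial>distr M borel (R 0))"
proof -
  have "emeasure M {\<omega> \<in> ball_event u. R 0 \<omega> \<in> B} =
    (\<integral>\<^sup>+s. ennreal (exp (- ((1 + I_fun DIM('a) u) * s))) * indicator {0<..} s * indicator B s \<partial>lborel)"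
    by (rule emeasure_ball_event_first[OF u B])
  also have "\<dots> = (\<integral>\<^sup>+s. ennreal (exponential_density 1 s) * (ennreal (exp (- (s * I_fun DIM('a) u))) * indicator B s) \<partial>lborel)"
  proof (rule nn_integral_cong_AE)
    show "AE s in lborel. ennreal (exp (- ((1 + I_fun DIM('a) u) * s))) * indicator {0<..} s * indicator B s =
        ennreal (exponential_density 1 s) * (ennreal (exp (- (s * I_fun DIM('a) u))) * indicator B s)"
      using AE_lborel_singleton[of "0::real"]
    proof eventually_elim
      case (elim s)
      have "exp (- ((1 + I_fun DIM('a) u) * s)) = exp (- s) * exp (- (s * I_fun DIM('a) u))"
        unfolding exp_add[symmetric] by (simp add: algebra_simps)
      then show ?case
        using elim by (auto simp: exponential_density_def indicator_def ennreal_mult)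
    qed
  qed
  also have "\<dots> = (\<integral>\<^sup>+s. ennreal (exp (- (s * I_fun DIM('a) u))) * indicator B s \<partial>distr M borel (R 0))"
    unfolding distr_first_radius by (subst nn_integral_density) auto
  finally show ?thesis .
qed

lemma prob_ball_event:
  assumes u: "0 \<le> u"
  shows "prob (ball_event u) = 1 / (1 + I_fun DIM('a) u)"
proof -
  let ?\<kappa> = "1 + I_fun DIM('a) u"
  have \<kappa>: "0 < ?\<kappa>" using I_nonneg[OF u] by simp
  have "(\<lambda>k. prob {\<omega> \<in> ball_event u. R 0 \<omega> \<le> real (Suc k)}) \<longlonglongrightarrow> prob (\<Union>k. {\<omega> \<in> ball_event u. R 0 \<omega> \<le> real (Suc k)})"
  proof (rule finite_Lim_measure_incseq)
    have "{\<omega> \<in> ball_event u. R 0 \<omega> \<le> x} = {\<omega> \<in> space M. \<omega> \<in> ball_event u \<and> R 0 \<omega> \<le> x}" for x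
      by (auto simp: ball_event_def)
    then have "{\<omega> \<in> ball_event u. R 0 \<omega> \<le> x} \<in> sets M" for x by simp
    then show "range (\<lambda>k. {\<omega> \<in> ball_event u. R 0 \<omega> \<le> real (Suc k)}) \<subseteq> sets M" by auto
    show "incseq (\<lambda>k. {\<omega> \<in> ball_event u. R 0 \<omega> \<le> real (Suc k)})"
      by (auto simp: incseq_def)
  qed
  also have "(\<Union>k. {\<omega> \<in> ball_event u. R 0 \<omega> \<le> real (Suc k)}) = ball_event u"
  proof -
    have "\<exists>k. x \<le> real (Suc k)" for x by (meson le_SucI of_nat_le_iff order_trans real_arch_simple order_refl)
    then show ?thesis by blast
  qed
  finally have "(\<lambda>k. (1 - exp (- (?\<kappa> * real (Suc k)))) / ?\<kappa>) \<longlonglongrightarrow> prob (ball_event u)"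
    using prob_ball_event_first_le[OF u] by simp
  moreover have "(\<lambda>k. (1 - exp (- (?\<kappa> * real (Suc k)))) / ?\<kappa>) \<longlonglongrightarrow> (1 - 0) / ?\<kappa>"
  proof -
    have "filterlim (\<lambda>k. ?\<kappa> * real (Suc k)) at_top sequentially"
      using \<kappa> by (intro filterlim_tendsto_pos_mult_at_top[OF tendsto_const] filterlim_compose[OF filterlim_real_sequentially] filterlim_Suc) auto
    then have "(\<lambda>k. exp (- (?\<kappa> * real (Suc k)))) \<longlonglongrightarrow> 0"
      by (intro filterlim_compose[OF exp_at_bot] filterlim_compose[OF filterlim_uminus_at_bot_at_top])
    then show ?thesis using \<kappa> by (intro tendsto_intros) auto
  qed
  ultimately have "prob (ball_event u) = (1 - 0) / ?\<kappa>" by (rule LIMSEQ_unique)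
  then show ?thesis by simp
qed

lemma cond_prob_ball_event:
  assumes u: "0 \<le> u"
  shows "AE \<omega> in M. cond_prob_given M (R 0) (ball_event u) \<omega> = exp (- (R 0 \<omega> * I_fun DIM('a) u))"
proof -
  let ?F = "vimage_algebra (space M) (R 0) borel"
  let ?g = "\<lambda>\<omega>. exp (- (R 0 \<omega> * I_fun DIM('a) u))"
  have F_sets: "sets ?F = {R 0 -` A \<inter> space M | A. A \<in> sets borel}" by (intro sets_vimage_algebra2) auto
  have "subalgebra M ?F" unfolding subalgebra_def by (auto simp: F_sets)
  then have "finite_measure_subalgebra M ?F"
    by (intro finite_measure_subalgebra.intro finite_measure_axioms finite_measure_subalgebra_axioms.intro)
  then interpret sigma_finite_subalgebra M ?F by (rule finite_measure_subalgebra_is_sigma_finite)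
  have R0F: "R 0 \<in> ?F \<rightarrow>\<^sub>M borel" by (intro measurable_vimage_algebra1) auto
  have g_int: "integrable M ?g"
  proof (rule integrable_const_bound[of _ 1])
    show "AE \<omega> in M. norm (?g \<omega>) \<le> 1"
    proof (rule AE_I2)
      fix \<omega> assume "\<omega> \<in> space M"
      then have "0 \<le> R 0 \<omega> * I_fun DIM('a) u" by (intro mult_nonneg_nonneg I_nonneg u less_imp_le[OF R_pos])
      then show "norm (?g \<omega>) \<le> 1" by simp
    qed
  qed simp
  have ind_int: "integrable M (indicator (ball_event u) :: 'w \<Rightarrow> real)"
    by (rule integrable_real_indicator) (auto simp: emeasure_eq_measure)
  show ?thesis
    unfolding cond_prob_given_def
  proof (rule real_cond_exp_charact)
    fix A assume "A \<in> sets ?F"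
    then obtain B where A: "A = R 0 -` B \<inter> space M" and B[measurable]: "B \<in> sets borel" unfolding F_sets by blast
    have "(\<integral>\<omega>\<in>A. indicator (ball_event u) \<omega> \<partial>M) = (\<integral>\<omega>. indicator {\<omega> \<in> space M. \<omega> \<in> ball_event u \<and> R 0 \<omega> \<in> B} \<omega> \<partial>M)"
      unfolding set_lebesgue_integral_def A by (intro Bochner_Integration.integral_cong) (auto simp: indicator_def)
    also have "\<dots> = prob {\<omega> \<in> space M. \<omega> \<in> ball_event u \<and> R 0 \<omega> \<in> B}"
      by (subst Bochner_Integration.integral_indicator) (auto intro!: arg_cong[where f = prob])
    also have "{\<omega> \<in> space M. \<omega> \<in> ball_event u \<and> R 0 \<omega> \<in> B} = {\<omega> \<in> ball_event u. R 0 \<omega> \<in> B}"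
      by (auto simp: ball_event_def)
    also have "prob {\<omega> \<in> ball_event u. R 0 \<omega> \<in> B} = enn2real (\<integral>\<^sup>+\<omega>. ennreal (indicator A \<omega> *\<^sub>R ?g \<omega>) \<partial>M)"
      unfolding measure_def emeasure_ball_event_first_exp[OF u B]
      by (subst nn_integral_distr) (auto simp: A indicator_def intro!: arg_cong[where f = enn2real] nn_integral_cong)
    also have "\<dots> = (\<integral>\<omega>\<in>A. ?g \<omega> \<partial>M)"
      unfolding set_lebesgue_integral_def
      by (rule integral_eq_nn_integral[symmetric]) (auto simp: A)
    finally show "(\<integral>\<omega>\<in>A. indicator (ball_event u) \<omega> \<partial>M) = (\<integral>\<omega>\<in>A. ?g \<omega> \<partial>M)" .
  next
    show "?g \<in> borel_measurable ?F" using R0F by measurable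
  qed (use g_int ind_int in auto)
qed

section \<open>The conditional law of the distance\<close>

lemma I_mono:
  assumes "0 \<le> u" "u \<le> v"
  shows "I_fun DIM('a) u \<le> I_fun DIM('a) v"
proof -
  have "ball_event v \<subseteq> ball_event u"
    unfolding ball_in_zero_cell_eq[OF assms(1), symmetric] ball_in_zero_cell_eq[OF order_trans[OF assms], symmetric]
    using assms by (auto simp: ball_in_zero_cell_def hyp_cball_def subset_iff intro: order_trans)
  then have "prob (ball_event v) \<le> prob (ball_event u)" by (intro finite_measure_mono) auto
  then show ?thesis
    using I_nonneg[OF assms(1)] I_nonneg[OF order_trans[OF assms]] assms by (simp add: prob_ball_event divide_simps)
qed

text \<open>
  The events that the distance to the boundary is at least \<open>w\<close> decrease, as \<open>w\<close> increases to \<open>u\<close>, to the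
  event for \<open>u\<close>; so $1/(1 + I_d)$ is left-continuous by continuity of the probability measure.
\<close>

lemma I_left_continuous:
  assumes u: "0 < u" and le: "\<And>w. 0 \<le> w \<Longrightarrow> w < u \<Longrightarrow> I_fun DIM('a) w \<le> v"
  shows "I_fun DIM('a) u \<le> v"
proof -
  \<comment> \<open>A sequence that increases strictly to \<open>u\<close>.\<close>
  define w where "w n = u * (1 - inverse (real (Suc n)))" for n
  have inv: "inverse (real (Suc n)) \<le> 1" for n using le_imp_inverse_le[of 1 "real (Suc n)"] by simp
  have w: "0 \<le> w n" "w n < u" for n
    using u inv[of n] by (simp_all add: w_def del: of_nat_Suc)
  have w_lim: "w \<longlonglongrightarrow> u"
  proof -
    have "(\<lambda>n. u * (1 - inverse (real (Suc n)))) \<longlonglongrightarrow> u * (1 - 0)"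
      by (intro tendsto_intros LIMSEQ_inverse_real_of_nat)
    then show ?thesis by (simp add: w_def[abs_def])
  qed
  have w_inc: "w m \<le> w n" if "m \<le> n" for m n
    unfolding w_def using u that by (intro mult_left_mono diff_left_mono le_imp_inverse_le) auto
  have v: "0 \<le> v" using le[OF order_refl u] by (simp add: I_0)
  have "(\<Inter>n. ball_event (w n)) = ball_event u"
  proof (intro equalityI subsetI)
    fix \<omega> assume *: "\<omega> \<in> (\<Inter>n. ball_event (w n))"
    then have \<omega>: "\<omega> \<in> space M" by (auto simp: ball_event_def)
    have ge: "ereal (w n) \<le> boundary_dist \<omega>" for n using * boundary_dist_ge_iff[OF \<omega> w(1)] by auto
    have lim: "(\<lambda>n. ereal (w n)) \<longlonglongrightarrow> ereal u" using w_lim by simp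
    have "ereal u \<le> boundary_dist \<omega>" by (rule LIMSEQ_le_const2[OF lim]) (use ge in auto)
    then show "\<omega> \<in> ball_event u" using boundary_dist_ge_iff[OF \<omega> less_imp_le[OF u]] by simp
  next
    fix \<omega> assume *: "\<omega> \<in> ball_event u"
    then have \<omega>: "\<omega> \<in> space M" by (auto simp: ball_event_def)
    have "ereal u \<le> boundary_dist \<omega>" using * boundary_dist_ge_iff[OF \<omega> less_imp_le[OF u]] by simp
    then have "ereal (w n) \<le> boundary_dist \<omega>" for n
      using w(2)[of n] by (meson ereal_less_eq(3) less_imp_le order_trans)
    then show "\<omega> \<in> (\<Inter>n. ball_event (w n))" using boundary_dist_ge_iff[OF \<omega> w(1)] by auto
  qed
  moreover have "(\<lambda>n. prob (ball_event (w n))) \<longlonglongrightarrow> prob (\<Inter>n. ball_event (w n))"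
  proof (rule finite_Lim_measure_decseq)
    show "decseq (\<lambda>n. ball_event (w n))"
    proof (rule decseq_SucI, rule subsetI)
      fix n \<omega> assume *: "\<omega> \<in> ball_event (w (Suc n))"
      then have \<omega>: "\<omega> \<in> space M" by (auto simp: ball_event_def)
      have "ereal (w (Suc n)) \<le> boundary_dist \<omega>" using * boundary_dist_ge_iff[OF \<omega> w(1)] by simp
      then have "ereal (w n) \<le> boundary_dist \<omega>" using w_inc[of n "Suc n"]
        by (meson ereal_less_eq(3) le_SucI order_refl order_trans)
      then show "\<omega> \<in> ball_event (w n)" using boundary_dist_ge_iff[OF \<omega> w(1)] by simp
    qed
  qed auto
  ultimately have "(\<lambda>n. prob (ball_event (w n))) \<longlonglongrightarrow> prob (ball_event u)" by simp
  moreover have "1 / (1 + v) \<le> prob (ball_event (w n))" for n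
    using le[OF w] I_nonneg[OF w(1)[of n]] v unfolding prob_ball_event[OF w(1)]
    by (intro divide_left_mono) auto
  ultimately have "1 / (1 + v) \<le> prob (ball_event u)" by (intro LIMSEQ_le_const) auto
  then show ?thesis
    using u v I_nonneg[of u] by (simp add: prob_ball_event field_simps)
qed

text \<open>
  A generalised inverse of $I_d$.  Admitting \<open>u = 0\<close> unconditionally keeps the set
  non-empty for negative \<open>v\<close>, so that the function is monotone on the whole line.
\<close>

definition I_inverse :: "real \<Rightarrow> real" where
  "I_inverse v = Sup {u. 0 \<le> u \<and> (u = 0 \<or> I_fun DIM('a) u \<le> v)}"

lemma I_ge_linear:
  assumes u: "0 \<le> u"
  shows "(real DIM('a) - 1) * u \<le> I_fun DIM('a) u"
  using I_fun_bounds(2)[OF dim u] exp_ge_add_one_self[of "(real DIM('a) - 1) * u"] by linarith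

lemma I_inverse_set:
  "0 \<in> {u. 0 \<le> u \<and> (u = 0 \<or> I_fun DIM('a) u \<le> v)}"
  "bdd_above {u. 0 \<le> u \<and> (u = 0 \<or> I_fun DIM('a) u \<le> v)}"
proof -
  have d: "0 < real DIM('a) - 1" using dim by simp
  show "bdd_above {u. 0 \<le> u \<and> (u = 0 \<or> I_fun DIM('a) u \<le> v)}"
  proof (rule bdd_aboveI)
    fix u assume "u \<in> {u. 0 \<le> u \<and> (u = 0 \<or> I_fun DIM('a) u \<le> v)}"
    then have "u = 0 \<or> (0 \<le> u \<and> (real DIM('a) - 1) * u \<le> v)" using I_ge_linear[of u] by auto
    then have "u = 0 \<or> u \<le> v / (real DIM('a) - 1)" using d by (auto simp: pos_le_divide_eq mult.commute)
    then show "u \<le> max 0 (v / (real DIM('a) - 1))" by auto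
  qed
qed simp

lemma I_inverse_mono: "mono I_inverse"
proof (rule monoI)
  fix v w :: real assume "v \<le> w"
  then show "I_inverse v \<le> I_inverse w"
    unfolding I_inverse_def using I_inverse_set(1)[of v] by (intro cSup_subset_mono I_inverse_set(2)) auto
qed

lemma I_inverse_ge_iff:
  assumes u: "0 \<le> u" and v: "0 \<le> v"
  shows "u \<le> I_inverse v \<longleftrightarrow> I_fun DIM('a) u \<le> v"
proof
  assume "I_fun DIM('a) u \<le> v"
  then show "u \<le> I_inverse v"
    unfolding I_inverse_def using u by (intro cSup_upper I_inverse_set(2)) auto
next
  assume *: "u \<le> I_inverse v"
  show "I_fun DIM('a) u \<le> v"
  proof (cases "u = 0")
    case True
    then show ?thesis using v by (simp add: I_0)
  next
    case False
    then have "0 < u" using u by simp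
    then show ?thesis
    proof (rule I_left_continuous)
      fix w assume w: "0 \<le> w" "w < u"
      then have "w < Sup {u. 0 \<le> u \<and> (u = 0 \<or> I_fun DIM('a) u \<le> v)}" using * by (simp add: I_inverse_def)
      then obtain x where x: "0 \<le> x" "x = 0 \<or> I_fun DIM('a) x \<le> v" "w < x"
        using less_cSup_iff[OF _ I_inverse_set(2), of v w] I_inverse_set(1)[of v] by blast
      then show "I_fun DIM('a) w \<le> v" using w I_mono[of w x] by auto
    qed
  qed
qed

lemma I_inverse_measurable[measurable]: "I_inverse \<in> borel_measurable borel"
  by (rule borel_measurable_mono[OF I_inverse_mono])

abbreviation unit_exponential :: "real measure" where
  "unit_exponential \<equiv> density lborel (exponential_density 1)"

text \<open>
  The law of $I_d^{-1}(V/s)$ for a standard exponential variable $V$.  For $s > 0$ it gives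
  $[u, \infty]$ the mass $P[V \ge s I_d(u)] = e^{-s I_d(u)}$; for $s \le 0$ it is a point mass at 0.
\<close>

definition dist_kernel :: "real \<Rightarrow> ereal measure" where
  "dist_kernel s = distr unit_exponential borel (\<lambda>v. ereal (I_inverse (v / s)))"

lemma dist_kernel_prob: "prob_space (dist_kernel s)"
  unfolding dist_kernel_def
  by (intro prob_space.prob_space_distr prob_space_exponential_density) auto

lemma dist_kernel_measurable: "dist_kernel \<in> borel \<rightarrow>\<^sub>M prob_algebra borel"
  unfolding dist_kernel_def[abs_def]
proof (rule measurable_distr_prob_space2)
  show "(\<lambda>_. unit_exponential) \<in> borel \<rightarrow>\<^sub>M prob_algebra borel"
    using prob_space_exponential_density[of 1] by (intro measurable_const) (auto simp: space_prob_algebra)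
qed measurable

lemma emeasure_dist_kernel_atLeast:
  assumes s: "0 < s" and u: "0 \<le> u"
  shows "emeasure (dist_kernel s) {ereal u..} = ennreal (exp (- (s * I_fun DIM('a) u)))"
proof -
  have I: "0 \<le> s * I_fun DIM('a) u" using s I_nonneg[OF u] by simp
  have "emeasure (dist_kernel s) {ereal u..} = emeasure unit_exponential {v. u \<le> I_inverse (v / s)}"
    unfolding dist_kernel_def by (subst emeasure_distr) (auto intro!: arg_cong[where f = "emeasure _"])
  also have "\<dots> = (\<integral>\<^sup>+v. ennreal (exponential_density 1 v) * indicator {v. u \<le> I_inverse (v / s)} v \<partial>lborel)"
  proof -
    have "{v \<in> space borel. u \<le> I_inverse (v / s)} \<in> sets borel" by measurable
    then show ?thesis by (subst emeasure_density) auto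
  qed
  also have "\<dots> = (\<integral>\<^sup>+v. ennreal (exp (- v)) * indicator {s * I_fun DIM('a) u..} v \<partial>lborel)"
  proof (rule nn_integral_cong)
    fix v
    show "ennreal (exponential_density 1 v) * indicator {v. u \<le> I_inverse (v / s)} v =
        ennreal (exp (- v)) * indicator {s * I_fun DIM('a) u..} v"
    proof (cases "0 \<le> v")
      case True
      then show ?thesis
        using I_inverse_ge_iff[OF u, of "v / s"] s
        by (auto simp: exponential_density_def indicator_def pos_le_divide_eq mult.commute)
    next
      case False
      then show ?thesis using I by (auto simp: exponential_density_def indicator_def)
    qed
  qed
  also have "\<dots> = ennreal (0 - (- exp (- (s * I_fun DIM('a) u))))"
  proof (rule nn_integral_FTC_atLeast)
    have "((\<lambda>v::real. exp (- v)) \<longlongrightarrow> 0) at_top"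
      by (intro filterlim_compose[OF exp_at_bot] filterlim_uminus_at_bot_at_top)
    then show "((\<lambda>v::real. - exp (- v)) \<longlongrightarrow> 0) at_top" using tendsto_minus by fastforce
  qed (auto intro!: derivative_eq_intros)
  finally show ?thesis by simp
qed

text \<open>
  For fixed \<open>A\<close> both sides are finite measures in \<open>B\<close>.  The right side is the image of a product measure
  under $(s, v) \mapsto I_d^{-1}(v/s)$, and on the intersection-stable generator \<open>{x..}\<close> the identity is
  \<open>emeasure_ball_event_first_exp\<close>.
\<close>

lemma emeasure_first_boundary_dist:
  assumes A: "A \<in> sets borel" and B: "B \<in> sets borel"
  shows "emeasure M {\<omega> \<in> space M. R 0 \<omega> \<in> A \<and> boundary_dist \<omega> \<in> B} =
    (\<integral>\<^sup>+s. emeasure (dist_kernel s) B * indicator A s \<partial>distr M borel (R 0))"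
proof -
  note [measurable] = A
  let ?L = "distr M borel (R 0)"
  define \<mu> where "\<mu> = distr (density M (indicator (R 0 -` A \<inter> space M))) borel boundary_dist"
  have e\<mu>: "emeasure \<mu> C = emeasure M {\<omega> \<in> space M. R 0 \<omega> \<in> A \<and> boundary_dist \<omega> \<in> C}" if [measurable]: "C \<in> sets borel" for C
  proof -
    have "emeasure \<mu> C = (\<integral>\<^sup>+\<omega>. indicator (R 0 -` A \<inter> space M) \<omega> * indicator (boundary_dist -` C \<inter> space M) \<omega> \<partial>M)"
      unfolding \<mu>_def by (simp add: emeasure_distr emeasure_density)
    also have "\<dots> = (\<integral>\<^sup>+\<omega>. indicator {\<omega> \<in> space M. R 0 \<omega> \<in> A \<and> boundary_dist \<omega> \<in> C} \<omega> \<partial>M)"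
      by (intro nn_integral_cong) (auto simp: indicator_def)
    finally show ?thesis by simp
  qed
  interpret L: prob_space ?L by (rule prob_space_distr) simp
  interpret X: prob_space unit_exponential by (rule prob_space_exponential_density) simp
  interpret LX: pair_sigma_finite "density ?L (indicator A)" unit_exponential
  proof (intro pair_sigma_finite.intro)
    have "finite_measure (density ?L (indicator A))"
      by (intro finite_measureI) (simp add: emeasure_density L.emeasure_eq_measure nn_integral_indicator)
    then show "sigma_finite_measure (density ?L (indicator A))" by (rule finite_measure.axioms(1))
    show "sigma_finite_measure unit_exponential" ..
  qed
  define \<nu> where "\<nu> = distr (density ?L (indicator A) \<Otimes>\<^sub>M unit_exponential) borel (\<lambda>(s, v). ereal (I_inverse (v / s)))"
  have e\<nu>: "emeasure \<nu> C = (\<integral>\<^sup>+s. emeasure (dist_kernel s) C * indicator A s \<partial>?L)" if [measurable]: "C \<in> sets borel" for C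
  proof -
    have "emeasure \<nu> C = (\<integral>\<^sup>+x. indicator C x \<partial>\<nu>)" by (simp add: \<nu>_def)
    also have "\<dots> = (\<integral>\<^sup>+x. indicator C (ereal (I_inverse (snd x / fst x))) \<partial>(density ?L (indicator A) \<Otimes>\<^sub>M unit_exponential))"
      unfolding \<nu>_def by (subst nn_integral_distr) (auto simp: case_prod_unfold)
    also have "\<dots> = (\<integral>\<^sup>+s. (\<integral>\<^sup>+v. indicator C (ereal (I_inverse (v / s))) \<partial>unit_exponential) \<partial>density ?L (indicator A))"
      using X.nn_integral_fst[of "\<lambda>x. indicator C (ereal (I_inverse (snd x / fst x)))" "density ?L (indicator A)"]
      by simp
    also have "\<dots> = (\<integral>\<^sup>+s. emeasure (dist_kernel s) C \<partial>density ?L (indicator A))"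
    proof (rule nn_integral_cong)
      fix s
      have "emeasure (dist_kernel s) C = (\<integral>\<^sup>+x. indicator C x \<partial>dist_kernel s)" by (simp add: dist_kernel_def)
      also have "\<dots> = (\<integral>\<^sup>+v. indicator C (ereal (I_inverse (v / s))) \<partial>unit_exponential)"
        unfolding dist_kernel_def by (subst nn_integral_distr) auto
      finally show "(\<integral>\<^sup>+v. indicator C (ereal (I_inverse (v / s))) \<partial>unit_exponential) = emeasure (dist_kernel s) C" ..
    qed
    also have "\<dots> = (\<integral>\<^sup>+s. emeasure (dist_kernel s) C * indicator A s \<partial>?L)"
    proof (subst nn_integral_density)
      show "(\<lambda>s. emeasure (dist_kernel s) C) \<in> borel_measurable ?L"
        using measurable_emeasure_kernel[OF measurable_prob_algebraD[OF dist_kernel_measurable] that]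
        by (simp cong: measurable_cong_sets)
    qed (auto simp: mult.commute)
    finally show ?thesis .
  qed
  have "\<mu> = \<nu>"
  proof (rule measure_eqI_generator_eq_countable[where E = "range atLeast" and \<Omega> = UNIV and A = "{UNIV}"])
    have "{x..} \<inter> {y..} = {max x y..}" for x y :: ereal by auto
    then show "Int_stable (range (atLeast :: ereal \<Rightarrow> _))" by (auto simp: Int_stable_def)
    show "sets \<mu> = sigma_sets UNIV (range atLeast)" "sets \<nu> = sigma_sets UNIV (range atLeast)"
      by (simp_all add: \<mu>_def \<nu>_def borel_eq_atLeast_ereal)
    have "UNIV = {- \<infinity>::ereal..}" by auto
    then show "{UNIV} \<subseteq> range (atLeast :: ereal \<Rightarrow> _)" by blast
    fix a :: "ereal set" assume "a \<in> {UNIV}"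
    then show "emeasure \<mu> a \<noteq> \<infinity>" by (simp add: e\<mu>)
  next
    fix C assume "C \<in> range (atLeast :: ereal \<Rightarrow> _)"
    then obtain x where C: "C = {x..}" by auto
    have Rpos: "AE s in ?L. 0 < s"
      using R_pos[of _ 0] by (subst AE_distr_iff) (auto intro!: AE_I2)
    have fin: "emeasure \<mu> {ereal u..} = emeasure \<nu> {ereal u..}" if u: "0 \<le> u" for u
    proof -
      have "{\<omega> \<in> space M. R 0 \<omega> \<in> A \<and> boundary_dist \<omega> \<in> {ereal u..}} = {\<omega> \<in> ball_event u. R 0 \<omega> \<in> A}"
        using boundary_dist_ge_iff[OF _ u] by (auto simp: ball_event_def)
      then have "emeasure \<mu> {ereal u..} = emeasure M {\<omega> \<in> ball_event u. R 0 \<omega> \<in> A}" by (subst e\<mu>) auto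
      also have "\<dots> = (\<integral>\<^sup>+s. ennreal (exp (- (s * I_fun DIM('a) u))) * indicator A s \<partial>?L)"
        by (rule emeasure_ball_event_first_exp[OF u A])
      also have "\<dots> = (\<integral>\<^sup>+s. emeasure (dist_kernel s) {ereal u..} * indicator A s \<partial>?L)"
        using Rpos by (intro nn_integral_cong_AE) (auto simp: emeasure_dist_kernel_atLeast[OF _ u] elim!: eventually_mono)
      finally show ?thesis by (subst e\<nu>) auto
    qed
    show "emeasure \<mu> C = emeasure \<nu> C"
    proof (cases "x \<le> 0")
      case True
      have inv: "0 \<le> I_inverse v" for v
        unfolding I_inverse_def by (rule cSup_upper[OF I_inverse_set])
      have "emeasure \<mu> {x..} = emeasure \<mu> {ereal 0..}"
      proof -
        have "{\<omega> \<in> space M. R 0 \<omega> \<in> A \<and> boundary_dist \<omega> \<in> {x..}} = {\<omega> \<in> space M. R 0 \<omega> \<in> A \<and> boundary_dist \<omega> \<in> {ereal 0..}}"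
          using True origin_boundary_dist_nonneg by (auto simp: zero_ereal_def intro: order_trans)
        then show ?thesis by (subst (1 2) e\<mu>) auto
      qed
      also have "\<dots> = emeasure \<nu> {ereal 0..}" by (rule fin) simp
      also have "\<dots> = emeasure \<nu> {x..}"
      proof -
        have "ereal (I_inverse w) \<ge> x" for w
        proof -
          have "x \<le> ereal 0" using True by (simp add: zero_ereal_def)
          also have "\<dots> \<le> ereal (I_inverse w)" using inv by simp
          finally show ?thesis .
        qed
        then show ?thesis unfolding \<nu>_def using inv
          by (subst (1 2) emeasure_distr) (auto intro!: arg_cong[where f = "emeasure _"])
      qed
      finally show ?thesis by (simp add: C)
    next
      case False
      show ?thesis
      proof (cases x)
        case (real r)
        then show ?thesis using False fin[of r] by (simp add: C)
      next
        case PInf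
        have dec: "decseq (\<lambda>n. {ereal (real n)..})" by (auto simp: decseq_def intro: order_trans)
        have Int: "(\<Inter>n. {ereal (real n)..}) = {\<infinity>}"
        proof -
          have "y = \<infinity>" if "\<And>n. ereal (real n) \<le> y" for y
          proof (rule ereal_top)
            fix B
            obtain n where "B \<le> real n" using real_arch_simple by blast
            then have "ereal B \<le> ereal (real n)" by simp
            then show "ereal B \<le> y" using that by (rule order_trans)
          qed
          then show ?thesis by auto
        qed
        have "(INF n. emeasure \<mu> {ereal (real n)..}) = emeasure \<mu> (\<Inter>n. {ereal (real n)..})"
          by (rule INF_emeasure_decseq[OF _ dec]) (auto simp: e\<mu>, simp add: \<mu>_def)
        moreover have "(INF n. emeasure \<nu> {ereal (real n)..}) = emeasure \<nu> (\<Inter>n. {ereal (real n)..})"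
        proof (rule INF_emeasure_decseq[OF _ dec])
          show "emeasure \<nu> {ereal (real n)..} \<noteq> \<infinity>" for n
            unfolding fin[OF of_nat_0_le_iff, symmetric] by (subst e\<mu>) auto
        qed (auto simp: \<nu>_def)
        moreover have "{x..} = {\<infinity>}" using PInf by auto
        ultimately show ?thesis using fin by (simp add: C Int)
      qed (use False in auto)
    qed
  qed auto
  then show ?thesis using e\<mu>[OF B] e\<nu>[OF B] by simp
qed

lemma regular_cond_law_boundary_dist:
  "regular_cond_law M (R 0) boundary_dist dist_kernel"
  unfolding regular_cond_law_def
proof (intro conjI ballI)
  fix A :: "real set" and B :: "ereal set" assume A[measurable]: "A \<in> sets borel" and B: "B \<in> sets borel"
  have K: "measure (dist_kernel s) B = enn2real (emeasure (dist_kernel s) B)" for s by (simp add: measure_def)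
  interpret K: prob_space "dist_kernel s" for s by (rule dist_kernel_prob)
  have meas: "(\<lambda>s. emeasure (dist_kernel s) B) \<in> borel_measurable borel"
    by (rule measurable_emeasure_kernel[OF measurable_prob_algebraD[OF dist_kernel_measurable] B])
  have "measure M {\<omega> \<in> space M. R 0 \<omega> \<in> A \<and> boundary_dist \<omega> \<in> B} =
      enn2real (\<integral>\<^sup>+s. ennreal (indicator A s *\<^sub>R measure (dist_kernel s) B) \<partial>distr M borel (R 0))"
    unfolding measure_def[of M] emeasure_first_boundary_dist[OF A B]
    by (intro arg_cong[where f = enn2real] nn_integral_cong) (simp add: indicator_def K.emeasure_eq_measure)
  also have "\<dots> = (LINT s:A|distr M borel (R 0). measure (dist_kernel s) B)"
    unfolding set_lebesgue_integral_def
    using meas by (intro integral_eq_nn_integral[symmetric]) (auto simp: K)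
  finally show "measure M {\<omega> \<in> space M. R 0 \<omega> \<in> A \<and> boundary_dist \<omega> \<in> B} =
      (LINT s:A|distr M borel (R 0). measure (dist_kernel s) B)" .
qed (auto intro: dist_kernel_measurable)

lemma stoch_le_dist_kernel:
  assumes s: "0 < s"
  shows "stoch_le (dist_kernel s) (Exp_law (s * (real DIM('a) - 1)))"
proof (rule stoch_le_Exp_lawI)
  show "0 < s * (real DIM('a) - 1)" using s dim by simp
  fix u :: real assume u: "0 \<le> u"
  have "measure (dist_kernel s) {ereal u..} = exp (- (s * I_fun DIM('a) u))"
    by (simp add: measure_def emeasure_dist_kernel_atLeast[OF s u])
  also have "\<dots> \<le> exp (- (s * (real DIM('a) - 1)) * u)"
    using s I_ge_linear[OF u] by (simp add: mult.assoc)
  finally show "measure (dist_kernel s) {ereal u..} \<le> exp (- (s * (real DIM('a) - 1)) * u)" .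
qed (rule dist_kernel_prob | simp add: dist_kernel_def)+

lemma measure_boundary_dist_atLeast:
  assumes u: "0 \<le> u"
  shows "measure (distr M borel boundary_dist) {ereal u..} = prob (ball_event u)"
proof -
  have "boundary_dist -` {ereal u..} \<inter> space M = ball_event u"
    using boundary_dist_ge_iff[OF _ u] by (auto simp: ball_event_def)
  then show ?thesis by (simp add: measure_distr)
qed

lemma prob_ball_event_le:
  assumes u: "0 \<le> u"
  shows "prob (ball_event u) \<le> exp (- ((real DIM('a) - 1) * u))"
proof -
  have "1 / (1 + I_fun DIM('a) u) \<le> 1 / exp ((real DIM('a) - 1) * u)"
    using I_fun_bounds(2)[OF dim u] I_nonneg[OF u] by (intro divide_left_mono) auto
  then show ?thesis by (simp add: prob_ball_event[OF u] exp_minus divide_inverse)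
qed

lemma prob_ball_event_ge:
  assumes u: "0 \<le> u"
  shows "exp (- (2 * (real DIM('a) - 1) * u)) \<le> prob (ball_event u)"
proof -
  have "1 / exp (2 * (real DIM('a) - 1) * u) \<le> 1 / (1 + I_fun DIM('a) u)"
    using I_fun_bounds(1)[OF dim u] I_nonneg[OF u] by (intro divide_left_mono) auto
  then show ?thesis by (simp add: prob_ball_event[OF u] exp_minus divide_inverse)
qed

lemma stoch_le_boundary_dist_Exp:
  "stoch_le (distr M borel boundary_dist) (Exp_law (real DIM('a) - 1))"
proof (rule stoch_le_Exp_lawI)
  show "0 < real DIM('a) - 1" using dim by simp
  fix u :: real assume u: "0 \<le> u"
  show "measure (distr M borel boundary_dist) {ereal u..} \<le> exp (- (real DIM('a) - 1) * u)"
    using prob_ball_event_le[OF u] unfolding measure_boundary_dist_atLeast[OF u] minus_mult_left .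
qed (auto intro: prob_space_distr)

text \<open>
  The strict tail at \<open>x\<close> dominates the weak tails at points above \<open>x\<close>, for which the lower bound is known.
\<close>

lemma stoch_le_Exp_boundary_dist:
  "stoch_le (Exp_law (2 * (real DIM('a) - 1))) (distr M borel boundary_dist)"
  unfolding stoch_le_def
proof
  define a where "a = 2 * (real DIM('a) - 1)"
  have a: "0 < a" using dim by (simp add: a_def)
  interpret Y: prob_space "distr M borel boundary_dist" by (rule prob_space_distr) simp
  fix x :: ereal
  show "measure (Exp_law (2 * (real DIM('a) - 1))) {x<..} \<le> measure (distr M borel boundary_dist) {x<..}"
    unfolding a_def[symmetric] Exp_law_greaterThan[OF a]
  proof (cases "x = \<infinity>"; cases "x < 0")
    assume "x \<noteq> \<infinity>" "x < 0"
    have "boundary_dist -` {x<..} \<inter> space M = space M"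
      using \<open>x < 0\<close> origin_boundary_dist_nonneg by (auto intro: less_le_trans)
    then show "(if x = \<infinity> then 0 else if x < 0 then 1 else exp (- a * real_of_ereal x)) \<le> measure (distr M borel boundary_dist) {x<..}"
      using \<open>x < 0\<close> by (simp add: measure_distr prob_space)
  next
    assume "x \<noteq> \<infinity>" "\<not> x < 0"
    then obtain u where u: "x = ereal u" "0 \<le> u" by (cases x) auto
    have "exp (- a * (u + inverse (real (Suc n)))) \<le> measure (distr M borel boundary_dist) {x<..}" for n
    proof -
      have w: "0 < inverse (real (Suc n))" by simp
      have "exp (- a * (u + inverse (real (Suc n)))) \<le> prob (ball_event (u + inverse (real (Suc n))))"
        using prob_ball_event_ge[OF add_nonneg_nonneg[OF u(2) less_imp_le[OF w]]] unfolding a_def minus_mult_left .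
      also have "\<dots> = measure (distr M borel boundary_dist) {ereal (u + inverse (real (Suc n)))..}"
        using u w by (intro measure_boundary_dist_atLeast[symmetric]) (simp del: of_nat_Suc)
      also have "\<dots> \<le> measure (distr M borel boundary_dist) {x<..}"
      proof (rule Y.finite_measure_mono)
        have "x < ereal (u + inverse (real (Suc n)))" using w by (simp add: u(1) del: of_nat_Suc)
        then show "{ereal (u + inverse (real (Suc n)))..} \<subseteq> {x<..}" by (auto intro: less_le_trans)
      qed simp
      finally show ?thesis .
    qed
    moreover have "(\<lambda>n. exp (- a * (u + inverse (real (Suc n))))) \<longlonglongrightarrow> exp (- a * (u + 0))"
      by (intro tendsto_intros LIMSEQ_inverse_real_of_nat)
    ultimately have "exp (- a * (u + 0)) \<le> measure (distr M borel boundary_dist) {x<..}"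
      by (intro LIMSEQ_le_const2) auto
    then show "(if x = \<infinity> then 0 else if x < 0 then 1 else exp (- a * real_of_ereal x)) \<le> measure (distr M borel boundary_dist) {x<..}"
      using u by simp
  qed auto
qed

end

section \<open>The ball around the origin in the zero cell\<close>

theorem proposition5p1:
  fixes M :: "'w measure"
    and \<Theta> :: "nat \<Rightarrow> 'w \<Rightarrow> 'a::euclidean_space"
    and R :: "nat \<Rightarrow> 'w \<Rightarrow> real"
    and d :: nat
  assumes "d = DIM('a)" and "2 \<le> d"
    and "ideal_nuclei M \<Theta> R"
  shows
    "(\<forall>u\<ge>0. AE \<omega> in M. cond_prob_given M (R 0) (ball_in_zero_cell M \<Theta> R u) \<omega>
                        = exp (- (R 0 \<omega> * I_fun d u))) \<and>
     (\<forall>u\<ge>0. measure M (ball_in_zero_cell M \<Theta> R u) = 1 / (1 + I_fun d u)) \<and>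
     (\<forall>u\<ge>0. 1 + I_fun d u =
        2 ^ (d - 1) * Gamma (real d / 2) / (sqrt pi * Gamma ((real d - 1) / 2))
        * cosh u powr (1 - real d)
        * (LBINT t:{0..1}. t ^ (d - 2) * (1 - t\<^sup>2) powr ((real d - 3) / 2)
                            / (1 - t * tanh u) ^ (2 * d - 2))) \<and>
     (\<forall>u\<ge>0. AE \<omega> in M. cond_prob_given M (R 0) (ball_in_zero_cell M \<Theta> R u) \<omega>
                        \<le> exp (- (R 0 \<omega> * (real d - 1) * u))) \<and>
     (\<forall>u\<ge>0. measure M (ball_in_zero_cell M \<Theta> R u) \<le> exp (- ((real d - 1) * u))) \<and>
     (\<exists>K. regular_cond_law M (R 0) (\<lambda>\<omega>. origin_boundary_dist (zero_cell \<Theta> R \<omega>)) K \<and>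
          (\<forall>s>0. stoch_le (K s) (Exp_law (s * (real d - 1))))) \<and>
     stoch_le (distr M borel (\<lambda>\<omega>. origin_boundary_dist (zero_cell \<Theta> R \<omega>)))
              (Exp_law (real d - 1)) \<and>
     (\<forall>u\<ge>0. measure M (ball_in_zero_cell M \<Theta> R u) \<ge> exp (- (2 * (real d - 1) * u))) \<and>
     stoch_le (Exp_law (2 * (real d - 1)))
              (distr M borel (\<lambda>\<omega>. origin_boundary_dist (zero_cell \<Theta> R \<omega>)))"
proof -
  interpret ideal_nuclei_process M \<Theta> R
    using assms by unfold_locales auto
  note d = assms(1)
  have cond_le: "AE \<omega> in M. cond_prob_given M (R 0) (ball_event u) \<omega> \<le> exp (- (R 0 \<omega> * (real d - 1) * u))"
    if u: "0 \<le> u" for u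
    using cond_prob_ball_event[OF u] AE_space
  proof eventually_elim
    case (elim \<omega>)
    have "R 0 \<omega> * ((real d - 1) * u) \<le> R 0 \<omega> * I_fun d u"
      unfolding d using R_pos[OF elim(2)] by (intro mult_left_mono I_ge_linear u less_imp_le)
    then show ?case using elim(1) by (simp add: d mult.assoc)
  qed
  show ?thesis
  proof (intro conjI allI impI)
    show "\<exists>K. regular_cond_law M (R 0) boundary_dist K \<and> (\<forall>s>0. stoch_le (K s) (Exp_law (s * (real d - 1))))"
      using regular_cond_law_boundary_dist stoch_le_dist_kernel unfolding d by blast
    show "stoch_le (distr M borel boundary_dist) (Exp_law (real d - 1))"
      unfolding d by (rule stoch_le_boundary_dist_Exp)
    show "stoch_le (Exp_law (2 * (real d - 1))) (distr M borel boundary_dist)"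
      unfolding d by (rule stoch_le_Exp_boundary_dist)
  next
    fix u :: real assume u: "0 \<le> u"
    note eq = ball_in_zero_cell_eq[OF u]
    show "AE \<omega> in M. cond_prob_given M (R 0) (ball_in_zero_cell M \<Theta> R u) \<omega> = exp (- (R 0 \<omega> * I_fun d u))"
      unfolding eq d by (rule cond_prob_ball_event[OF u])
    show "prob (ball_in_zero_cell M \<Theta> R u) = 1 / (1 + I_fun d u)"
      unfolding eq d by (rule prob_ball_event[OF u])
    show "1 + I_fun d u = 2 ^ (d - 1) * Gamma (real d / 2) / (sqrt pi * Gamma ((real d - 1) / 2))
        * cosh u powr (1 - real d)
        * (LBINT t:{0..1}. t ^ (d - 2) * (1 - t\<^sup>2) powr ((real d - 3) / 2)
                            / (1 - t * tanh u) ^ (2 * d - 2))"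
      unfolding d by (rule I_fun_beta_integral[OF dim u])
    show "AE \<omega> in M. cond_prob_given M (R 0) (ball_in_zero_cell M \<Theta> R u) \<omega> \<le> exp (- (R 0 \<omega> * (real d - 1) * u))"
      unfolding eq by (rule cond_le[OF u])
    show "prob (ball_in_zero_cell M \<Theta> R u) \<le> exp (- ((real d - 1) * u))"
      unfolding eq d by (rule prob_ball_event_le[OF u])
    show "exp (- (2 * (real d - 1) * u)) \<le> prob (ball_in_zero_cell M \<Theta> R u)"
      unfolding eq d by (rule prob_ball_event_ge[OF u])
  qed
qed

end
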